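(* Let $L\supseteq\mathsf{K4.3}$ be a normal modal logic and let $\varphi_1,\varphi_2$ be formulas without a Craig interpolant in $L$; put $\delta=\mathit{sig}(\varphi_1)\cup\mathit{sig}(\varphi_2)$ and $\sigma=\mathit{sig}(\varphi_1)\cap\mathit{sig}(\varphi_2)$. Then there are rooted $\delta$-models $\mathfrak N_1,x_1$ and $\mathfrak N_2,x_2$ such that: (a) $\mathfrak N_1,x_1\models\varphi_1$ and $\mathfrak N_2,x_2\models\neg\varphi_2$; (b) each $\mathfrak N_i$ is based on a frame for $L$; (c) $\mathit{at}^\sigma_{\mathfrak N_1}(x_1)=\mathit{at}^\sigma_{\mathfrak N_2}(x_2)$; (d) there is $N=\mathcal O(\max(|\varphi_1|,|\varphi_2|))$ such that $\mathfrak N_i=\mathfrak N_i^0\lhd\dots\lhd\mathfrak N_i^{N-1}$ for $i=1,2$ and, for every $\ell<N$: (1) each $\mathfrak N_i^\ell$ is the ordered sum of $\mathcal O(\max(|\varphi_1|,|\varphi_2|))$-many simple $\delta$-models based on atomic frames, and (2) the pair $(\mathfrak N_1^\ell,\mathfrak N_2^\ell)$ is $\sigma$-matching.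
   Context: Modal formulas: variables $p_0,p_1,\dots$, $\top,\bot$, $\neg,\wedge,\Diamond$; $\Box=\neg\Diamond\neg$, $\Box^+\varphi=\varphi\wedge\Box\varphi$; $\mathit{sig}(\varphi)$ = variables of $\varphi$; $\mathit{sub}(\varphi)$ = set of subformulas of $\varphi$ and their negations, $|\varphi|:=|\mathit{sub}(\varphi)|$. Normal modal logics, $\mathsf K$, $\oplus$ as usual; $\mathsf{K4.3}=\mathsf{K}\oplus(\Box p_0\to\Box\Box p_0)\oplus(\Box(\Box^+p_0\to p_1)\vee\Box(\Box^+p_1\to p_0))$. Craig interpolant of $\varphi_1,\varphi_2$ in $L$: $\iota$ over $\mathit{sig}(\varphi_1)\cap\mathit{sig}(\varphi_2)$ with $\varphi_1\to\iota,\ \iota\to\varphi_2\in L$. General frames $(W,R,\mathcal P)$ ($\mathcal P\subseteq 2^W$ containing $\emptyset,W$, closed under $\cap$, complement, $\Diamond X=\{x\mid \exists y\in X\, xRy\}$), $\delta$-models $(\mathfrak F,\mathfrak v)$ with $\mathfrak v:\delta\to\mathcal P$, frames for $L$ (validating all formulas of $L$ under all valuations into $\mathcal P$), rooted pointed models ($xRy$ for all $y\ne x$). $\mathit{at}^\sigma_{\mathfrak M}(x)=\{p\in\sigma\mid x\in\mathfrak v(p)\}\cup\{\neg p\mid p\in\sigma,\ x\notin\mathfrak v(p)\}$. A cluster is a set $\{x\}\cup\{y\mid xRy\wedge yRx\}$; it is degenerate if it is a single irreflexive point. Ordered sum $\mathfrak F_0\lhd\dots\lhd\mathfrak F_{n-1}$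 of frames with disjoint universes: union of universes, $R=\bigcup R_i\cup\bigcup_{i<j}W_i\times W_j$, internal sets $X_0\cup\dots\cup X_{n-1}$ with $X_i$ internal in $\mathfrak F_i$; for models, union of valuations; the $\mathfrak M_i$ are the $\lhd$-components. $\mathfrak C(k,\bullet)$, $0<k<\omega$: points $a_0,\dots,a_{k-1},b_0,b_1,\dots$; $xRy$ iff $x=a_i$ (any $y$) or ($x=b_n,y=b_m,m<n$); internal sets generated by $X_i=\{a_i\}\cup\{b_n\mid n\equiv i\pmod k\}$, $i<k$, and all $\{b_n\}$. $\mathfrak C(k,\circ)$: same but all $b_n$ reflexive. The cluster $A_k=\{a_0,\dots,a_{k-1}\}$ is its root cluster. A $\delta$-model is simple if it is based on a finite Kripke frame, or on $\mathfrak C(k,\ast)$ with each $\mathfrak v(p)$ a union of some $X_i$. Atomic frames: $m^<$ (a chain of $m$ irreflexive points, $\bullet\lhd\dots\lhd\bullet$), $\circ\lhd m^<$ (one reflexive point followed by $m^<$), the $k$-point reflexive cluster, $\mathfrak C(k,\bullet)$, $\mathfrak C(k,\circ)$, where $0<m<\omega$ and $0<k\le 2^{|\delta|}$. $\sigma$-matching: for $\mathfrak N_1,\mathfrak N_2$ each an ordered sum of finitely many simple $\delta$-models on atomic frames, the pair is $\sigma$-matching if one of: (a) $\mathfrak N_1,\mathfrak N_2$ are simple models on the same atomic frame $\mathfrak H$ with $\mathit{at}^\sigma_{\mathfrak N_1}(y)=\mathit{at}^\sigma_{\mathfrak N_2}(y)$ for all $y$ in $\mathfrak H$; (b) the final clusters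 $C_i$ of $\mathfrak N_i$ are non-degenerate, for every $y_1$ in $\mathfrak N_1$ there is $y_2\in C_2$ with $\mathit{at}^\sigma_{\mathfrak N_1}(y_1)=\mathit{at}^\sigma_{\mathfrak N_2}(y_2)$, and for every $y_2$ in $\mathfrak N_2$ there is $y_1\in C_1$ with equal atomic $\sigma$-types; (c) the last $\lhd$-components of $\mathfrak N_1,\mathfrak N_2$ are based on the same atomic frame $\mathfrak G$ of the form $\mathfrak C(k,\bullet)$ or $\mathfrak C(k,\circ)$ ($0<k\le 2^{|\delta|}$), $\mathit{at}^\sigma_{\mathfrak N_1}(y)=\mathit{at}^\sigma_{\mathfrak N_2}(y)$ for all $y\in A_k$, and for every $y_1$ in a non-last $\lhd$-component of $\mathfrak N_1$ there is $y_2\in A_k$ (in $\mathfrak N_2$) with equal atomic $\sigma$-type, and symmetrically for non-last components of $\mathfrak N_2$. $\mathcal O(\cdot)$ bounds are in terms of $\max(|\varphi_1|,|\varphi_2|)$. *)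

theory Defs
  imports Main
begin

section \<open>Modal formulas and normal modal logics\<close>

datatype form =
    Var nat
  | Top
  | Bot
  | Neg form
  | And form form
  | Dia form

abbreviation Or :: "form \<Rightarrow> form \<Rightarrow> form" where
  "Or \<phi> \<psi> \<equiv> Neg (And (Neg \<phi>) (Neg \<psi>))"

abbreviation Imp :: "form \<Rightarrow> form \<Rightarrow> form" where
  "Imp \<phi> \<psi> \<equiv> Neg (And \<phi> (Neg \<psi>))"

abbreviation Iff :: "form \<Rightarrow> form \<Rightarrow> form" where
  "Iff \<phi> \<psi> \<equiv> And (Imp \<phi> \<psi>) (Imp \<psi> \<phi>)"

abbreviation Box :: "form \<Rightarrow> form" where
  "Box \<phi> \<equiv> Neg (Dia (Neg \<phi>))"

abbreviation BoxPlus :: "form \<Rightarrow> form" where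
  "BoxPlus \<phi> \<equiv> And \<phi> (Box \<phi>)"

fun sig :: "form \<Rightarrow> nat set" where
  "sig (Var p) = {p}"
| "sig Top = {}"
| "sig Bot = {}"
| "sig (Neg \<phi>) = sig \<phi>"
| "sig (And \<phi> \<psi>) = sig \<phi> \<union> sig \<psi>"
| "sig (Dia \<phi>) = sig \<phi>"

fun subforms :: "form \<Rightarrow> form set" where
  "subforms (Var p) = {Var p}"
| "subforms Top = {Top}"
| "subforms Bot = {Bot}"
| "subforms (Neg \<phi>) = insert (Neg \<phi>) (subforms \<phi>)"
| "subforms (And \<phi> \<psi>) = insert (And \<phi> \<psi>) (subforms \<phi> \<union> subforms \<psi>)"
| "subforms (Dia \<phi>) = insert (Dia \<phi>) (subforms \<phi>)"

definition sub :: "form \<Rightarrow> form set" where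
  "sub \<phi> = subforms \<phi> \<union> Neg ` subforms \<phi>"

definition flen :: "form \<Rightarrow> nat" where
  "flen \<phi> = card (sub \<phi>)"

fun subst :: "(nat \<Rightarrow> form) \<Rightarrow> form \<Rightarrow> form" where
  "subst s (Var p) = s p"
| "subst s Top = Top"
| "subst s Bot = Bot"
| "subst s (Neg \<phi>) = Neg (subst s \<phi>)"
| "subst s (And \<phi> \<psi>) = And (subst s \<phi>) (subst s \<psi>)"
| "subst s (Dia \<phi>) = Dia (subst s \<phi>)"

text \<open>Boolean evaluation, treating variables and formulas \<open>Dia \<phi>\<close> as propositional atoms.\<close>

fun beval :: "(form \<Rightarrow> bool) \<Rightarrow> form \<Rightarrow> bool" where
  "beval e (Var p) = e (Var p)"
| "beval e Top = True"
| "beval e Bot = False"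
| "beval e (Neg \<phi>) = (\<not> beval e \<phi>)"
| "beval e (And \<phi> \<psi>) = (beval e \<phi> \<and> beval e \<psi>)"
| "beval e (Dia \<phi>) = e (Dia \<phi>)"

definition tautology :: "form \<Rightarrow> bool" where
  "tautology \<phi> \<longleftrightarrow> (\<forall>e. beval e \<phi>)"

text \<open>Since \<open>Dia\<close> is primitive and \<open>Box\<close> is defined, the usual duality axiom
  \<open>Dia p \<leftrightarrow> \<not> Box \<not> p\<close> has to be listed alongside the axiom K.\<close>

definition normal_logic :: "form set \<Rightarrow> bool" where
  "normal_logic L \<longleftrightarrow>
     (\<forall>\<phi>. tautology \<phi> \<longrightarrow> \<phi> \<in> L) \<and>
     Imp (Box (Imp (Var 0) (Var 1))) (Imp (Box (Var 0)) (Box (Var 1))) \<in> L \<and>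
     Iff (Dia (Var 0)) (Neg (Box (Neg (Var 0)))) \<in> L \<and>
     (\<forall>\<phi> \<psi>. \<phi> \<in> L \<longrightarrow> Imp \<phi> \<psi> \<in> L \<longrightarrow> \<psi> \<in> L) \<and>
     (\<forall>\<phi>. \<phi> \<in> L \<longrightarrow> Box \<phi> \<in> L) \<and>
     (\<forall>s \<phi>. \<phi> \<in> L \<longrightarrow> subst s \<phi> \<in> L)"

definition logic_K :: "form set" where
  "logic_K = \<Inter>{L. normal_logic L}"

definition oplus :: "form set \<Rightarrow> form \<Rightarrow> form set" (infixl "\<oplus>\<^sub>L" 65) where
  "L \<oplus>\<^sub>L \<phi> = \<Inter>{L'. normal_logic L' \<and> L \<subseteq> L' \<and> \<phi> \<in> L'}"

definition logic_K43 :: "form set" where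
  "logic_K43 = logic_K
     \<oplus>\<^sub>L Imp (Box (Var 0)) (Box (Box (Var 0)))
     \<oplus>\<^sub>L Or (Box (Imp (BoxPlus (Var 0)) (Var 1))) (Box (Imp (BoxPlus (Var 1)) (Var 0)))"

definition craig_interpolant :: "form set \<Rightarrow> form \<Rightarrow> form \<Rightarrow> form \<Rightarrow> bool" where
  "craig_interpolant L \<phi>\<^sub>1 \<phi>\<^sub>2 \<iota> \<longleftrightarrow>
     sig \<iota> \<subseteq> sig \<phi>\<^sub>1 \<inter> sig \<phi>\<^sub>2 \<and> Imp \<phi>\<^sub>1 \<iota> \<in> L \<and> Imp \<iota> \<phi>\<^sub>2 \<in> L"


section \<open>General frames and models\<close>

datatype 'w frame =
  Frame (worlds: "'w set") (rel: "('w \<times> 'w) set") (internal: "'w set set")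

datatype 'w model =
  Model (frame_of: "'w frame") (val: "nat \<Rightarrow> 'w set")

definition dia_set :: "'w set \<Rightarrow> ('w \<times> 'w) set \<Rightarrow> 'w set \<Rightarrow> 'w set" where
  "dia_set W R X = {x \<in> W. \<exists>y\<in>X. (x, y) \<in> R}"

definition general_frame :: "'w frame \<Rightarrow> bool" where
  "general_frame F \<longleftrightarrow>
     worlds F \<noteq> {} \<and>
     rel F \<subseteq> worlds F \<times> worlds F \<and>
     internal F \<subseteq> Pow (worlds F) \<and>
     {} \<in> internal F \<and> worlds F \<in> internal F \<and>
     (\<forall>X\<in>internal F. \<forall>Y\<in>internal F. X \<inter> Y \<in> internal F) \<and>
     (\<forall>X\<in>internal F. worlds F - X \<in> internal F) \<and>
     (\<forall>X\<in>internal F. dia_set (worlds F) (rel F) X \<in> internal F)"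

text \<open>A \<open>\<delta>\<close>-model is represented with a total valuation; its values outside \<open>\<delta>\<close> are unconstrained
  and irrelevant.\<close>

definition delta_model :: "nat set \<Rightarrow> 'w model \<Rightarrow> bool" where
  "delta_model \<delta> M \<longleftrightarrow>
     general_frame (frame_of M) \<and> (\<forall>p\<in>\<delta>. val M p \<in> internal (frame_of M))"

fun sat :: "'w model \<Rightarrow> 'w \<Rightarrow> form \<Rightarrow> bool" where
  "sat M x (Var p) = (x \<in> val M p)"
| "sat M x Top = True"
| "sat M x Bot = False"
| "sat M x (Neg \<phi>) = (\<not> sat M x \<phi>)"
| "sat M x (And \<phi> \<psi>) = (sat M x \<phi> \<and> sat M x \<psi>)"
| "sat M x (Dia \<phi>) = (\<exists>y\<in>worlds (frame_of M). (x, y) \<in> rel (frame_of M) \<and> sat M y \<phi>)"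

definition frame_for :: "form set \<Rightarrow> 'w frame \<Rightarrow> bool" where
  "frame_for L F \<longleftrightarrow>
     general_frame F \<and>
     (\<forall>\<phi>\<in>L. \<forall>v. (\<forall>p. v p \<in> internal F) \<longrightarrow> (\<forall>x\<in>worlds F. sat (Model F v) x \<phi>))"

definition root :: "'w frame \<Rightarrow> 'w \<Rightarrow> bool" where
  "root F x \<longleftrightarrow> x \<in> worlds F \<and> (\<forall>y\<in>worlds F. y \<noteq> x \<longrightarrow> (x, y) \<in> rel F)"

definition rooted_delta_model :: "nat set \<Rightarrow> 'w model \<Rightarrow> 'w \<Rightarrow> bool" where
  "rooted_delta_model \<delta> M x \<longleftrightarrow> delta_model \<delta> M \<and> root (frame_of M) x"

definition at_type :: "nat set \<Rightarrow> 'w model \<Rightarrow> 'w \<Rightarrow> form set" where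
  "at_type \<sigma> M x = {Var p | p. p \<in> \<sigma> \<and> x \<in> val M p} \<union> {Neg (Var p) | p. p \<in> \<sigma> \<and> x \<notin> val M p}"

definition cluster_of :: "'w frame \<Rightarrow> 'w \<Rightarrow> 'w set" where
  "cluster_of F x = {x} \<union> {y. (x, y) \<in> rel F \<and> (y, x) \<in> rel F}"

definition is_cluster :: "'w frame \<Rightarrow> 'w set \<Rightarrow> bool" where
  "is_cluster F C \<longleftrightarrow> (\<exists>x\<in>worlds F. C = cluster_of F x)"

definition degenerate :: "'w frame \<Rightarrow> 'w set \<Rightarrow> bool" where
  "degenerate F C \<longleftrightarrow> (\<exists>x. C = {x} \<and> (x, x) \<notin> rel F)"

definition final_cluster :: "'w frame \<Rightarrow> 'w set \<Rightarrow> bool" where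
  "final_cluster F C \<longleftrightarrow> is_cluster F C \<and> (\<forall>x\<in>C. \<forall>y. (x, y) \<in> rel F \<longrightarrow> y \<in> C)"


section \<open>Ordered sums\<close>

text \<open>The universes of the summands are made disjoint by tagging every point of the \<open>i\<close>-th summand
  with \<open>i\<close>; thus \<open>(i, x)\<close> is the copy of \<open>x\<close> in the \<open>i\<close>-th \<open>\<lhd>\<close>-component.\<close>

definition osum_frame :: "'w frame list \<Rightarrow> (nat \<times> 'w) frame" where
  "osum_frame Fs = Frame
     (SIGMA i:{..<length Fs}. worlds (Fs ! i))
     ({((i, x), (i, y)) | i x y. i < length Fs \<and> (x, y) \<in> rel (Fs ! i)} \<union>
      {((i, x), (j, y)) | i j x y. i < j \<and> j < length Fs \<and>
                                   x \<in> worlds (Fs ! i) \<and> y \<in> worlds (Fs ! j)})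
     {SIGMA i:{..<length Fs}. X i | X. \<forall>i<length Fs. X i \<in> internal (Fs ! i)}"

definition osum_model :: "'w model list \<Rightarrow> (nat \<times> 'w) model" where
  "osum_model Ms = Model
     (osum_frame (map frame_of Ms))
     (\<lambda>p. SIGMA i:{..<length Ms}. val (Ms ! i) p)"


section \<open>Atomic frames and simple models\<close>

text \<open>All atomic frames live on one type of points: \<open>A i\<close> stands for \<open>a\<^sub>i\<close> and \<open>B n\<close> for \<open>b\<^sub>n\<close>. The
  chains and the finite clusters only use points \<open>A i\<close>.\<close>

datatype point = A nat | B nat

definition kripke_frame :: "'w set \<Rightarrow> ('w \<times> 'w) set \<Rightarrow> 'w frame" where
  "kripke_frame W R = Frame W R (Pow W)"

text \<open>\<open>m\<^sup><\<close>\<close>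
definition irr_chain :: "nat \<Rightarrow> point frame" where
  "irr_chain m = kripke_frame {A i | i. i < m} {(A i, A j) | i j. i < j \<and> j < m}"

text \<open>\<open>\<circ> \<lhd> m\<^sup><\<close>: the reflexive point is \<open>A 0\<close>.\<close>
definition refl_irr_chain :: "nat \<Rightarrow> point frame" where
  "refl_irr_chain m =
     kripke_frame {A i | i. i \<le> m} ({(A 0, A 0)} \<union> {(A i, A j) | i j. i < j \<and> j \<le> m})"

definition refl_cluster :: "nat \<Rightarrow> point frame" where
  "refl_cluster k = kripke_frame {A i | i. i < k} {(A i, A j) | i j. i < k \<and> j < k}"

definition root_cluster :: "nat \<Rightarrow> point set" where
  "root_cluster k = {A i | i. i < k}"

text \<open>The universe and relation of \<open>\<CC>(k,\<bullet>)\<close> (for \<open>r = False\<close>) and \<open>\<CC>(k,\<circ>)\<close> (for \<open>r = True\<close>).\<close>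

definition C_worlds :: "nat \<Rightarrow> point set" where
  "C_worlds k = root_cluster k \<union> range B"

definition C_rel :: "bool \<Rightarrow> nat \<Rightarrow> (point \<times> point) set" where
  "C_rel r k =
     root_cluster k \<times> C_worlds k \<union> {(B n, B m) | n m. m < n \<or> (r \<and> m = n)}"

definition C_gen :: "nat \<Rightarrow> nat \<Rightarrow> point set" where
  "C_gen k i = {A i} \<union> {B n | n. n mod k = i}"

inductive_set generated :: "'w set \<Rightarrow> ('w \<times> 'w) set \<Rightarrow> 'w set set \<Rightarrow> 'w set set"
  for W :: "'w set" and R :: "('w \<times> 'w) set" and G :: "'w set set" where
  gen_base: "X \<in> G \<Longrightarrow> X \<in> generated W R G"
| gen_empty: "{} \<in> generated W R G"
| gen_univ: "W \<in> generated W R G"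
| gen_int: "X \<in> generated W R G \<Longrightarrow> Y \<in> generated W R G \<Longrightarrow> X \<inter> Y \<in> generated W R G"
| gen_compl: "X \<in> generated W R G \<Longrightarrow> W - X \<in> generated W R G"
| gen_dia: "X \<in> generated W R G \<Longrightarrow> dia_set W R X \<in> generated W R G"

definition C_frame :: "bool \<Rightarrow> nat \<Rightarrow> point frame" where
  "C_frame r k = Frame (C_worlds k) (C_rel r k)
     (generated (C_worlds k) (C_rel r k) ({C_gen k i | i. i < k} \<union> {{B n} | n. True}))"

definition atomic_frame :: "nat set \<Rightarrow> point frame \<Rightarrow> bool" where
  "atomic_frame \<delta> H \<longleftrightarrow>
     (\<exists>m>0. H = irr_chain m) \<or>
     (\<exists>m>0. H = refl_irr_chain m) \<or>
     (\<exists>k>0. k \<le> 2 ^ card \<delta> \<and> (H = refl_cluster k \<or> H = C_frame False k \<or> H = C_frame True k))"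

definition simple_model :: "nat set \<Rightarrow> point model \<Rightarrow> bool" where
  "simple_model \<delta> M \<longleftrightarrow> delta_model \<delta> M \<and>
     ((finite (worlds (frame_of M)) \<and> internal (frame_of M) = Pow (worlds (frame_of M))) \<or>
      (\<exists>r. \<exists>k>0. frame_of M = C_frame r k \<and>
         (\<forall>p\<in>\<delta>. \<exists>I\<subseteq>{..<k}. val M p = (\<Union>i\<in>I. C_gen k i))))"

definition simple_atomic :: "nat set \<Rightarrow> point model \<Rightarrow> bool" where
  "simple_atomic \<delta> M \<longleftrightarrow> simple_model \<delta> M \<and> atomic_frame \<delta> (frame_of M)"


section \<open>Matching pairs\<close>

text \<open>Matching refers to the \<open>\<lhd>\<close>-components, so it is a relation between the (nonempty) lists of
  components of the two models; the models themselves are the ordered sums of these lists. A simple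
  model on an atomic frame is a one-element list.\<close>

definition matching_a :: "nat set \<Rightarrow> nat set \<Rightarrow> point model list \<Rightarrow> point model list \<Rightarrow> bool" where
  "matching_a \<delta> \<sigma> Ms\<^sub>1 Ms\<^sub>2 \<longleftrightarrow>
     (\<exists>M\<^sub>1 M\<^sub>2 H. Ms\<^sub>1 = [M\<^sub>1] \<and> Ms\<^sub>2 = [M\<^sub>2] \<and>
        simple_model \<delta> M\<^sub>1 \<and> simple_model \<delta> M\<^sub>2 \<and>
        atomic_frame \<delta> H \<and> frame_of M\<^sub>1 = H \<and> frame_of M\<^sub>2 = H \<and>
        (\<forall>y\<in>worlds H. at_type \<sigma> M\<^sub>1 y = at_type \<sigma> M\<^sub>2 y))"

definition matching_b :: "nat set \<Rightarrow> 'w model \<Rightarrow> 'w model \<Rightarrow> bool" where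
  "matching_b \<sigma> N\<^sub>1 N\<^sub>2 \<longleftrightarrow>
     (\<exists>C\<^sub>1 C\<^sub>2. final_cluster (frame_of N\<^sub>1) C\<^sub>1 \<and> \<not> degenerate (frame_of N\<^sub>1) C\<^sub>1 \<and>
        final_cluster (frame_of N\<^sub>2) C\<^sub>2 \<and> \<not> degenerate (frame_of N\<^sub>2) C\<^sub>2 \<and>
        (\<forall>y\<^sub>1\<in>worlds (frame_of N\<^sub>1). \<exists>y\<^sub>2\<in>C\<^sub>2. at_type \<sigma> N\<^sub>1 y\<^sub>1 = at_type \<sigma> N\<^sub>2 y\<^sub>2) \<and>
        (\<forall>y\<^sub>2\<in>worlds (frame_of N\<^sub>2). \<exists>y\<^sub>1\<in>C\<^sub>1. at_type \<sigma> N\<^sub>1 y\<^sub>1 = at_type \<sigma> N\<^sub>2 y\<^sub>2))"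

definition matching_c :: "nat set \<Rightarrow> nat set \<Rightarrow> point model list \<Rightarrow> point model list \<Rightarrow> bool" where
  "matching_c \<delta> \<sigma> Ms\<^sub>1 Ms\<^sub>2 \<longleftrightarrow>
     Ms\<^sub>1 \<noteq> [] \<and> Ms\<^sub>2 \<noteq> [] \<and>
     (\<exists>r. \<exists>k>0. k \<le> 2 ^ card \<delta> \<and>
        frame_of (last Ms\<^sub>1) = C_frame r k \<and> frame_of (last Ms\<^sub>2) = C_frame r k \<and>
        (\<forall>y\<in>root_cluster k. at_type \<sigma> (last Ms\<^sub>1) y = at_type \<sigma> (last Ms\<^sub>2) y) \<and>
        (\<forall>M\<in>set (butlast Ms\<^sub>1). \<forall>y\<^sub>1\<in>worlds (frame_of M).
           \<exists>y\<^sub>2\<in>root_cluster k. at_type \<sigma> M y\<^sub>1 = at_type \<sigma> (last Ms\<^sub>2) y\<^sub>2) \<and>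
        (\<forall>M\<in>set (butlast Ms\<^sub>2). \<forall>y\<^sub>2\<in>worlds (frame_of M).
           \<exists>y\<^sub>1\<in>root_cluster k. at_type \<sigma> (last Ms\<^sub>1) y\<^sub>1 = at_type \<sigma> M y\<^sub>2))"

definition sigma_matching :: "nat set \<Rightarrow> nat set \<Rightarrow> point model list \<Rightarrow> point model list \<Rightarrow> bool" where
  "sigma_matching \<delta> \<sigma> Ms\<^sub>1 Ms\<^sub>2 \<longleftrightarrow>
     matching_a \<delta> \<sigma> Ms\<^sub>1 Ms\<^sub>2 \<or>
     matching_b \<sigma> (osum_model Ms\<^sub>1) (osum_model Ms\<^sub>2) \<or>
     matching_c \<delta> \<sigma> Ms\<^sub>1 Ms\<^sub>2"

end

theory Submission
  imports Defs
begin

text \<open>In the canonical models over \<open>\<delta>\<close> and over \<open>\<sigma>\<close>, the absence of an interpolant yields points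
  \<open>x\<^sub>1\<close>, \<open>x\<^sub>2\<close> over \<open>\<delta>\<close> with the same restriction \<open>t\<close> to \<open>\<sigma>\<close>, and restriction maps the two linearly
  ordered submodels generated by \<open>x\<^sub>1\<close> and \<open>x\<^sub>2\<close> p-morphically onto the one generated by \<open>t\<close>. There,
  every formula that holds somewhere holds for a last time, and finitely many such last points
  decide all subformulas. The canonical models are cut into definable intervals. An interval
  ending in a nondegenerate cluster can be collapsed to that cluster; a finite run of irreflexive
  points is kept; and an interval containing arbitrarily long runs of irreflexive points, or
  arbitrarily many definable cuts at nondegenerate clusters, can stand for \<open>\<CC>(k,\<bullet>)\<close> or \<open>\<CC>(k,\<circ>)\<close>, since a
  formula only sees a bounded part of such a sequence. A valuation on the resulting sum pulls back
  to a definable valuation on the canonical model, so the sum is a frame for \<open>L\<close>. Cutting along the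
  model generated by \<open>t\<close> treats both sides simultaneously: fibres of irreflexive points are
  single points, and the last cluster of the fibre of a nondegenerate cluster maps onto it.\<close>

section \<open>Maximal consistent sets\<close>

text \<open>Each constructed model is tied to the canonical one by two maps in opposite directions.
  The map \<open>h\<close> from worlds to the points they copy settles truth; it needs a back
  condition only for finitely many relevant points, which is why whole intervals may be collapsed
  and why all bounds are linear. The map \<open>g\<close> from the canonical model to the frame
  settles validity: a valuation pulled back along it must consist of formulas, so that closure of
  \<open>L\<close> under substitution applies. Hence cuts must be definable, and the obstacle is
  that a cluster \<open>d\<close> of the model generated by \<open>t\<close> need not be definably
  separable from the points after it. When it is separable, the two fibres are cut off right after
  it and only their final clusters have to agree. When it is not, the components are extended beyond
  the fibres, up to a cut separated from \<open>d\<close> by arbitrarily many layers; the limit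
  cluster becomes the root cluster of a \<open>C_frame\<close>, indexed by the cluster of
  \<open>d\<close> so that both sides get the same frame. Each relevant cluster costs one pair for
  its fibre and at most two for the stretch after it.\<close>

definition Fm :: "nat set \<Rightarrow> form set" where
  "Fm \<tau> = {\<phi>. sig \<phi> \<subseteq> \<tau>}"

fun Conj :: "form list \<Rightarrow> form" where
  "Conj [] = Top"
| "Conj (\<phi> # \<phi>s) = And \<phi> (Conj \<phi>s)"

lemma beval_Conj [simp]: "beval e (Conj \<phi>s) \<longleftrightarrow> (\<forall>\<phi>\<in>set \<phi>s. beval e \<phi>)"
  by (induction \<phi>s) auto

lemma sig_Conj [simp]: "sig (Conj \<phi>s) = \<Union> (sig ` set \<phi>s)"
  by (induction \<phi>s) auto

lemma Fm_simps [simp]: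
  "Var p \<in> Fm \<tau> \<longleftrightarrow> p \<in> \<tau>" "Top \<in> Fm \<tau>" "Bot \<in> Fm \<tau>"
  "Neg \<phi> \<in> Fm \<tau> \<longleftrightarrow> \<phi> \<in> Fm \<tau>"
  "And \<phi> \<psi> \<in> Fm \<tau> \<longleftrightarrow> \<phi> \<in> Fm \<tau> \<and> \<psi> \<in> Fm \<tau>"
  "Dia \<phi> \<in> Fm \<tau> \<longleftrightarrow> \<phi> \<in> Fm \<tau>"
  "Conj \<phi>s \<in> Fm \<tau> \<longleftrightarrow> set \<phi>s \<subseteq> Fm \<tau>"
  by (auto simp: Fm_def)

lemma Fm_mono: "\<sigma> \<subseteq> \<tau> \<Longrightarrow> Fm \<sigma> \<subseteq> Fm \<tau>"
  by (auto simp: Fm_def)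

locale K43_logic =
  fixes L :: "form set"
  assumes normal: "normal_logic L" and K43: "logic_K43 \<subseteq> L"
begin

lemma taut: "(\<And>e. beval e \<phi>) \<Longrightarrow> \<phi> \<in> L"
  using normal by (simp add: normal_logic_def tautology_def)

lemma mp: "Imp \<phi> \<psi> \<in> L \<Longrightarrow> \<phi> \<in> L \<Longrightarrow> \<psi> \<in> L"
  using normal unfolding normal_logic_def by blast

lemma nec: "\<phi> \<in> L \<Longrightarrow> Box \<phi> \<in> L"
  using normal unfolding normal_logic_def by blast

lemma subst_in: "\<phi> \<in> L \<Longrightarrow> subst s \<phi> \<in> L"
  using normal unfolding normal_logic_def by blast

lemma taut_mp: "\<phi> \<in> L \<Longrightarrow> (\<And>e. beval e \<phi> \<Longrightarrow> beval e \<psi>) \<Longrightarrow> \<psi> \<in> L"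
  by (rule mp[of \<phi>]) (auto intro: taut)

lemma taut_mp2:
  assumes "\<phi> \<in> L" "\<chi> \<in> L" "\<And>e. beval e \<phi> \<Longrightarrow> beval e \<chi> \<Longrightarrow> beval e \<psi>"
  shows "\<psi> \<in> L"
proof -
  have "Imp \<phi> (Imp \<chi> \<psi>) \<in> L" using assms(3) by (auto intro: taut)
  then show ?thesis using mp assms(1,2) by blast
qed

lemma K_inst: "Imp (Box (Imp \<phi> \<psi>)) (Imp (Box \<phi>) (Box \<psi>)) \<in> L"
proof -
  have "Imp (Box (Imp (Var 0) (Var 1))) (Imp (Box (Var 0)) (Box (Var 1))) \<in> L"
    using normal unfolding normal_logic_def by blast
  from subst_in[OF this, of "\<lambda>n. if n = 0 then \<phi> else \<psi>"] show ?thesis by simp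
qed

lemma axiom_4: "Imp (Box \<phi>) (Box (Box \<phi>)) \<in> L"
proof -
  have "Imp (Box (Var 0)) (Box (Box (Var 0))) \<in> L"
    using K43 unfolding logic_K43_def oplus_def by blast
  from subst_in[OF this, of "\<lambda>n. \<phi>"] show ?thesis by simp
qed

lemma axiom_3: "Or (Box (Imp (BoxPlus \<phi>) \<psi>)) (Box (Imp (BoxPlus \<psi>) \<phi>)) \<in> L"
proof -
  have "Or (Box (Imp (BoxPlus (Var 0)) (Var 1))) (Box (Imp (BoxPlus (Var 1)) (Var 0))) \<in> L"
    using K43 unfolding logic_K43_def oplus_def by blast
  from subst_in[OF this, of "\<lambda>n. if n = 0 then \<phi> else \<psi>"] show ?thesis by simp
qed

lemma Box_mono: "Imp \<phi> \<psi> \<in> L \<Longrightarrow> Imp (Box \<phi>) (Box \<psi>) \<in> L"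
  using K_inst nec mp by blast

definition con :: "form set \<Rightarrow> bool" where
  "con \<Gamma> \<longleftrightarrow> (\<forall>\<phi>s. set \<phi>s \<subseteq> \<Gamma> \<longrightarrow> Neg (Conj \<phi>s) \<notin> L)"

definition mcs :: "nat set \<Rightarrow> form set \<Rightarrow> bool" where
  "mcs \<tau> u \<longleftrightarrow> u \<subseteq> Fm \<tau> \<and> con u \<and> (\<forall>\<phi>\<in>Fm \<tau>. \<phi> \<in> u \<or> Neg \<phi> \<in> u)"

lemma con_subset: "con \<Gamma> \<Longrightarrow> \<Delta> \<subseteq> \<Gamma> \<Longrightarrow> con \<Delta>"
  by (auto simp: con_def)

lemma not_conE:
  assumes "\<not> con \<Gamma>"
  obtains \<phi>s where "set \<phi>s \<subseteq> \<Gamma>" "Neg (Conj \<phi>s) \<in> L"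
proof -
  have "\<exists>\<phi>s. set \<phi>s \<subseteq> \<Gamma> \<and> Neg (Conj \<phi>s) \<in> L"
    using assms by (simp add: con_def)
  then show thesis using that by (elim exE conjE)
qed

text \<open>If both extensions were inconsistent, the two refuting lists with \<phi> and its
  negation removed would together refute \<Gamma>, by cases on the truth of \<phi>.\<close>

lemma con_insert:
  assumes "con \<Gamma>"
  shows "con (insert \<phi> \<Gamma>) \<or> con (insert (Neg \<phi>) \<Gamma>)"
proof (rule ccontr)
  assume "\<not> ?thesis"
  then have n: "\<not> con (insert \<phi> \<Gamma>)" "\<not> con (insert (Neg \<phi>) \<Gamma>)" by simp_all
  obtain as where as: "set as \<subseteq> insert \<phi> \<Gamma>" "Neg (Conj as) \<in> L"
    by (rule not_conE[OF n(1)])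
  obtain bs where bs: "set bs \<subseteq> insert (Neg \<phi>) \<Gamma>" "Neg (Conj bs) \<in> L"
    by (rule not_conE[OF n(2)])
  let ?cs = "filter (\<lambda>x. x \<noteq> \<phi>) as @ filter (\<lambda>x. x \<noteq> Neg \<phi>) bs"
  have "Neg (Conj ?cs) \<in> L"
  proof (rule taut_mp2[OF as(2) bs(2)])
    fix e assume "beval e (Neg (Conj as))" "beval e (Neg (Conj bs))"
    then obtain a b where "a \<in> set as" "\<not> beval e a" "b \<in> set bs" "\<not> beval e b" by auto
    then have "a \<in> set ?cs \<or> b \<in> set ?cs" by (cases "beval e \<phi>") auto
    then show "beval e (Neg (Conj ?cs))"
      using \<open>\<not> beval e a\<close> \<open>\<not> beval e b\<close> by (simp only: beval.simps beval_Conj) blast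
  qed
  moreover have "set ?cs \<subseteq> \<Gamma>" using as bs by auto
  ultimately show False using assms unfolding con_def by blast
qed

lemma mcs_extend:
  assumes "\<Gamma> \<subseteq> Fm \<tau>" "con \<Gamma>"
  obtains u where "mcs \<tau> u" "\<Gamma> \<subseteq> u"
proof -
  let ?F = "{\<Delta>. \<Gamma> \<subseteq> \<Delta> \<and> \<Delta> \<subseteq> Fm \<tau> \<and> con \<Delta>}"
  have "\<exists>M\<in>?F. \<forall>X\<in>?F. M \<subseteq> X \<longrightarrow> X = M"
  proof (rule subset_Zorn_nonempty)
    show "?F \<noteq> {}" using assms by blast
  next
    fix \<C> assume ne: "\<C> \<noteq> {}" and ch: "subset.chain ?F \<C>"
    have sub: "\<C> \<subseteq> ?F" and lin: "\<And>X Y. X \<in> \<C> \<Longrightarrow> Y \<in> \<C> \<Longrightarrow> X \<subseteq> Y \<or> Y \<subseteq> X"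
      using ch by (auto simp: subset_chain_def)
    have "con (\<Union>\<C>)" unfolding con_def
    proof (intro allI impI)
      fix \<phi>s assume "set \<phi>s \<subseteq> \<Union>\<C>"
      then obtain X where "X \<in> \<C>" "set \<phi>s \<subseteq> X"
        using finite_subset_Union_chain[of "set \<phi>s" \<C> ?F] ne ch by auto
      then show "Neg (Conj \<phi>s) \<notin> L" using sub unfolding con_def by blast
    qed
    moreover have "\<Gamma> \<subseteq> \<Union>\<C>" using sub ne by fast
    moreover have "\<Union>\<C> \<subseteq> Fm \<tau>" using sub by fast
    ultimately show "\<Union>\<C> \<in> ?F" by simp
  qed
  then obtain u where "u \<in> ?F" and m: "\<forall>X\<in>?F. u \<subseteq> X \<longrightarrow> X = u" by (rule bexE)
  then have u: "\<Gamma> \<subseteq> u" "u \<subseteq> Fm \<tau>" "con u" by auto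
  have mx: "X = u" if "\<Gamma> \<subseteq> X" "X \<subseteq> Fm \<tau>" "con X" "u \<subseteq> X" for X
    using bspec[OF m, of X] that by auto
  have "\<phi> \<in> u \<or> Neg \<phi> \<in> u" if "\<phi> \<in> Fm \<tau>" for \<phi>
  proof -
    have *: "insert \<psi> u = u" if "con (insert \<psi> u)" "\<psi> \<in> Fm \<tau>" for \<psi>
      using mx[of "insert \<psi> u"] u that by auto
    show ?thesis using con_insert[OF u(3), of \<phi>] *[of \<phi>] *[of "Neg \<phi>"] that by auto
  qed
  then have "mcs \<tau> u" using u by (simp add: mcs_def)
  then show thesis using that u(1) by simp
qed

lemma mcs_Fm: "mcs \<tau> u \<Longrightarrow> \<phi> \<in> u \<Longrightarrow> \<phi> \<in> Fm \<tau>"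
  by (auto simp: mcs_def)

lemma mcs_closed:
  assumes "mcs \<tau> u" "set \<phi>s \<subseteq> u" "Imp (Conj \<phi>s) \<psi> \<in> L" "\<psi> \<in> Fm \<tau>"
  shows "\<psi> \<in> u"
proof (rule ccontr)
  assume "\<psi> \<notin> u"
  then have "Neg \<psi> \<in> u" using assms by (auto simp: mcs_def)
  then have "set (Neg \<psi> # \<phi>s) \<subseteq> u" using assms by auto
  moreover have "Neg (Conj (Neg \<psi> # \<phi>s)) \<in> L"
    by (rule taut_mp[OF assms(3)]) auto
  ultimately show False using assms(1) unfolding mcs_def con_def by blast
qed

lemma mcs_L: "mcs \<tau> u \<Longrightarrow> \<psi> \<in> L \<Longrightarrow> \<psi> \<in> Fm \<tau> \<Longrightarrow> \<psi> \<in> u"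
  by (rule mcs_closed[of \<tau> u "[]"]) (auto intro: taut_mp)

lemma mcs_imp: "mcs \<tau> u \<Longrightarrow> Imp \<phi> \<psi> \<in> L \<Longrightarrow> \<phi> \<in> u \<Longrightarrow> \<psi> \<in> Fm \<tau> \<Longrightarrow> \<psi> \<in> u"
  by (rule mcs_closed[of \<tau> u "[\<phi>]"]) (auto intro: taut_mp)

lemma mcs_taut:
  "mcs \<tau> u \<Longrightarrow> set \<phi>s \<subseteq> u \<Longrightarrow> \<psi> \<in> Fm \<tau> \<Longrightarrow> (\<And>e. \<forall>\<phi>\<in>set \<phi>s. beval e \<phi> \<Longrightarrow> beval e \<psi>) \<Longrightarrow> \<psi> \<in> u"
  by (rule mcs_closed[of \<tau> u \<phi>s])
    (assumption, assumption, rule taut, simp only: beval.simps beval_Conj, blast, assumption)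

lemma mcs_Neg: "mcs \<tau> u \<Longrightarrow> \<phi> \<in> Fm \<tau> \<Longrightarrow> Neg \<phi> \<in> u \<longleftrightarrow> \<phi> \<notin> u"
proof (rule iffI)
  assume u: "mcs \<tau> u" and n: "Neg \<phi> \<in> u"
  show "\<phi> \<notin> u"
  proof
    assume "\<phi> \<in> u"
    then have "set [\<phi>, Neg \<phi>] \<subseteq> u" using n by auto
    moreover have "Neg (Conj [\<phi>, Neg \<phi>]) \<in> L" by (rule taut) auto
    ultimately show False using u unfolding mcs_def con_def by blast
  qed
qed (auto simp: mcs_def)

lemma mcs_And: "mcs \<tau> u \<Longrightarrow> And \<phi> \<psi> \<in> u \<longleftrightarrow> \<phi> \<in> u \<and> \<psi> \<in> u"
proof (intro iffI conjI)
  assume u: "mcs \<tau> u" and a: "And \<phi> \<psi> \<in> u"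
  have f: "And \<phi> \<psi> \<in> Fm \<tau>" using mcs_Fm u a by blast
  show "\<phi> \<in> u" by (rule mcs_taut[OF u, of "[And \<phi> \<psi>]"]) (use a f in auto)
  show "\<psi> \<in> u" by (rule mcs_taut[OF u, of "[And \<phi> \<psi>]"]) (use a f in auto)
next
  assume u: "mcs \<tau> u" and a: "\<phi> \<in> u \<and> \<psi> \<in> u"
  then show "And \<phi> \<psi> \<in> u"
    using mcs_Fm[OF u] by (intro mcs_taut[OF u, of "[\<phi>, \<psi>]"]) auto
qed

lemma mcs_Top: "mcs \<tau> u \<Longrightarrow> Top \<in> u"
  by (rule mcs_taut[of \<tau> u "[]"]) auto

lemma mcs_Bot: "mcs \<tau> u \<Longrightarrow> Bot \<notin> u"
  using mcs_Neg[of \<tau> u Bot] mcs_taut[of \<tau> u "[]" "Neg Bot"] by auto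

lemma mcs_Or: "mcs \<tau> u \<Longrightarrow> \<phi> \<in> Fm \<tau> \<Longrightarrow> \<psi> \<in> Fm \<tau> \<Longrightarrow> Or \<phi> \<psi> \<in> u \<longleftrightarrow> \<phi> \<in> u \<or> \<psi> \<in> u"
  using mcs_Neg mcs_And by auto

lemma mcs_Conj: "mcs \<tau> u \<Longrightarrow> Conj \<phi>s \<in> u \<longleftrightarrow> set \<phi>s \<subseteq> u"
  by (induction \<phi>s) (auto simp: mcs_And mcs_Top)

lemma mcs_eqI: "mcs \<tau> u \<Longrightarrow> mcs \<tau> v \<Longrightarrow> u \<subseteq> v \<Longrightarrow> u = v"
  using mcs_Neg mcs_Fm by blast

text \<open>Splitting the refuting list by membership in \<Gamma> turns inconsistency of a union
  into an implication, the form that can be boxed in the existence lemma or read as an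
  interpolant.\<close>

lemma not_conD:
  assumes "\<not> con (\<Gamma> \<union> \<Delta>)"
  obtains \<phi>s \<psi>s where "set \<phi>s \<subseteq> \<Gamma>" "set \<psi>s \<subseteq> \<Delta>" "Imp (Conj \<phi>s) (Neg (Conj \<psi>s)) \<in> L"
proof -
  obtain as where as: "set as \<subseteq> \<Gamma> \<union> \<Delta>" "Neg (Conj as) \<in> L"
    by (rule not_conE[OF assms])
  show thesis
  proof (rule that[of "filter (\<lambda>a. a \<in> \<Gamma>) as" "filter (\<lambda>a. a \<notin> \<Gamma>) as"])
    show "Imp (Conj (filter (\<lambda>a. a \<in> \<Gamma>) as)) (Neg (Conj (filter (\<lambda>a. a \<notin> \<Gamma>) as))) \<in> L"
      by (rule taut_mp[OF as(2)]) auto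
  qed (use as in auto)
qed

section \<open>The canonical accessibility relation\<close>

definition acc :: "form set \<Rightarrow> form set \<Rightarrow> bool" where
  "acc u v \<longleftrightarrow> (\<forall>\<chi>. Box \<chi> \<in> u \<longrightarrow> \<chi> \<in> v)"

definition unbox :: "form set \<Rightarrow> form set" where
  "unbox u = {\<chi>. Box \<chi> \<in> u}"

lemma acc_unbox: "acc u v \<longleftrightarrow> unbox u \<subseteq> v"
  by (auto simp: acc_def unbox_def)

lemma Box_Conj:
  assumes "mcs \<tau> u" "set \<phi>s \<subseteq> unbox u" shows "Box (Conj \<phi>s) \<in> u"
  using assms(2)
proof (induction \<phi>s)
  case Nil
  have "Box (Conj []) \<in> L" by (rule nec) (rule taut, simp)
  then show ?case by (rule mcs_L[OF assms(1)]) simp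
next
  case (Cons \<phi> \<phi>s)
  then have a: "Box \<phi> \<in> u" "Box (Conj \<phi>s) \<in> u" by (auto simp: unbox_def)
  have "Imp (Box \<phi>) (Box (Imp (Conj \<phi>s) (And \<phi> (Conj \<phi>s)))) \<in> L"
    by (rule Box_mono, rule taut) auto
  from this K_inst[of "Conj \<phi>s" "And \<phi> (Conj \<phi>s)"]
  have "Imp (Conj [Box \<phi>, Box (Conj \<phi>s)]) (Box (And \<phi> (Conj \<phi>s))) \<in> L"
    by (rule taut_mp2) auto
  then show ?case using a mcs_Fm[OF assms(1) a(1)] mcs_Fm[OF assms(1) a(2)]
    by (intro mcs_closed[OF assms(1), of "[Box \<phi>, Box (Conj \<phi>s)]"]) auto
qed

lemma Box_Neg_iff: "mcs \<tau> u \<Longrightarrow> \<phi> \<in> Fm \<tau> \<Longrightarrow> Box (Neg \<phi>) \<in> u \<longleftrightarrow> Dia \<phi> \<notin> u"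
proof -
  assume u: "mcs \<tau> u" and f: "\<phi> \<in> Fm \<tau>"
  have "Iff (Dia (Var 0)) (Neg (Box (Neg (Var 0)))) \<in> L"
    using normal unfolding normal_logic_def by blast
  from subst_in[OF this, of "\<lambda>n. \<phi>"]
  have *: "Iff (Dia \<phi>) (Neg (Box (Neg \<phi>))) \<in> L" by simp
  have "Iff (Dia \<phi>) (Neg (Box (Neg \<phi>))) \<in> u" by (rule mcs_L[OF u *]) (use f in auto)
  then have "Imp (Dia \<phi>) (Neg (Box (Neg \<phi>))) \<in> u" "Imp (Neg (Box (Neg \<phi>))) (Dia \<phi>) \<in> u"
    using mcs_And[OF u] by blast+
  then show ?thesis using mcs_Neg[OF u] mcs_And[OF u] f by (metis Fm_simps(4,5,6))
qed

lemma acc_Dia: "mcs \<tau> u \<Longrightarrow> mcs \<tau> v \<Longrightarrow> acc u v \<Longrightarrow> \<phi> \<in> v \<Longrightarrow> Dia \<phi> \<in> u"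
  using Box_Neg_iff[of \<tau> u \<phi>] mcs_Fm[of \<tau> v \<phi>] mcs_Neg[of \<tau> v \<phi>] unfolding acc_def by blast

lemma Box_alt: "mcs \<tau> u \<Longrightarrow> \<phi> \<in> Fm \<tau> \<Longrightarrow> Box \<phi> \<in> u \<longleftrightarrow> Dia (Neg \<phi>) \<notin> u"
  by (simp add: mcs_Neg)

lemma acc_iff_Dia: "mcs \<tau> u \<Longrightarrow> mcs \<tau> v \<Longrightarrow> acc u v \<longleftrightarrow> (\<forall>\<phi>\<in>v. Dia \<phi> \<in> u)"
proof
  assume u: "mcs \<tau> u" and v: "mcs \<tau> v" and d: "\<forall>\<phi>\<in>v. Dia \<phi> \<in> u"
  show "acc u v" unfolding acc_def
  proof (intro allI impI)
    fix \<chi> assume b: "Box \<chi> \<in> u"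
    then have "\<chi> \<in> Fm \<tau>" using mcs_Fm[OF u b] by auto
    then show "\<chi> \<in> v" using b d Box_alt[OF u] mcs_Neg[OF v] by blast
  qed
qed (use acc_Dia in blast)

text \<open>The relative form, with \<open>\<Gamma>\<close> over a smaller signature, also shows that restricting
  maximal consistent sets to that signature is a p-morphism.\<close>

lemma acc_extend:
  assumes u: "mcs \<tau> u" and G: "\<Gamma> \<subseteq> Fm \<tau>"
    and fin: "\<And>\<phi>s. set \<phi>s \<subseteq> \<Gamma> \<Longrightarrow> Dia (Conj \<phi>s) \<in> u"
  obtains v where "mcs \<tau> v" "acc u v" "\<Gamma> \<subseteq> v"
proof -
  have sub: "unbox u \<union> \<Gamma> \<subseteq> Fm \<tau>" using G mcs_Fm[OF u] by (force simp: unbox_def)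
  have "con (unbox u \<union> \<Gamma>)"
  proof (rule ccontr)
    assume "\<not> con (unbox u \<union> \<Gamma>)"
    then obtain as bs where as: "set as \<subseteq> unbox u" and bs: "set bs \<subseteq> \<Gamma>"
      and i: "Imp (Conj as) (Neg (Conj bs)) \<in> L" by (rule not_conD)
    have f: "Conj bs \<in> Fm \<tau>" using bs G by auto
    have "Box (Neg (Conj bs)) \<in> u"
      by (rule mcs_imp[OF u Box_mono[OF i] Box_Conj[OF u as]]) (use f in auto)
    then show False using Box_Neg_iff[OF u f] fin[OF bs] by simp
  qed
  then obtain v where "mcs \<tau> v" "unbox u \<union> \<Gamma> \<subseteq> v" using mcs_extend sub by blast
  then show thesis using that by (auto simp: acc_unbox)
qed

lemma Dia_mono: "mcs \<tau> u \<Longrightarrow> Imp \<phi> \<psi> \<in> L \<Longrightarrow> Dia \<phi> \<in> u \<Longrightarrow> \<psi> \<in> Fm \<tau> \<Longrightarrow> Dia \<psi> \<in> u"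
proof -
  assume u: "mcs \<tau> u" and i: "Imp \<phi> \<psi> \<in> L" and d: "Dia \<phi> \<in> u" and f: "\<psi> \<in> Fm \<tau>"
  have f': "\<phi> \<in> Fm \<tau>" using mcs_Fm[OF u d] by simp
  have "Imp (Neg \<psi>) (Neg \<phi>) \<in> L" by (rule taut_mp[OF i]) auto
  from mcs_imp[OF u Box_mono[OF this]] show ?thesis
    using Box_Neg_iff[OF u] f f' d by auto
qed

lemma Dia_witness:
  assumes u: "mcs \<tau> u" and d: "Dia \<phi> \<in> u"
  obtains v where "mcs \<tau> v" "acc u v" "\<phi> \<in> v"
proof -
  have f: "\<phi> \<in> Fm \<tau>" using mcs_Fm[OF u d] by simp
  have "\<exists>v. mcs \<tau> v \<and> acc u v \<and> {\<phi>} \<subseteq> v"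
  proof (rule acc_extend[OF u])
    fix \<phi>s assume "set \<phi>s \<subseteq> {\<phi>}"
    then show "Dia (Conj \<phi>s) \<in> u"
      using f by (intro Dia_mono[OF u taut d]) auto
  qed (use f in auto)
  then show thesis using that by blast
qed

lemma acc_trans:
  assumes "mcs \<tau> u" "mcs \<tau> v" "mcs \<tau> w" "acc u v" "acc v w"
  shows "acc u w"
  unfolding acc_def
proof (intro allI impI)
  fix \<chi> assume b: "Box \<chi> \<in> u"
  have "Box (Box \<chi>) \<in> u"
    by (rule mcs_imp[OF assms(1) axiom_4 b]) (use mcs_Fm[OF assms(1) b] in auto)
  then show "\<chi> \<in> w" using assms unfolding acc_def by blast
qed

text \<open>Two incomparable successors would supply an instance of the linearity axiom both of
  whose disjuncts fail at \<open>u\<close>.\<close>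

lemma acc_connected:
  assumes m: "mcs \<tau> u" "mcs \<tau> v" "mcs \<tau> w" and r: "acc u v" "acc u w"
  shows "v = w \<or> acc v w \<or> acc w v"
proof (rule ccontr)
  assume n: "\<not> ?thesis"
  then obtain a where a: "Box a \<in> v" "a \<notin> w" unfolding acc_def by blast
  obtain b where b: "Box b \<in> w" "b \<notin> v" using n unfolding acc_def by blast
  obtain c where c: "c \<in> v" "c \<notin> w" using n mcs_eqI[OF m(2,3)] by blast
  have f: "a \<in> Fm \<tau>" "b \<in> Fm \<tau>" "c \<in> Fm \<tau>"
    using mcs_Fm[OF m(2) a(1)] mcs_Fm[OF m(3) b(1)] mcs_Fm[OF m(2) c(1)] by auto
  \<comment> \<open>\<open>a\<close> and \<open>b\<close> witness that neither point sees the other,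
    and \<open>c\<close> that they differ. The disjunctions make \<open>p\<close> true and boxed at
    \<open>v\<close> but false at \<open>w\<close>, and \<open>q\<close> true and boxed at
    \<open>w\<close> but false at \<open>v\<close>.\<close>
  define p q where "p = Or a c" and "q = Or b (Neg c)"
  have fpq: "p \<in> Fm \<tau>" "q \<in> Fm \<tau>" using f by (auto simp: p_def q_def)
  have p: "p \<in> v" "p \<notin> w" and q: "q \<in> w" "q \<notin> v"
    using f a b c by (auto simp: p_def q_def mcs_And[OF m(2)] mcs_And[OF m(3)]
        mcs_Neg[OF m(2)] mcs_Neg[OF m(3)])
  have "Imp (Box a) (Box p) \<in> L" "Imp (Box b) (Box q) \<in> L"
    by (rule Box_mono, rule taut, simp add: p_def q_def)+
  then have bx: "Box p \<in> v" "Box q \<in> w"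
    using mcs_imp[OF m(2) _ a(1)] mcs_imp[OF m(3) _ b(1)] fpq by auto
  have "Or (Box (Imp (BoxPlus p) q)) (Box (Imp (BoxPlus q) p)) \<in> u"
    by (rule mcs_L[OF m(1) axiom_3]) (use fpq in auto)
  then have "Box (Imp (BoxPlus p) q) \<in> u \<or> Box (Imp (BoxPlus q) p) \<in> u"
    using mcs_Or[OF m(1)] fpq by simp
  then have "Imp (BoxPlus p) q \<in> v \<or> Imp (BoxPlus q) p \<in> w"
    using r unfolding acc_def by blast
  then show False
  proof
    assume "Imp (BoxPlus p) q \<in> v"
    then have "And (BoxPlus p) (Neg q) \<notin> v"
      using mcs_Neg[OF m(2), of "And (BoxPlus p) (Neg q)"] fpq by simp
    then show False using p bx q mcs_And[OF m(2)] mcs_Neg[OF m(2)] fpq by blast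
  next
    assume "Imp (BoxPlus q) p \<in> w"
    then have "And (BoxPlus q) (Neg p) \<notin> w"
      using mcs_Neg[OF m(3), of "And (BoxPlus q) (Neg p)"] fpq by simp
    then show False using p bx q mcs_And[OF m(3)] mcs_Neg[OF m(3)] fpq by blast
  qed
qed

end

section \<open>Rooted canonical models\<close>

context K43_logic
begin

definition le :: "form set \<Rightarrow> form set \<Rightarrow> bool" where
  "le u v \<longleftrightarrow> u = v \<or> acc u v"

lemma le_refl [simp]: "le u u"
  by (simp add: le_def)

lemma acc_le: "acc u v \<Longrightarrow> le u v"
  by (simp add: le_def)

end

locale K43_root = K43_logic +
  fixes \<tau> :: "nat set" and x :: "form set"
  assumes finite_sig: "finite \<tau>" and root_mcs: "mcs \<tau> x"
begin

text \<open>By transitivity of \<open>acc\<close>, one step from \<open>x\<close> already reaches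
  the whole submodel generated by \<open>x\<close>.\<close>

definition W :: "form set set" where
  "W = {u. mcs \<tau> u \<and> le x u}"

lemma W_mcs: "u \<in> W \<Longrightarrow> mcs \<tau> u"
  by (simp add: W_def)

lemma root_W [simp]: "x \<in> W"
  by (simp add: W_def le_def root_mcs)

lemma root_le: "u \<in> W \<Longrightarrow> le x u"
  by (simp add: W_def)

lemma W_acc_trans: "u \<in> W \<Longrightarrow> v \<in> W \<Longrightarrow> w \<in> W \<Longrightarrow> acc u v \<Longrightarrow> acc v w \<Longrightarrow> acc u w"
  using acc_trans W_mcs by blast

lemma le_trans: "u \<in> W \<Longrightarrow> v \<in> W \<Longrightarrow> w \<in> W \<Longrightarrow> le u v \<Longrightarrow> le v w \<Longrightarrow> le u w"
  using W_acc_trans unfolding le_def by blast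

lemma acc_le_trans: "u \<in> W \<Longrightarrow> v \<in> W \<Longrightarrow> w \<in> W \<Longrightarrow> acc u v \<Longrightarrow> le v w \<Longrightarrow> acc u w"
  using W_acc_trans unfolding le_def by blast

lemma le_acc_trans: "u \<in> W \<Longrightarrow> v \<in> W \<Longrightarrow> w \<in> W \<Longrightarrow> le u v \<Longrightarrow> acc v w \<Longrightarrow> acc u w"
  using W_acc_trans unfolding le_def by blast

lemma le_total: "u \<in> W \<Longrightarrow> v \<in> W \<Longrightarrow> le u v \<or> le v u"
  using acc_connected[of \<tau> x u v] root_mcs unfolding W_def le_def by blast

lemma lt_acc: "u \<in> W \<Longrightarrow> v \<in> W \<Longrightarrow> \<not> le v u \<Longrightarrow> acc u v"
  using le_total unfolding le_def by blast

lemma lt_irrefl2: "u \<in> W \<Longrightarrow> v \<in> W \<Longrightarrow> le u v \<Longrightarrow> \<not> acc v v \<Longrightarrow> u \<noteq> v \<Longrightarrow> \<not> le v u"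
  using W_acc_trans unfolding le_def by blast

lemma W_succ: "u \<in> W \<Longrightarrow> mcs \<tau> v \<Longrightarrow> acc u v \<Longrightarrow> v \<in> W"
  using acc_trans[of \<tau> x u v] root_mcs unfolding W_def le_def by blast

lemma W_Neg [simp]: "u \<in> W \<Longrightarrow> \<phi> \<in> Fm \<tau> \<Longrightarrow> Neg \<phi> \<in> u \<longleftrightarrow> \<phi> \<notin> u"
  using mcs_Neg W_mcs by blast

lemma W_And [simp]: "u \<in> W \<Longrightarrow> And \<phi> \<psi> \<in> u \<longleftrightarrow> \<phi> \<in> u \<and> \<psi> \<in> u"
  using mcs_And W_mcs by blast

lemma W_Top [simp]: "u \<in> W \<Longrightarrow> Top \<in> u"
  using mcs_Top W_mcs by blast

lemma W_Bot [simp]: "u \<in> W \<Longrightarrow> Bot \<notin> u"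
  using mcs_Bot W_mcs by blast

lemma W_Fm: "u \<in> W \<Longrightarrow> \<phi> \<in> u \<Longrightarrow> \<phi> \<in> Fm \<tau>"
  using mcs_Fm W_mcs by blast

lemma W_Dia: "u \<in> W \<Longrightarrow> Dia \<phi> \<in> u \<longleftrightarrow> (\<exists>v\<in>W. acc u v \<and> \<phi> \<in> v)"
  by (meson Dia_witness W_mcs W_succ acc_Dia)

lemma not_accE:
  assumes "u \<in> W" "v \<in> W" "\<not> acc v u"
  obtains \<psi> where "\<psi> \<in> u" "Dia \<psi> \<notin> v"
  using acc_iff_Dia[of \<tau> v u] assms W_mcs by blast

text \<open>Only the trace of \<open>X\<close> on \<open>W\<close> counts, which allows complements
  in the whole type.\<close>

definition dfn :: "form set set \<Rightarrow> bool" where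
  "dfn X \<longleftrightarrow> (\<exists>\<kappa>\<in>Fm \<tau>. \<forall>u\<in>W. u \<in> X \<longleftrightarrow> \<kappa> \<in> u)"

lemma dfnI: "\<kappa> \<in> Fm \<tau> \<Longrightarrow> (\<And>u. u \<in> W \<Longrightarrow> u \<in> X \<longleftrightarrow> \<kappa> \<in> u) \<Longrightarrow> dfn X"
  unfolding dfn_def by blast

lemma dfn_cong: "(\<And>u. u \<in> W \<Longrightarrow> u \<in> X \<longleftrightarrow> u \<in> Y) \<Longrightarrow> dfn X \<longleftrightarrow> dfn Y"
  unfolding dfn_def by auto

lemma dfn_UNIV: "dfn UNIV"
  by (rule dfnI[of Top]) auto

lemma dfn_W: "dfn W"
  by (rule dfnI[of Top]) auto

lemma dfn_empty [simp]: "dfn {}"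
  by (rule dfnI[of Bot]) auto

lemma dfn_compl: "dfn X \<Longrightarrow> dfn (- X)"
proof -
  assume "dfn X"
  then obtain \<kappa> where "\<kappa> \<in> Fm \<tau>" "\<forall>u\<in>W. u \<in> X \<longleftrightarrow> \<kappa> \<in> u" by (auto simp: dfn_def)
  then show ?thesis by (intro dfnI[of "Neg \<kappa>"]) auto
qed

lemma dfn_Int: "dfn X \<Longrightarrow> dfn Y \<Longrightarrow> dfn (X \<inter> Y)"
proof -
  assume "dfn X" "dfn Y"
  then obtain \<kappa> \<mu> where "\<kappa> \<in> Fm \<tau>" "\<forall>u\<in>W. u \<in> X \<longleftrightarrow> \<kappa> \<in> u" "\<mu> \<in> Fm \<tau>" "\<forall>u\<in>W. u \<in> Y \<longleftrightarrow> \<mu> \<in> u"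
    by (auto simp: dfn_def)
  then show ?thesis by (intro dfnI[of "And \<kappa> \<mu>"]) auto
qed

lemma dfn_Diff: "dfn X \<Longrightarrow> dfn Y \<Longrightarrow> dfn (X - Y)"
  using dfn_Int dfn_compl by (simp add: Diff_eq)

lemma dfn_Un: "dfn X \<Longrightarrow> dfn Y \<Longrightarrow> dfn (X \<union> Y)"
  using dfn_compl[OF dfn_Int[OF dfn_compl dfn_compl, of X Y]] by simp

lemma dfn_UN: "finite I \<Longrightarrow> (\<And>i. i \<in> I \<Longrightarrow> dfn (X i)) \<Longrightarrow> dfn (\<Union>i\<in>I. X i)"
  by (induction I rule: finite_induct) (auto intro: dfn_Un)

lemma dfn_INT: "finite I \<Longrightarrow> (\<And>i. i \<in> I \<Longrightarrow> dfn (X i)) \<Longrightarrow> dfn (\<Inter>i\<in>I. X i)"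
  by (induction I rule: finite_induct) (auto intro: dfn_Int dfn_UNIV)

lemma dfn_mem: "\<phi> \<in> Fm \<tau> \<Longrightarrow> dfn {u. \<phi> \<in> u}"
  by (rule dfnI) auto

text \<open>Zorn's lemma is applied to the sets \<open>unbox v\<close> for points \<open>v\<close>
  above \<Gamma>: along \<open>acc\<close> these grow by transitivity, so a maximal one marks the
  last cluster where \<Gamma> holds. Arbitrary \<Gamma> is allowed because it is later used both for
  single formulas and for a whole point of the restricted model.\<close>

lemma greatest_exists:
  assumes u: "u \<in> W" "\<Gamma> \<subseteq> u"
  obtains m where "m \<in> W" "\<Gamma> \<subseteq> m" "\<And>v. v \<in> W \<Longrightarrow> \<Gamma> \<subseteq> v \<Longrightarrow> le v m"
proof (rule ccontr)
  note obt = that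
  assume no: "\<not> thesis"
  let ?P = "{v \<in> W. \<Gamma> \<subseteq> v}"
  have succ: "\<exists>w\<in>?P. \<not> le w v" if "v \<in> ?P" for v
    using no obt that by blast
  have ub: "\<exists>w\<in>?P. unbox v \<subseteq> w" if v: "v \<in> ?P" for v
    using succ[OF v] v lt_acc by (auto simp: acc_unbox)
  let ?B = "unbox ` ?P"
  have "\<exists>M\<in>?B. \<forall>X\<in>?B. M \<subseteq> X \<longrightarrow> X = M"
  proof (rule subset_Zorn)
    fix \<C> assume ch: "subset.chain ?B \<C>"
    show "\<exists>Y\<in>?B. \<forall>X\<in>\<C>. X \<subseteq> Y"
    proof (cases "\<C> = {}")
      case True
      then show ?thesis using u by blast
    next
      assume ne: "\<C> \<noteq> {}"
    have sub: "\<C> \<subseteq> ?B" using ch by (auto simp: subset_chain_def)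
    have ex: "\<exists>w\<in>W. X \<union> \<Gamma> \<subseteq> w" if X: "X \<in> \<C>" for X
    proof -
      obtain v where v: "v \<in> ?P" "X = unbox v" using X sub by blast
      obtain w where "w \<in> ?P" "unbox v \<subseteq> w" using ub[OF v(1)] by blast
      then show ?thesis using v(2) by blast
    qed
    \<comment> \<open>A finite part uses only one member \<open>unbox v\<close> of the chain, and
      without a greatest point some later point contains both \<open>unbox v\<close> and
      \<Gamma>.\<close>
    have "con (\<Union>\<C> \<union> \<Gamma>)" unfolding con_def
    proof (intro allI impI)
      fix \<phi>s assume s: "set \<phi>s \<subseteq> \<Union>\<C> \<union> \<Gamma>"
      have "finite (set \<phi>s - \<Gamma>)" "set \<phi>s - \<Gamma> \<subseteq> \<Union>\<C>" using s by auto
      then obtain X where X: "X \<in> \<C>" "set \<phi>s - \<Gamma> \<subseteq> X"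
        using finite_subset_Union_chain[OF _ _ ne ch] by metis
      obtain w where w: "w \<in> W" "X \<union> \<Gamma> \<subseteq> w" using ex[OF X(1)] by blast
      then have "set \<phi>s \<subseteq> w" using X(2) by blast
      then show "Neg (Conj \<phi>s) \<notin> L" using W_mcs[OF w(1)] by (simp add: mcs_def con_def)
    qed
    moreover have "\<Union>\<C> \<union> \<Gamma> \<subseteq> Fm \<tau>"
    proof
      fix \<phi> assume "\<phi> \<in> \<Union>\<C> \<union> \<Gamma>"
      then obtain w where "w \<in> W" "\<phi> \<in> w"
      proof (elim UnE UnionE)
        fix X assume "\<phi> \<in> X" "X \<in> \<C>"
        then show thesis using ex[of X] that by blast
      qed (use u that in blast)
      then show "\<phi> \<in> Fm \<tau>" by (rule W_Fm)
    qed
    ultimately obtain w where w: "mcs \<tau> w" "\<Union>\<C> \<union> \<Gamma> \<subseteq> w" using mcs_extend by blast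
    obtain v where v: "v \<in> ?P" "unbox v \<in> \<C>" using ne sub by blast
    have a: "acc v' w" if "unbox v' \<in> \<C>" for v' using w that by (auto simp: acc_unbox)
    have wP: "w \<in> ?P" using W_succ[of v w] v w a by auto
    have "unbox v' \<subseteq> unbox w" if "v' \<in> ?P" "unbox v' \<in> \<C>" for v'
    proof
      fix \<chi> assume "\<chi> \<in> unbox v'"
      then have b: "Box \<chi> \<in> v'" by (simp add: unbox_def)
      have m: "mcs \<tau> v'" using that W_mcs by blast
      have "Box (Box \<chi>) \<in> v'"
        by (rule mcs_imp[OF m axiom_4 b]) (use mcs_Fm[OF m b] in auto)
      then show "\<chi> \<in> unbox w" using a[OF that(2)] by (auto simp: acc_def unbox_def)
    qed
    then have "\<forall>X\<in>\<C>. X \<subseteq> unbox w" using sub by fast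
    then show ?thesis using wP by blast
    qed
  qed
  then obtain v where v: "v \<in> ?P" and mx: "\<And>w. w \<in> ?P \<Longrightarrow> unbox v \<subseteq> unbox w \<Longrightarrow> unbox w = unbox v"
    by auto
  have up: "unbox a \<subseteq> unbox b" if ab: "a \<in> ?P" "b \<in> ?P" "acc a b" for a b
  proof
    fix \<chi> assume "\<chi> \<in> unbox a"
    then have b: "Box \<chi> \<in> a" by (simp add: unbox_def)
    have m: "mcs \<tau> a" using ab W_mcs by blast
    have "Box (Box \<chi>) \<in> a"
      by (rule mcs_imp[OF m axiom_4 b]) (use mcs_Fm[OF m b] in auto)
    then show "\<chi> \<in> unbox b" using ab(3) by (auto simp: acc_def unbox_def)
  qed
  \<comment> \<open>Two strict steps, from \<open>v\<close> to \<open>w\<close> and on to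
    \<open>z\<close>, are taken because \<open>v\<close> itself may be irreflexive. By maximality
    all three have the same boxed formulas, so \<open>z\<close> sees \<open>w\<close> just as
    \<open>v\<close> does, against the choice of \<open>z\<close>.\<close>
  obtain w where w: "w \<in> ?P" "\<not> le w v" using succ[OF v] by blast
  then have vw: "acc v w" using v lt_acc by blast
  obtain z where z: "z \<in> ?P" "\<not> le z w" using succ[OF w(1)] by blast
  then have wz: "acc w z" using w lt_acc by blast
  have vz: "acc v z" using W_acc_trans[of v w z] v w z vw wz by blast
  have "unbox w = unbox v" "unbox z = unbox v" using mx up v w z vw vz by blast+
  then have "acc z w" using vw by (simp add: acc_unbox)
  then show False using z by (simp add: le_def)
qed

text \<open>The cluster of \<open>q\<close> is isolated from the right: no strictly later points accumulate at it.\<close>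

definition risol :: "form set \<Rightarrow> bool" where
  "risol q \<longleftrightarrow> dfn {u. le u q}"

lemma risol_cong:
  assumes "p \<in> W" "q \<in> W" "le p q" "le q p" shows "risol p \<longleftrightarrow> risol q"
  unfolding risol_def by (rule dfn_cong) (use assms le_trans in blast)

text \<open>For a single formula the points up to the last one satisfying it are defined by \<phi>
  or diamond \<phi>. This is the source of right-isolated points, hence of definable cuts.\<close>

lemma greatest_formula:
  assumes u: "u \<in> W" "\<phi> \<in> u"
  obtains m where "m \<in> W" "\<phi> \<in> m" "\<And>v. v \<in> W \<Longrightarrow> \<phi> \<in> v \<Longrightarrow> le v m" "risol m"
proof -
  obtain m where m: "m \<in> W" "{\<phi>} \<subseteq> m" "\<And>v. v \<in> W \<Longrightarrow> {\<phi>} \<subseteq> v \<Longrightarrow> le v m"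
    using greatest_exists[of u "{\<phi>}"] u by blast
  have f: "\<phi> \<in> Fm \<tau>" using W_Fm u by blast
  have "risol m" unfolding risol_def
  proof (rule dfnI[of "Or \<phi> (Dia \<phi>)"])
    fix v assume v: "v \<in> W"
    have "Or \<phi> (Dia \<phi>) \<in> v \<longleftrightarrow> \<phi> \<in> v \<or> Dia \<phi> \<in> v" using v f by simp
    also have "\<dots> \<longleftrightarrow> le v m"
      using m v W_Dia[OF v, of \<phi>] acc_le_trans[of v _ m] unfolding le_def by blast
    finally show "v \<in> {u. le u m} \<longleftrightarrow> Or \<phi> (Dia \<phi>) \<in> v" by simp
  qed (use f in simp)
  then show thesis using m that by blast
qed

text \<open>If \<open>v\<close> does not see \<open>u\<close>, some \<psi> in \<open>u\<close> has
  no successor of \<open>v\<close> satisfying it; the last point satisfying \<psi> is the required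
  one. For reflexive \<open>v\<close> it lies strictly before \<open>v\<close>.\<close>

lemma risol_between:
  assumes "u \<in> W" "v \<in> W" "\<not> le v u"
  obtains m where "m \<in> W" "risol m" "le u m" "\<not> acc v m"
proof -
  have "\<not> acc v u" using assms acc_le by blast
  then obtain \<psi> where p: "\<psi> \<in> u" "Dia \<psi> \<notin> v" using not_accE assms by blast
  obtain m where m: "m \<in> W" "\<psi> \<in> m" "\<And>v. v \<in> W \<Longrightarrow> \<psi> \<in> v \<Longrightarrow> le v m" "risol m"
    using greatest_formula[OF assms(1) p(1)] by blast
  have "\<not> acc v m" using W_Dia[OF assms(2)] m p by blast
  then show thesis using that m p assms by blast
qed

text \<open>A failure of reflexivity gives some \<chi> that is boxed but false at \<open>u\<close>.
  In a linear order at most one point can have this property, since the earlier of two would force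
  \<chi> at the later.\<close>

lemma irr_singleton_dfn:
  assumes u: "u \<in> W" "\<not> acc u u"
  shows "dfn {u}"
proof -
  obtain \<chi> where c: "Box \<chi> \<in> u" "\<chi> \<notin> u" using u unfolding acc_def by blast
  have f: "\<chi> \<in> Fm \<tau>" using W_Fm[OF u(1) c(1)] by simp
  show ?thesis
  proof (rule dfnI[of "And (Box \<chi>) (Neg \<chi>)"])
    fix v assume v: "v \<in> W"
    have "v = u" if "Box \<chi> \<in> v" "\<chi> \<notin> v"
      using le_total[OF u(1) v] that c unfolding le_def acc_def by blast
    then show "v \<in> {u} \<longleftrightarrow> And (Box \<chi>) (Neg \<chi>) \<in> v" 
      using c f v u W_And[OF v] W_Neg[OF v f] by blast
  qed (use f in simp)
qed

lemma irr_dfn_above: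
  assumes w: "w \<in> W" "\<not> acc w w"
  shows "dfn {u. le w u}"
proof -
  obtain \<beta> where b: "\<beta> \<in> Fm \<tau>" "\<And>u. u \<in> W \<Longrightarrow> u = w \<longleftrightarrow> \<beta> \<in> u"
    using irr_singleton_dfn[OF w] unfolding dfn_def by auto
  show ?thesis
  proof (rule dfnI[of "Neg (Dia \<beta>)"])
    fix u assume u: "u \<in> W"
    have "Dia \<beta> \<in> u \<longleftrightarrow> acc u w" using W_Dia[OF u] b w by blast
    also have "\<dots> \<longleftrightarrow> \<not> le w u" using w u W_acc_trans[of w u w] lt_acc unfolding le_def by blast
    finally show "u \<in> {u. le w u} \<longleftrightarrow> Neg (Dia \<beta>) \<in> u" using u b by simp
  qed (use b in simp)
qed

lemma irr_risol:
  assumes w: "w \<in> W" "\<not> acc w w"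
  shows "risol w"
  unfolding risol_def
proof (subst dfn_cong)
  show "dfn (- {u. le w u} \<union> {w})"
    using irr_dfn_above[OF w] irr_singleton_dfn[OF w] dfn_compl dfn_Un by blast
  show "u \<in> {u. le u w} \<longleftrightarrow> u \<in> - {u. le w u} \<union> {w}" if "u \<in> W" for u
    using le_total[OF that w(1)] lt_irrefl2[OF that w(1)] w by auto
qed

text \<open>An immediate predecessor, determined only up to its cluster and possibly
  reflexive.\<close>

definition ipred :: "form set \<Rightarrow> form set \<Rightarrow> bool" where
  "ipred p w \<longleftrightarrow> p \<in> W \<and> \<not> le w p \<and> (\<forall>u\<in>W. \<not> le w u \<longrightarrow> le u p)"

text \<open>The points strictly before an irreflexive one form a definable set, which therefore has
  a last point.\<close>

lemma irr_ipred:
  assumes w: "w \<in> W" "\<not> acc w w" and u: "u \<in> W" "\<not> le w u"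
  obtains p where "ipred p w"
proof -
  obtain \<beta> where b: "\<beta> \<in> Fm \<tau>" "\<And>u. u \<in> W \<Longrightarrow> \<not> le w u \<longleftrightarrow> \<beta> \<in> u"
    using dfn_compl[OF irr_dfn_above[OF w]] unfolding dfn_def by auto
  obtain m where "m \<in> W" "\<beta> \<in> m" "\<And>v. v \<in> W \<Longrightarrow> \<beta> \<in> v \<Longrightarrow> le v m"
    using greatest_formula[of u \<beta>] b u by blast
  then show thesis using b that[of m] unfolding ipred_def by blast
qed

lemma ipred_risol_irr:
  assumes w: "w \<in> W" "\<not> acc w w" and p: "ipred p w"
  shows "risol p"
  unfolding risol_def
proof (subst dfn_cong)
  show "dfn (- {u. le w u})" using irr_dfn_above[OF w] dfn_compl by blast
  show "u \<in> {u. le u p} \<longleftrightarrow> u \<in> - {u. le w u}" if "u \<in> W" for u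
    using p that le_trans[of w u p] w unfolding ipred_def by auto
qed

text \<open>The right-isolated point that exists between \<open>p\<close> and \<open>w\<close> has
  to lie in the cluster of \<open>p\<close>, as nothing else fits in between.\<close>

lemma ipred_risol_refl:
  assumes w: "w \<in> W" "acc w w" and p: "ipred p w"
  shows "risol p"
proof -
  have p': "p \<in> W" "\<not> le w p" "\<And>u. u \<in> W \<Longrightarrow> \<not> le w u \<Longrightarrow> le u p" using p unfolding ipred_def by auto
  obtain m where m: "m \<in> W" "risol m" "le p m" "\<not> acc w m" using risol_between[OF p'(1) w(1) p'(2)] .
  have "\<not> le w m" using m w unfolding le_def by blast
  then have "le m p" using p' m by blast
  then show ?thesis using risol_cong[of p m] m p' by blast
qed

section \<open>Clusters and definable retractions onto finite sets\<close>

definition cluster :: "form set \<Rightarrow> form set set" where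
  "cluster u = {v \<in> W. le u v \<and> le v u}"

text \<open>Mutually accessible points have the same successors and so agree on all diamonds; only
  variables can tell them apart. This is where the bound \<open>2 ^ card \<tau>\<close> on cluster
  sizes comes from.\<close>

lemma cluster_eqI:
  assumes m: "u \<in> W" "v \<in> W" "le u v" "le v u" and at: "\<And>p. p \<in> \<tau> \<Longrightarrow> Var p \<in> u \<longleftrightarrow> Var p \<in> v"
  shows "u = v"
proof (rule ccontr)
  assume ne: "u \<noteq> v"
  have a: "acc u v" "acc v u" using ne m unfolding le_def by auto
  have "\<phi> \<in> u \<longleftrightarrow> \<phi> \<in> v" if "\<phi> \<in> Fm \<tau>" for \<phi>
    using that
  proof (induction \<phi>)
    case (Dia \<phi>)
    show ?case using W_Dia[OF m(1)] W_Dia[OF m(2)] a W_acc_trans m by blast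
  qed (use m at in auto)
  then show False using ne W_Fm m by blast
qed

lemma cluster_inj: "u \<in> W \<Longrightarrow> inj_on (\<lambda>v. {p \<in> \<tau>. Var p \<in> v}) (cluster u)"
proof (rule inj_onI)
  fix v w assume u: "u \<in> W" and c: "v \<in> cluster u" "w \<in> cluster u"
    and e: "{p \<in> \<tau>. Var p \<in> v} = {p \<in> \<tau>. Var p \<in> w}"
  show "v = w"
  proof (rule cluster_eqI)
    show "le v w" "le w v" using c u le_trans unfolding cluster_def by blast+
  qed (use c e in \<open>auto simp: cluster_def\<close>)
qed

lemma finite_cluster: "u \<in> W \<Longrightarrow> finite (cluster u)"
  by (rule inj_on_finite[OF cluster_inj, of u "Pow \<tau>"]) (auto simp: finite_sig)

lemma card_cluster: "u \<in> W \<Longrightarrow> card (cluster u) \<le> 2 ^ card \<tau>"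
  using card_inj_on_le[OF cluster_inj, of u "Pow \<tau>"] finite_sig by (auto simp: card_Pow)

lemma isolate:
  assumes "finite C" "C \<subseteq> W" "u \<in> W"
  obtains \<theta> where "\<theta> \<in> u" "\<And>v. v \<in> C \<Longrightarrow> v \<noteq> u \<Longrightarrow> \<theta> \<notin> v"
proof -
  have "\<exists>\<theta>. \<theta> \<in> u \<and> (\<forall>v\<in>C. v \<noteq> u \<longrightarrow> \<theta> \<notin> v)"
    using assms(1,2)
  proof (induction C rule: finite_induct)
    case empty
    show ?case using W_Top[OF assms(3)] by blast
  next
    case (insert c C)
    then obtain \<theta> where t: "\<theta> \<in> u" "\<forall>v\<in>C. v \<noteq> u \<longrightarrow> \<theta> \<notin> v" by auto
    have c: "c \<in> W" using insert by simp
    show ?case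
    proof (cases "c = u")
      case False
      then obtain \<eta> where "\<eta> \<in> u" "\<eta> \<notin> c" using mcs_eqI[of \<tau> u c] W_mcs c assms by blast
      then have "And \<theta> \<eta> \<in> u \<and> (\<forall>v\<in>insert c C. v \<noteq> u \<longrightarrow> And \<theta> \<eta> \<notin> v)"
        using t assms insert by (auto simp: subset_iff)
      then show ?thesis by blast
    qed (use t in auto)
  qed
  then show thesis using that by blast
qed

text \<open>Used to collapse an interval to points of its last cluster: definability of the fibres
  makes every valuation on the cluster pull back to formulas.\<close>

lemma retraction:
  assumes C: "finite C" "C \<subseteq> W" "C \<noteq> {}"
  obtains g where "\<And>u. g u \<in> C" "\<And>c. c \<in> C \<Longrightarrow> g c = c" "\<And>c. dfn {u. g u = c}"
proof -
  have "\<exists>\<theta>. \<forall>c\<in>C. \<theta> c \<in> c \<and> (\<forall>v\<in>C. v \<noteq> c \<longrightarrow> \<theta> c \<notin> v)"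
    using isolate[OF C(1,2)] C(2) by (intro bchoice ballI) (metis subsetD)
  then obtain \<theta> where t: "\<And>c. c \<in> C \<Longrightarrow> \<theta> c \<in> c" "\<And>c v. c \<in> C \<Longrightarrow> v \<in> C \<Longrightarrow> v \<noteq> c \<Longrightarrow> \<theta> c \<notin> v"
    by blast
  have f: "\<theta> c \<in> Fm \<tau>" if "c \<in> C" for c using W_Fm t that C by blast
  \<comment> \<open>\<open>c0\<close> is the default value for points at which none, or more than
    one, of the isolating formulas \<theta> holds.\<close>
  obtain c0 where c0: "c0 \<in> C" using C by blast
  define X where "X c = {u. \<theta> c \<in> u} \<inter> (\<Inter>c'\<in>C - {c}. - {u. \<theta> c' \<in> u})" for c
  have dX: "dfn (X c)" if "c \<in> C" for c
    unfolding X_def using C f that by (intro dfn_Int dfn_INT dfn_compl dfn_mem) auto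
  have dis: "c = c'" if "u \<in> X c" "u \<in> X c'" "c \<in> C" "c' \<in> C" for u c c'
    using that unfolding X_def by blast
  define g where "g u = (if \<exists>c\<in>C. u \<in> X c then THE c. c \<in> C \<and> u \<in> X c else c0)" for u
  have gX: "g u = c" if "c \<in> C" "u \<in> X c" for u c
    unfolding g_def using that dis by (auto intro!: the_equality)
  have g0: "g u = c0" if "\<And>c. c \<in> C \<Longrightarrow> u \<notin> X c" for u
    unfolding g_def using that by auto
  have gC: "g u \<in> C" for u using gX g0 c0 by metis
  have gid: "g c = c" if "c \<in> C" for c
    using that t by (intro gX) (auto simp: X_def)
  have "dfn {u. g u = c}" for c
  proof (cases "c \<in> C")
    case True
    show ?thesis
    proof (cases "c = c0")
      case True
      have "{u. g u = c} = X c0 \<union> (\<Inter>c\<in>C. - X c)" using True gX g0 c0 by blast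
      then show ?thesis using dX c0 C by (auto intro!: dfn_Un dfn_INT dfn_compl)
    next
      case False
      then have "{u. g u = c} = X c" using True gX g0 by blast
      then show ?thesis using dX True by simp
    qed
  next
    case False
    then have "{u. g u = c} = {}" using gC by auto
    then show ?thesis by simp
  qed
  then show thesis using that gC gid by blast
qed

end

section \<open>Ordered sums\<close>

text \<open>Truth in \<open>M\<close> when \<open>M\<close> is followed by further points, at which exactly the formulas in \<open>S\<close> hold
  somewhere.\<close>

fun csat :: "'w model \<Rightarrow> form set \<Rightarrow> 'w \<Rightarrow> form \<Rightarrow> bool" where
  "csat M S y (Var p) = (y \<in> val M p)"
| "csat M S y Top = True"
| "csat M S y Bot = False"
| "csat M S y (Neg \<phi>) = (\<not> csat M S y \<phi>)"
| "csat M S y (And \<phi> \<psi>) = (csat M S y \<phi> \<and> csat M S y \<psi>)"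
| "csat M S y (Dia \<phi>) =
    (\<phi> \<in> S \<or> (\<exists>z\<in>worlds (frame_of M). (y, z) \<in> rel (frame_of M) \<and> csat M S z \<phi>))"

lemma sat_csat: "sat M y \<phi> = csat M {} y \<phi>"
  by (induction \<phi> arbitrary: y) auto

lemma subforms_self [simp]: "\<phi> \<in> subforms \<phi>"
  by (cases \<phi>) auto

lemma finite_subforms [simp]: "finite (subforms \<phi>)"
  by (induction \<phi>) auto

lemma subforms_Fm: "\<phi> \<in> Fm \<tau> \<Longrightarrow> \<psi> \<in> subforms \<phi> \<Longrightarrow> \<psi> \<in> Fm \<tau>"
  by (induction \<phi>) auto

lemma subforms_trans: "\<psi> \<in> subforms \<phi> \<Longrightarrow> \<chi> \<in> subforms \<psi> \<Longrightarrow> \<chi> \<in> subforms \<phi>"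
  by (induction \<phi>) auto

lemma worlds_osum: "worlds (osum_frame Fs) = (SIGMA i:{..<length Fs}. worlds (Fs ! i))"
  by (simp add: osum_frame_def)

lemma rel_osum:
  "((i, y), (j, z)) \<in> rel (osum_frame Fs) \<longleftrightarrow>
     (i = j \<and> i < length Fs \<and> (y, z) \<in> rel (Fs ! i)) \<or>
     (i < j \<and> j < length Fs \<and> y \<in> worlds (Fs ! i) \<and> z \<in> worlds (Fs ! j))"
  by (auto simp: osum_frame_def)

lemma internal_osum:
  "internal (osum_frame Fs) =
     {SIGMA i:{..<length Fs}. X i | X. \<forall>i<length Fs. X i \<in> internal (Fs ! i)}"
  by (simp add: osum_frame_def)

lemma internal_osumI:
  "(\<And>i. i < length Fs \<Longrightarrow> X i \<in> internal (Fs ! i)) \<Longrightarrow>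
     Y = (SIGMA i:{..<length Fs}. X i) \<Longrightarrow> Y \<in> internal (osum_frame Fs)"
  unfolding internal_osum by blast

lemma internal_osum_fibre:
  "Y \<in> internal (osum_frame Fs) \<Longrightarrow> i < length Fs \<Longrightarrow> {z. (i, z) \<in> Y} \<in> internal (Fs ! i)"
  unfolding internal_osum by auto

lemma general_frame_osum:
  assumes ne: "Fs \<noteq> []" and gf: "\<And>F. F \<in> set Fs \<Longrightarrow> general_frame F"
  shows "general_frame (osum_frame Fs)"
proof -
  have g: "general_frame (Fs ! i)" if "i < length Fs" for i using gf that by simp
  have gW: "worlds (Fs ! i) \<noteq> {}" "rel (Fs ! i) \<subseteq> worlds (Fs ! i) \<times> worlds (Fs ! i)"
    "internal (Fs ! i) \<subseteq> Pow (worlds (Fs ! i))" "{} \<in> internal (Fs ! i)" 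
    "worlds (Fs ! i) \<in> internal (Fs ! i)"
    "\<And>X Y. X \<in> internal (Fs ! i) \<Longrightarrow> Y \<in> internal (Fs ! i) \<Longrightarrow> X \<inter> Y \<in> internal (Fs ! i)"
    "\<And>X. X \<in> internal (Fs ! i) \<Longrightarrow> worlds (Fs ! i) - X \<in> internal (Fs ! i)"
    "\<And>X. X \<in> internal (Fs ! i) \<Longrightarrow> dia_set (worlds (Fs ! i)) (rel (Fs ! i)) X \<in> internal (Fs ! i)"
    if "i < length Fs" for i
    using g[OF that] unfolding general_frame_def by auto
  let ?O = "osum_frame Fs"
  have "worlds ?O \<noteq> {}" using ne gW(1)[of 0] by (auto simp: worlds_osum Sigma_empty_iff)
  moreover have "rel ?O \<subseteq> worlds ?O \<times> worlds ?O"
    using gW(2) by (force simp: worlds_osum rel_osum)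
  moreover have "internal ?O \<subseteq> Pow (worlds ?O)"
    using gW(3) by (fastforce simp: worlds_osum internal_osum)
  moreover have "{} \<in> internal ?O"
    by (rule internal_osumI[of _ "\<lambda>_. {}"]) (auto simp: gW)
  moreover have "worlds ?O \<in> internal ?O"
    by (rule internal_osumI[of _ "\<lambda>i. worlds (Fs ! i)"]) (auto simp: gW worlds_osum)
  moreover have "X \<inter> Y \<in> internal ?O" if X: "X \<in> internal ?O" and Y: "Y \<in> internal ?O" for X Y
  proof -
    obtain X' where X': "X = (SIGMA i:{..<length Fs}. X' i)" "\<forall>i<length Fs. X' i \<in> internal (Fs ! i)"
      using X unfolding internal_osum by auto
    obtain Y' where Y': "Y = (SIGMA i:{..<length Fs}. Y' i)" "\<forall>i<length Fs. Y' i \<in> internal (Fs ! i)"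
      using Y unfolding internal_osum by auto
    show ?thesis
      by (rule internal_osumI[of _ "\<lambda>i. X' i \<inter> Y' i"]) (use X' Y' gW(6) in auto)
  qed
  moreover have "worlds ?O - X \<in> internal ?O" if X: "X \<in> internal ?O" for X
  proof -
    obtain X' where X': "X = (SIGMA i:{..<length Fs}. X' i)" "\<forall>i<length Fs. X' i \<in> internal (Fs ! i)"
      using X unfolding internal_osum by auto
    show ?thesis
      by (rule internal_osumI[of _ "\<lambda>i. worlds (Fs ! i) - X' i"]) (use X' gW(7) in \<open>auto simp: worlds_osum\<close>)
  qed
  moreover have "dia_set (worlds ?O) (rel ?O) X \<in> internal ?O" if X: "X \<in> internal ?O" for X
  proof -
    obtain X' where X': "X = (SIGMA i:{..<length Fs}. X' i)" "\<forall>i<length Fs. X' i \<in> internal (Fs ! i)"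
      using X unfolding internal_osum by auto
    have sub: "z \<in> worlds (Fs ! i)" if "i < length Fs" "z \<in> X' i" for i z
      using X'(2) gW(3) that by blast
    \<comment> \<open>A component lies entirely in the diamond of \<open>X\<close> as soon as
      \<open>X\<close> meets a later component; otherwise only its own relation matters.\<close>
    let ?Y = "\<lambda>i. if \<exists>j. i < j \<and> j < length Fs \<and> X' j \<noteq> {} then worlds (Fs ! i)
                  else dia_set (worlds (Fs ! i)) (rel (Fs ! i)) (X' i)"
    show ?thesis
    proof (rule internal_osumI[of _ ?Y])
      show "?Y i \<in> internal (Fs ! i)" if "i < length Fs" for i
        using that gW X'(2) by simp
      show "dia_set (worlds ?O) (rel ?O) X = (SIGMA i:{..<length Fs}. ?Y i)"
      proof (intro set_eqI)
        fix q :: "nat \<times> 'a"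
        obtain i y where q: "q = (i, y)" by fastforce
        have "q \<in> dia_set (worlds ?O) (rel ?O) X \<longleftrightarrow> i < length Fs \<and> y \<in> worlds (Fs ! i) \<and>
           (\<exists>j z. j < length Fs \<and> z \<in> X' j \<and> (i = j \<and> (y, z) \<in> rel (Fs ! i) \<or> i < j))"
          unfolding q dia_set_def X'(1) using sub by (auto simp: worlds_osum rel_osum Bex_def)
        also have "\<dots> \<longleftrightarrow> q \<in> (SIGMA i:{..<length Fs}. ?Y i)"
          unfolding q by (auto simp: dia_set_def)
        finally show "q \<in> dia_set (worlds ?O) (rel ?O) X \<longleftrightarrow> q \<in> (SIGMA i:{..<length Fs}. ?Y i)" .
      qed
    qed
  qed
  ultimately show ?thesis unfolding general_frame_def by blast
qed

definition later :: "'w frame list \<Rightarrow> (nat \<Rightarrow> (nat \<times> 'w) set) \<Rightarrow> form set \<Rightarrow> nat \<Rightarrow> form set" where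
  "later Fs v S i = S \<union> {\<psi>. \<exists>j z. i < j \<and> j < length Fs \<and> z \<in> worlds (Fs ! j) \<and>
     csat (Model (osum_frame Fs) v) S (j, z) \<psi>}"

text \<open>Later components influence an earlier one only through the set of formulas true
  somewhere in them, so a component can be studied alone with that set as its context.\<close>

lemma csat_osum:
  assumes "i < length Fs" "y \<in> worlds (Fs ! i)"
  shows "csat (Model (osum_frame Fs) v) S (i, y) \<phi> \<longleftrightarrow>
    csat (Model (Fs ! i) (\<lambda>p. {z. (i, z) \<in> v p})) (later Fs v S i) y \<phi>"
  using assms(2)
proof (induction \<phi> arbitrary: y)
  case (Dia \<phi>)
  have "csat (Model (osum_frame Fs) v) S (i, y) (Dia \<phi>) \<longleftrightarrow> \<phi> \<in> S \<or>
     (\<exists>j z. j < length Fs \<and> z \<in> worlds (Fs ! j) \<and>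
       (i = j \<and> (y, z) \<in> rel (Fs ! i) \<or> i < j) \<and> csat (Model (osum_frame Fs) v) S (j, z) \<phi>)"
    using Dia.prems assms(1) by (auto simp: worlds_osum rel_osum Bex_def)
  also have "\<dots> \<longleftrightarrow> \<phi> \<in> later Fs v S i \<or>
     (\<exists>z\<in>worlds (Fs ! i). (y, z) \<in> rel (Fs ! i) \<and> csat (Model (osum_frame Fs) v) S (i, z) \<phi>)"
    unfolding later_def using assms(1) by blast
  also have "\<dots> \<longleftrightarrow> csat (Model (Fs ! i) (\<lambda>p. {z. (i, z) \<in> v p})) (later Fs v S i) y (Dia \<phi>)"
    using Dia.IH by auto
  finally show ?case .
qed auto

lemma decreasing_le:
  fixes f :: "nat \<Rightarrow> 'a set"
  assumes "\<And>i. i < N \<Longrightarrow> f (Suc i) \<subseteq> f i" "i \<le> j" "j \<le> N"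
  shows "f j \<subseteq> f i"
  using assms(2,3)
proof (induction j rule: dec_induct)
  case (step n)
  then show ?case using assms(1)[of n] by auto
qed simp

lemma decreasing_index:
  fixes f :: "nat \<Rightarrow> 'a set"
  assumes "u \<in> f 0" "u \<notin> f N"
  obtains i where "i < N" "u \<in> f i" "u \<notin> f (Suc i)"
proof -
  have "\<exists>i<N. u \<in> f i \<and> u \<notin> f (Suc i)"
    using assms by (induction N) (auto simp: less_Suc_eq)
  then show thesis using that by blast
qed

lemma frame_of_osum: "frame_of (osum_model Ms) = osum_frame (map frame_of Ms)"
  by (simp add: osum_model_def)

lemma val_osum: "(i, z) \<in> val (osum_model Ms) p \<longleftrightarrow> i < length Ms \<and> z \<in> val (Ms ! i) p"
  by (auto simp: osum_model_def)

lemma delta_model_osum: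
  assumes "Ms \<noteq> []" "\<And>M. M \<in> set Ms \<Longrightarrow> delta_model \<delta> M"
  shows "delta_model \<delta> (osum_model Ms)"
  unfolding delta_model_def frame_of_osum
proof (intro conjI ballI)
  show "general_frame (osum_frame (map frame_of Ms))"
    using assms by (intro general_frame_osum) (auto simp: delta_model_def)
  fix p assume "p \<in> \<delta>"
  then show "val (osum_model Ms) p \<in> internal (osum_frame (map frame_of Ms))"
    using assms(2) by (intro internal_osumI[of _ "\<lambda>i. val (Ms ! i) p"])
      (auto simp: delta_model_def osum_model_def)
qed

section \<open>Representing intervals of the canonical model by models\<close>

context K43_root
begin

definition upset :: "form set set \<Rightarrow> bool" where
  "upset U \<longleftrightarrow> U \<subseteq> W \<and> dfn U \<and> (\<forall>u\<in>U. \<forall>v\<in>W. le u v \<longrightarrow> v \<in> U)"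

lemma upset_sub: "upset U \<Longrightarrow> u \<in> U \<Longrightarrow> u \<in> W"
  by (auto simp: upset_def)

lemma upset_dfn: "upset U \<Longrightarrow> dfn U"
  by (auto simp: upset_def)

lemma upset_le: "upset U \<Longrightarrow> u \<in> U \<Longrightarrow> v \<in> W \<Longrightarrow> le u v \<Longrightarrow> v \<in> U"
  by (auto simp: upset_def)

lemma upset_acc: "upset U \<Longrightarrow> u \<in> U \<Longrightarrow> v \<in> W \<Longrightarrow> acc u v \<Longrightarrow> v \<in> U"
  using upset_le acc_le by blast

lemma upset_lt: "upset U \<Longrightarrow> u \<in> U \<Longrightarrow> v \<in> W \<Longrightarrow> v \<notin> U \<Longrightarrow> acc v u"
  using upset_le upset_sub lt_acc by blast

lemma upset_W: "upset W"
  by (simp add: upset_def dfn_W)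

text \<open>\<open>h\<close> sends every world of \<open>M\<close> to the point of the canonical model it is a copy of.\<close>

definition tmap :: "form set set \<Rightarrow> 'w model \<Rightarrow> ('w \<Rightarrow> form set) \<Rightarrow> form set set \<Rightarrow> bool" where
  "tmap Rl M h J \<longleftrightarrow>
     (\<forall>z\<in>worlds (frame_of M). h z \<in> J) \<and>
     (\<forall>z z'. (z, z') \<in> rel (frame_of M) \<longrightarrow> acc (h z) (h z')) \<and>
     (\<forall>p\<in>\<tau>. \<forall>z\<in>worlds (frame_of M). z \<in> val M p \<longleftrightarrow> Var p \<in> h z) \<and>
     (\<forall>w\<in>Rl \<inter> J. \<exists>z\<in>worlds (frame_of M). h z = w) \<and>
     (\<forall>w\<in>Rl \<inter> J. \<forall>z\<in>worlds (frame_of M). acc (h z) w \<longrightarrow>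
        (\<exists>z'\<in>worlds (frame_of M). (z, z') \<in> rel (frame_of M) \<and> h z' = w)) \<and>
     (x \<in> J \<longrightarrow> (\<exists>z. root (frame_of M) z \<and> h z = x))"

text \<open>A valuation on \<open>F\<close> is pulled back to \<open>J\<close> along \<open>g\<close>; \<open>g\<close> need only be a p-morphism up to the
  truth of the subformulas of \<open>\<chi>\<close> under that valuation, where \<open>S\<close> collects what holds after \<open>F\<close>.\<close>

definition pullback :: "'w frame \<Rightarrow> form set set \<Rightarrow> form \<Rightarrow> form set \<Rightarrow> (nat \<Rightarrow> 'w set) \<Rightarrow> (form set \<Rightarrow> 'w) \<Rightarrow> bool" where
  "pullback F J \<chi> S v g \<longleftrightarrow>
     (\<forall>u\<in>J. g u \<in> worlds F) \<and>
     (\<forall>p. dfn {u \<in> J. g u \<in> v p}) \<and>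
     (\<forall>u\<in>J. \<forall>u'\<in>J. acc u u' \<longrightarrow> (g u, g u') \<in> rel F) \<and>
     (\<forall>\<psi>\<in>subforms \<chi>. \<forall>z\<in>worlds F. csat (Model F v) S z \<psi> \<longrightarrow>
        (\<exists>u\<in>J. csat (Model F v) S (g u) \<psi>) \<and>
        (\<forall>u\<in>J. (g u, z) \<in> rel F \<longrightarrow> (\<exists>u'\<in>J. acc u u' \<and> csat (Model F v) S (g u') \<psi>)))"

text \<open>The quantifier over \<open>S\<close> makes the property stable under ordered sums, where
  \<open>S\<close> is filled by what holds in later components. The map \<open>g\<close> may depend
  on the formula and the valuation, as it will for \<open>C_frame\<close>.\<close>

definition vmap :: "'w frame \<Rightarrow> form set set \<Rightarrow> bool" where
  "vmap F J \<longleftrightarrow> (\<forall>\<chi> S v. (\<forall>p. v p \<in> internal F) \<longrightarrow> (\<exists>g. pullback F J \<chi> S v g))"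

text \<open>The set \<open>H\<close> bounds the canonical points that are copied; from it the atomic
  types on the two sides are compared later.\<close>

definition block :: "form set set \<Rightarrow> 'w model \<Rightarrow> form set set \<Rightarrow> form set set \<Rightarrow> form set set \<Rightarrow> bool" where
  "block Rl M U U' H \<longleftrightarrow> upset U \<and> upset U' \<and> U' \<subseteq> U \<and> delta_model \<tau> M \<and>
     (\<exists>h. tmap Rl M h (U - U') \<and> (\<forall>z\<in>worlds (frame_of M). h z \<in> H)) \<and> vmap (frame_of M) (U - U')"

definition interval :: "(nat \<Rightarrow> form set set) \<Rightarrow> nat \<Rightarrow> form set set" where
  "interval f i = f i - f (Suc i)"

lemma interval_order:
  assumes up: "\<And>i. i \<le> N \<Longrightarrow> upset (f i)" and dec: "\<And>i. i < N \<Longrightarrow> f (Suc i) \<subseteq> f i"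
    and i: "i < j" "j < N" and u: "u \<in> interval f i" and v: "v \<in> interval f j"
  shows "acc u v" "\<not> acc v u"
proof -
  have "f j \<subseteq> f (Suc i)" using decreasing_le[of N f "Suc i" j] dec i by simp
  then have "v \<in> f (Suc i)" "u \<notin> f (Suc i)" "u \<in> W" "upset (f (Suc i))"
    using u v up[of i] up[of "Suc i"] upset_sub i unfolding interval_def by auto
  then show "acc u v" "\<not> acc v u" using upset_lt upset_acc by blast+
qed

lemma interval_less:
  assumes up: "\<And>i. i \<le> N \<Longrightarrow> upset (f i)" and dec: "\<And>i. i < N \<Longrightarrow> f (Suc i) \<subseteq> f i"
    and i: "i < N" "j < N" and u: "u \<in> interval f i" and v: "v \<in> interval f j" and a: "acc u v"
  shows "i \<le> j"
  using interval_order(2)[of N f, OF up dec, of j i v u] i u v a by (meson not_le)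

lemma interval_unique:
  assumes dec: "\<And>i. i < N \<Longrightarrow> f (Suc i) \<subseteq> f i"
    and i: "i < N" "j < N" and u: "u \<in> interval f i" "u \<in> interval f j"
  shows "i = j"
proof (rule ccontr)
  assume "i \<noteq> j"
  then have "Suc i \<le> j \<or> Suc j \<le> i" by auto
  then show False
    using decreasing_le[of N f "Suc i" j] decreasing_le[of N f "Suc j" i] dec i u
    unfolding interval_def by auto
qed

lemma tmapD:
  assumes "tmap Rl M h J"
  shows "z \<in> worlds (frame_of M) \<Longrightarrow> h z \<in> J"
    and "(z, z') \<in> rel (frame_of M) \<Longrightarrow> acc (h z) (h z')"
    and "p \<in> \<tau> \<Longrightarrow> z \<in> worlds (frame_of M) \<Longrightarrow> z \<in> val M p \<longleftrightarrow> Var p \<in> h z"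
    and "w \<in> Rl \<Longrightarrow> w \<in> J \<Longrightarrow> \<exists>z\<in>worlds (frame_of M). h z = w"
    and "w \<in> Rl \<Longrightarrow> w \<in> J \<Longrightarrow> z \<in> worlds (frame_of M) \<Longrightarrow> acc (h z) w \<Longrightarrow>
        \<exists>z'\<in>worlds (frame_of M). (z, z') \<in> rel (frame_of M) \<and> h z' = w"
    and "x \<in> J \<Longrightarrow> \<exists>z. root (frame_of M) z \<and> h z = x"
  using assms unfolding tmap_def by simp_all

text \<open>Within a component the back condition is inherited; between components it follows from
  the clause that every relevant point of an interval is copied, because an earlier component sees
  all of a later one.\<close>

lemma tmap_osum:
  assumes up: "\<And>i. i \<le> length Ms \<Longrightarrow> upset (f i)" and dec: "\<And>i. i < length Ms \<Longrightarrow> f (Suc i) \<subseteq> f i"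
    and ne: "Ms \<noteq> []" "\<And>i. i < length Ms \<Longrightarrow> worlds (frame_of (Ms ! i)) \<noteq> {}"
    and t: "\<And>i. i < length Ms \<Longrightarrow> tmap Rl (Ms ! i) (h i) (interval f i)"
  shows "tmap Rl (osum_model Ms) (\<lambda>(i, z). h i z) (f 0 - f (length Ms))"
proof -
  let ?N = "length Ms" and ?F = "frame_of (osum_model Ms)"
  have W: "(i, z) \<in> worlds ?F \<longleftrightarrow> i < ?N \<and> z \<in> worlds (frame_of (Ms ! i))" for i z
    by (auto simp: frame_of_osum worlds_osum)
  have R: "((i, y), (j, z)) \<in> rel ?F \<longleftrightarrow>
     (i = j \<and> i < ?N \<and> (y, z) \<in> rel (frame_of (Ms ! i))) \<or>
     (i < j \<and> j < ?N \<and> y \<in> worlds (frame_of (Ms ! i)) \<and> z \<in> worlds (frame_of (Ms ! j)))" for i j y z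
    by (auto simp: frame_of_osum rel_osum)
  note T = tmapD[OF t]
  have J: "interval f i \<subseteq> f 0 - f ?N" if "i < ?N" for i
    using decreasing_le[of ?N f 0 i] decreasing_le[of ?N f "Suc i" ?N] dec that
    unfolding interval_def by fastforce
  note order = interval_order[of ?N f, OF up dec]
  note less = interval_less[of ?N f, OF up dec]
  have "\<forall>q\<in>worlds ?F. (\<lambda>(i, z). h i z) q \<in> f 0 - f ?N"
    using W T(1) J by fastforce
  moreover have "acc ((\<lambda>(i, z). h i z) q) ((\<lambda>(i, z). h i z) q')" if "(q, q') \<in> rel ?F" for q q'
  proof -
    obtain i y j z where q: "q = (i, y)" "q' = (j, z)" by fastforce
    show ?thesis using that order(1)[of i j] T(1)[of i] T(1)[of j] T(2)[of i] unfolding q R by auto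
  qed
  moreover have "\<forall>p\<in>\<tau>. \<forall>q\<in>worlds ?F. q \<in> val (osum_model Ms) p \<longleftrightarrow> Var p \<in> (\<lambda>(i, z). h i z) q"
    using W T(3) by (auto simp: val_osum)
  moreover have ex: "\<exists>q\<in>worlds ?F. (\<lambda>(i, z). h i z) q = w" if w: "w \<in> Rl \<inter> (f 0 - f ?N)" for w
  proof -
    obtain i where i: "i < ?N" "w \<in> interval f i"
      using decreasing_index[of w f ?N] w unfolding interval_def by auto
    obtain z where "z \<in> worlds (frame_of (Ms ! i))" "h i z = w" using T(4)[OF i(1) _ i(2)] w by blast
    then show ?thesis using W[of i z] i by (intro bexI[of _ "(i, z)"]) auto
  qed
  moreover have "\<exists>q'\<in>worlds ?F. (q, q') \<in> rel ?F \<and> (\<lambda>(i, z). h i z) q' = w"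
    if w: "w \<in> Rl \<inter> (f 0 - f ?N)" and q: "q \<in> worlds ?F" and a: "acc ((\<lambda>(i, z). h i z) q) w" for w q
  proof -
    obtain i where i: "i < ?N" "w \<in> interval f i"
      using decreasing_index[of w f ?N] w unfolding interval_def by auto
    obtain j y where qj: "q = (j, y)" "j < ?N" "y \<in> worlds (frame_of (Ms ! j))" using q W by (cases q) auto
    have "j \<le> i" using less[of j i "h j y" w] qj i a T(1) by simp
    show ?thesis
    proof (cases "j = i")
      case True
      then obtain z where "z \<in> worlds (frame_of (Ms ! i))" "(y, z) \<in> rel (frame_of (Ms ! i))" "h i z = w"
        using T(5)[OF i(1) _ i(2), of y] qj a w by auto
      then show ?thesis using W[of i z] R i qj True by (intro bexI[of _ "(i, z)"]) auto
    next
      case False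
      obtain z where "z \<in> worlds (frame_of (Ms ! i))" "h i z = w" using T(4)[OF i(1) _ i(2)] w by blast
      then show ?thesis using W[of i z] R i qj False \<open>j \<le> i\<close> by (intro bexI[of _ "(i, z)"]) auto
    qed
  qed
  moreover have "\<exists>q. root ?F q \<and> (\<lambda>(i, z). h i z) q = x" if xJ: "x \<in> f 0 - f ?N"
  proof -
    obtain i where i: "i < ?N" "x \<in> interval f i"
      using decreasing_index[of x f ?N] xJ unfolding interval_def by auto
    obtain z where z: "root (frame_of (Ms ! i)) z" "h i z = x" using T(6)[OF i] by blast
    have zW: "z \<in> worlds (frame_of (Ms ! i))" using z by (simp add: root_def)
    \<comment> \<open>A point of an earlier interval would see \<open>x\<close> without being seen
      from it, although the root precedes every point.\<close>
    have "i = 0"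
    proof (rule ccontr)
      assume "i \<noteq> 0"
      obtain y where "y \<in> worlds (frame_of (Ms ! 0))" using ne by fastforce
      then have y: "h 0 y \<in> interval f 0" using T(1)[of 0] ne by simp
      have "h 0 y \<in> W" using y up[of 0] upset_sub unfolding interval_def by auto
      then have "le x (h 0 y)" by (rule root_le)
      moreover have "acc (h 0 y) x" "\<not> acc x (h 0 y)"
        using order[of 0 i "h 0 y" x] y i \<open>i \<noteq> 0\<close> by auto
      ultimately show False unfolding le_def by auto
    qed
    have "root ?F (i, z)" unfolding root_def
    proof (intro conjI ballI impI)
      show "(i, z) \<in> worlds ?F" using W i zW by simp
      fix q assume q: "q \<in> worlds ?F" "q \<noteq> (i, z)"
      obtain j y where qj: "q = (j, y)" "j < ?N" "y \<in> worlds (frame_of (Ms ! j))" using q W by (cases q) auto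
      show "((i, z), q) \<in> rel ?F" using qj q(2) z(1) zW i R \<open>i = 0\<close> by (auto simp: root_def)
    qed
    then show ?thesis using z(2) by (intro exI[of _ "(i, z)"]) auto
  qed
  ultimately show ?thesis unfolding tmap_def by blast
qed

text \<open>Each component is pulled back with \<open>later\<close> as its context, and the maps are
  glued along the intervals. When the two worlds lie in different components, the existence half of
  the last clause of \<open>pullback\<close> supplies a witness, which every point of the earlier
  interval sees.\<close>

lemma vmap_osum:
  assumes up: "\<And>i. i \<le> length Fs \<Longrightarrow> upset (f i)" and dec: "\<And>i. i < length Fs \<Longrightarrow> f (Suc i) \<subseteq> f i"
    and V: "\<And>i. i < length Fs \<Longrightarrow> vmap (Fs ! i) (interval f i)"
  shows "vmap (osum_frame Fs) (f 0 - f (length Fs))"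
  unfolding vmap_def
proof (intro allI impI)
  fix \<chi> S and v :: "nat \<Rightarrow> (nat \<times> 'a) set"
  assume v: "\<forall>p. v p \<in> internal (osum_frame Fs)"
  let ?N = "length Fs" and ?F = "osum_frame Fs" and ?J = "f 0 - f (length Fs)"
  define vi where "vi i p = {z. (i, z) \<in> v p}" for i p
  have vint: "\<forall>p. vi i p \<in> internal (Fs ! i)" if "i < ?N" for i
    using internal_osum_fibre[of _ Fs i] v that by (simp add: vi_def)
  let ?M = "\<lambda>i. Model (Fs ! i) (vi i)" and ?S = "\<lambda>i. later Fs v S i"
  have "\<exists>g. pullback (Fs ! i) (interval f i) \<chi> (?S i) (vi i) g" if "i < ?N" for i
    using V[OF that] vint[OF that] unfolding vmap_def by blast
  then obtain g where g: "\<And>i. i < ?N \<Longrightarrow> pullback (Fs ! i) (interval f i) \<chi> (?S i) (vi i) (g i)" by metis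
  have gW: "\<And>u. u \<in> interval f i \<Longrightarrow> g i u \<in> worlds (Fs ! i)"
    and gD: "\<And>p. dfn {u \<in> interval f i. g i u \<in> vi i p}"
    and gR: "\<And>u u'. u \<in> interval f i \<Longrightarrow> u' \<in> interval f i \<Longrightarrow> acc u u' \<Longrightarrow> (g i u, g i u') \<in> rel (Fs ! i)"
    and gE: "\<And>\<psi> z. \<psi> \<in> subforms \<chi> \<Longrightarrow> z \<in> worlds (Fs ! i) \<Longrightarrow> csat (?M i) (?S i) z \<psi> \<Longrightarrow>
       \<exists>u\<in>interval f i. csat (?M i) (?S i) (g i u) \<psi>"
    and gB: "\<And>\<psi> z u. \<psi> \<in> subforms \<chi> \<Longrightarrow> z \<in> worlds (Fs ! i) \<Longrightarrow> csat (?M i) (?S i) z \<psi> \<Longrightarrow>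
       u \<in> interval f i \<Longrightarrow> (g i u, z) \<in> rel (Fs ! i) \<Longrightarrow>
        \<exists>u'\<in>interval f i. acc u u' \<and> csat (?M i) (?S i) (g i u') \<psi>"
    if "i < ?N" for i
    using g[OF that, unfolded pullback_def] by simp_all
  have cs: "csat (Model ?F v) S (i, z) \<phi> \<longleftrightarrow> csat (?M i) (?S i) z \<phi>" 
    if "i < ?N" "z \<in> worlds (Fs ! i)" for i z \<phi>
  proof -
    have "vi i = (\<lambda>p. {z. (i, z) \<in> v p})" by (rule ext) (simp add: vi_def)
    then show ?thesis using csat_osum[OF that] by simp
  qed
  define idx where "idx u = (THE i. i < ?N \<and> u \<in> interval f i)" for u
  have idx: "idx u = i" if "i < ?N" "u \<in> interval f i" for u i
    unfolding idx_def using interval_unique[of ?N f] dec that by (intro the_equality) auto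
  have ixE: "\<exists>i<?N. u \<in> interval f i" if "u \<in> ?J" for u
    using decreasing_index[of u f ?N] that unfolding interval_def by blast
  have J: "interval f i \<subseteq> ?J" if "i < ?N" for i
    using decreasing_le[of ?N f 0 i] decreasing_le[of ?N f "Suc i" ?N] dec that
    unfolding interval_def by fastforce
  define k where "k u = (idx u, g (idx u) u)" for u
  have k: "k u = (i, g i u)" if "i < ?N" "u \<in> interval f i" for u i
    using idx[OF that] by (simp add: k_def)
  note order = interval_order[of ?N f, OF up dec]
  note less = interval_less[of ?N f, OF up dec]
  have "pullback ?F ?J \<chi> S v k" unfolding pullback_def
  proof (intro conjI ballI allI impI)
    fix u assume "u \<in> ?J"
    then obtain i where "i < ?N" "u \<in> interval f i" using ixE by blast
    then show "k u \<in> worlds ?F" using k gW by (simp add: worlds_osum)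
  next
    fix p
    have "{u \<in> ?J. k u \<in> v p} = (\<Union>i\<in>{..<?N}. {u \<in> interval f i. g i u \<in> vi i p})"
    proof (intro set_eqI iffI)
      fix u assume "u \<in> {u \<in> ?J. k u \<in> v p}"
      then show "u \<in> (\<Union>i\<in>{..<?N}. {u \<in> interval f i. g i u \<in> vi i p})"
        using ixE[of u] k by (auto simp: vi_def)
    next
      fix u assume "u \<in> (\<Union>i\<in>{..<?N}. {u \<in> interval f i. g i u \<in> vi i p})"
      then obtain i where "i < ?N" "u \<in> interval f i" "g i u \<in> vi i p" by blast
      then show "u \<in> {u \<in> ?J. k u \<in> v p}" using k J by (auto simp: vi_def)
    qed
    then show "dfn {u \<in> ?J. k u \<in> v p}" using gD by (auto intro: dfn_UN)
  next
    fix u u' assume u: "u \<in> ?J" "u' \<in> ?J" "acc u u'"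
    obtain i where i: "i < ?N" "u \<in> interval f i" using ixE u by blast
    obtain j where j: "j < ?N" "u' \<in> interval f j" using ixE u by blast
    have "i \<le> j" using less[of i j u u'] i j u by simp
    then show "(k u, k u') \<in> rel ?F"
      using k[OF i] k[OF j] gR[OF i(1)] gW[OF i] gW[OF j] i j u by (cases "i = j") (auto simp: rel_osum)
  next
    fix \<psi> q assume p: "\<psi> \<in> subforms \<chi>" and q: "q \<in> worlds ?F" "csat (Model ?F v) S q \<psi>"
    obtain j z where z: "q = (j, z)" "j < ?N" "z \<in> worlds (Fs ! j)" using q(1) by (auto simp: worlds_osum)
    have c: "csat (?M j) (?S j) z \<psi>" using q cs z by simp
    obtain u where u: "u \<in> interval f j" "csat (?M j) (?S j) (g j u) \<psi>"
      using gE[OF z(2) p z(3) c] by blast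
    have uc: "csat (Model ?F v) S (k u) \<psi>" using cs[OF z(2) gW[OF z(2) u(1)]] u k[OF z(2) u(1)] by simp
    then show "\<exists>u\<in>?J. csat (Model ?F v) S (k u) \<psi>" using u(1) J[OF z(2)] by blast
    fix u' assume u': "u' \<in> ?J" "(k u', q) \<in> rel ?F"
    obtain i where i: "i < ?N" "u' \<in> interval f i" using ixE u' by blast
    have "i \<le> j" using u'(2) k[OF i] z by (auto simp: rel_osum)
    show "\<exists>u\<in>?J. acc u' u \<and> csat (Model ?F v) S (k u) \<psi>"
    proof (cases "i = j")
      case True
      then have "(g j u', z) \<in> rel (Fs ! j)" using u'(2) k[OF i] z by (auto simp: rel_osum)
      then obtain w where w: "w \<in> interval f j" "acc u' w" "csat (?M j) (?S j) (g j w) \<psi>"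
        using gB[OF z(2) p z(3) c] i True by blast
      have "csat (Model ?F v) S (k w) \<psi>" using cs[OF z(2) gW[OF z(2) w(1)]] w k[OF z(2) w(1)] by simp
      then show ?thesis using w J[OF z(2)] by blast
    next
      case False
      then have "acc u' u" using order(1)[of i j u' u] \<open>i \<le> j\<close> i u z by simp
      then show ?thesis using uc u(1) J[OF z(2)] by blast
    qed
  qed
  then show "\<exists>g. pullback ?F ?J \<chi> S v g" by blast
qed

lemma block_osum:
  assumes ne: "Ms \<noteq> []" and b: "\<And>i. i < length Ms \<Longrightarrow> block Rl (Ms ! i) (f i) (f (Suc i)) H"
  shows "block Rl (osum_model Ms) (f 0) (f (length Ms)) H"
proof -
  let ?N = "length Ms"
  have dec: "f (Suc i) \<subseteq> f i" if "i < ?N" for i using b[OF that] by (simp add: block_def)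
  have up: "upset (f i)" if "i \<le> ?N" for i
    using b[of i] b[of "i - 1"] that ne by (cases "i = ?N") (auto simp: block_def)
  have dm: "delta_model \<tau> (Ms ! i)" if "i < ?N" for i using b[OF that] by (simp add: block_def)
  have "\<exists>h. tmap Rl (Ms ! i) h (interval f i) \<and> (\<forall>z\<in>worlds (frame_of (Ms ! i)). h z \<in> H)" if "i < ?N" for i
    using b[OF that] by (simp add: block_def interval_def)
  then obtain h where h: "\<And>i. i < ?N \<Longrightarrow> tmap Rl (Ms ! i) (h i) (interval f i)"
    "\<And>i z. i < ?N \<Longrightarrow> z \<in> worlds (frame_of (Ms ! i)) \<Longrightarrow> h i z \<in> H" by metis
  have "tmap Rl (osum_model Ms) (\<lambda>(i, z). h i z) (f 0 - f ?N)"
    using dm by (intro tmap_osum up dec ne h(1)) (auto simp: delta_model_def general_frame_def)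
  moreover have "\<forall>q\<in>worlds (frame_of (osum_model Ms)). (\<lambda>(i, z). h i z) q \<in> H"
    using h(2) by (auto simp: frame_of_osum worlds_osum)
  moreover have "vmap (frame_of (osum_model Ms)) (f 0 - f ?N)"
    unfolding frame_of_osum using vmap_osum[of "map frame_of Ms" f] up dec b
    by (simp add: block_def interval_def)
  moreover have "delta_model \<tau> (osum_model Ms)"
    using dm by (intro delta_model_osum ne) (auto simp: in_set_conv_nth)
  moreover have "f ?N \<subseteq> f 0" using decreasing_le[of ?N f 0 ?N] dec by simp
  ultimately show ?thesis unfolding block_def using up by blast
qed

lemma block_types:
  assumes "block Rl M U U' H" "z \<in> worlds (frame_of M)"
  shows "\<exists>u\<in>H. \<forall>p\<in>\<tau>. z \<in> val M p \<longleftrightarrow> Var p \<in> u"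
proof -
  obtain h where h: "tmap Rl M h (U - U')" "\<forall>z\<in>worlds (frame_of M). h z \<in> H"
    using assms(1) unfolding block_def by (elim conjE exE)
  show ?thesis by (rule bexI[of _ "h z"]) (use h tmapD(3)[OF h(1)] assms(2) in simp_all)
qed

lemma block_mono: "block Rl M U U' H \<Longrightarrow> H \<subseteq> H' \<Longrightarrow> block Rl M U U' H'"
  unfolding block_def by (elim conjE exE, intro conjI exI) (assumption | blast)+

text \<open>A back condition for relevant points is enough for truth: by \<open>cov\<close>, any
  witness of a diamond can be replaced by a relevant point that is equal to it or later, hence is
  also seen.\<close>

lemma tmap_truth:
  assumes t: "tmap Rl M h W" and gf: "general_frame (frame_of M)"
    and cov: "\<And>\<psi> y. \<psi> \<in> subforms \<phi> \<Longrightarrow> y \<in> W \<Longrightarrow> \<psi> \<in> y \<Longrightarrow> \<exists>w\<in>Rl \<inter> W. \<psi> \<in> w \<and> le y w"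
    and f: "\<phi> \<in> Fm \<tau>" and z: "z \<in> worlds (frame_of M)" and psi: "\<psi> \<in> subforms \<phi>"
  shows "sat M z \<psi> \<longleftrightarrow> \<psi> \<in> h z"
  using z psi
proof (induction \<psi> arbitrary: z)
  case (Var p)
  then show ?case using tmapD(3)[OF t] subforms_Fm[OF f Var(2)] by simp
next
  case Top
  then show ?case using tmapD(1)[OF t] by simp
next
  case Bot
  then show ?case using tmapD(1)[OF t] by simp
next
  case (Neg \<psi>)
  have "\<psi> \<in> subforms \<phi>" using Neg.prems(2) by (rule subforms_trans) simp
  moreover have "h z \<in> W" using tmapD(1)[OF t] Neg.prems by simp
  ultimately show ?case using Neg W_Neg subforms_Fm[OF f] by auto
next
  case (And \<psi> \<psi>')
  have "\<psi> \<in> subforms \<phi>" "\<psi>' \<in> subforms \<phi>" using And.prems(2) by (rule subforms_trans, simp)+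
  moreover have "h z \<in> W" using tmapD(1)[OF t] And.prems by simp
  ultimately show ?case using And W_And by auto
next
  case (Dia \<psi>)
  have s: "\<psi> \<in> subforms \<phi>" using Dia.prems(2) by (rule subforms_trans) simp
  have hz: "h z \<in> W" using tmapD(1)[OF t] Dia.prems by simp
  show ?case
  proof
    assume "sat M z (Dia \<psi>)"
    then obtain y where y: "y \<in> worlds (frame_of M)" "(z, y) \<in> rel (frame_of M)" "sat M y \<psi>" by auto
    have "\<psi> \<in> h y" using Dia.IH y s by blast
    moreover have "acc (h z) (h y)" "h y \<in> W" using tmapD(1,2)[OF t] y by simp_all
    ultimately show "Dia \<psi> \<in> h z" using W_Dia[OF hz] by blast
  next
    assume "Dia \<psi> \<in> h z"
    then obtain y where y: "y \<in> W" "acc (h z) y" "\<psi> \<in> y" using W_Dia[OF hz] by blast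
    obtain w where w: "w \<in> Rl \<inter> W" "\<psi> \<in> w" "le y w" using cov[OF s y(1,3)] by blast
    then have "acc (h z) w" using acc_le_trans hz y by blast
    then obtain z' where "z' \<in> worlds (frame_of M)" "(z, z') \<in> rel (frame_of M)" "h z' = w"
      using tmapD(5)[OF t, of w z] w Dia.prems by blast
    then show "sat M z (Dia \<psi>)" using Dia.IH s w by auto
  qed
qed

lemma subst_sig: "(\<And>p. p \<in> sig \<phi> \<Longrightarrow> s p \<in> Fm \<tau>) \<Longrightarrow> subst s \<phi> \<in> Fm \<tau>"
  by (induction \<phi>) auto

text \<open>A refuting valuation pulls back to formulas \<open>s p\<close>, under which truth at
  \<open>g u\<close> becomes membership of the substitution instance in \<open>u\<close>. Since
  \<open>L\<close> is closed under substitution, no point can refute such an instance of a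
  theorem.\<close>

lemma vmap_valid:
  assumes V: "vmap F W" and gf: "general_frame F"
  shows "frame_for L F"
  unfolding frame_for_def
proof (intro conjI gf ballI allI impI)
  fix \<chi> and v :: "nat \<Rightarrow> 'a set" and y assume chi: "\<chi> \<in> L" and v: "\<forall>p. v p \<in> internal F" and y: "y \<in> worlds F"
  let ?M = "Model F v"
  show "sat ?M y \<chi>"
  proof (rule ccontr)
    assume "\<not> sat ?M y \<chi>"
    then have n: "csat ?M {} y (Neg \<chi>)" by (simp add: sat_csat)
    \<comment> \<open>Taking the negated formula makes the existence clause of
      \<open>pullback\<close> yield a point of \<open>W\<close> whose image refutes \<chi>.\<close>
    obtain g where g: "pullback F W (Neg \<chi>) {} v g"
      using V[unfolded vmap_def, rule_format, of v "Neg \<chi>" "{}"] v by auto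
    have gW: "\<forall>u\<in>W. g u \<in> worlds F" and gD: "\<forall>p. dfn {u \<in> W. g u \<in> v p}"
      and gR: "\<forall>u\<in>W. \<forall>u'\<in>W. acc u u' \<longrightarrow> (g u, g u') \<in> rel F"
      and gB: "\<forall>\<psi>\<in>subforms (Neg \<chi>). \<forall>z\<in>worlds F. csat ?M {} z \<psi> \<longrightarrow>
             (\<exists>u\<in>W. csat ?M {} (g u) \<psi>) \<and>
             (\<forall>u\<in>W. (g u, z) \<in> rel F \<longrightarrow> (\<exists>u'\<in>W. acc u u' \<and> csat ?M {} (g u') \<psi>))"
      using g[unfolded pullback_def] by simp_all
    have "\<forall>p. \<exists>\<kappa>\<in>Fm \<tau>. \<forall>u\<in>W. g u \<in> v p \<longleftrightarrow> \<kappa> \<in> u" using gD unfolding dfn_def by simp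
    then obtain s where s: "\<And>p. s p \<in> Fm \<tau>" "\<And>p u. u \<in> W \<Longrightarrow> g u \<in> v p \<longleftrightarrow> s p \<in> u" by metis
    have sF: "subst s \<phi> \<in> Fm \<tau>" for \<phi> using s(1) by (intro subst_sig)
    have key: "csat ?M {} (g u) \<psi> \<longleftrightarrow> subst s \<psi> \<in> u" if "u \<in> W" "\<psi> \<in> subforms (Neg \<chi>)" for u \<psi>
      using that
    proof (induction \<psi> arbitrary: u)
      case (Neg \<psi>)
      have "\<psi> \<in> subforms (Neg \<chi>)" using Neg.prems(2) by (rule subforms_trans) simp
      then show ?case using Neg sF by simp
    next
      case (And \<psi> \<psi>')
      have "\<psi> \<in> subforms (Neg \<chi>)" "\<psi>' \<in> subforms (Neg \<chi>)" using And.prems(2) by (rule subforms_trans, simp)+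
      then show ?case using And by simp
    next
      case (Dia \<psi>)
      have sf: "\<psi> \<in> subforms (Neg \<chi>)" using Dia.prems(2) by (rule subforms_trans) simp
      have "csat ?M {} (g u) (Dia \<psi>) \<longleftrightarrow> (\<exists>u'\<in>W. acc u u' \<and> csat ?M {} (g u') \<psi>)"
      proof
        assume "csat ?M {} (g u) (Dia \<psi>)"
        then obtain z where "z \<in> worlds F" "(g u, z) \<in> rel F" "csat ?M {} z \<psi>" by auto
        then show "\<exists>u'\<in>W. acc u u' \<and> csat ?M {} (g u') \<psi>" using gB sf Dia.prems(1) by blast
      next
        assume "\<exists>u'\<in>W. acc u u' \<and> csat ?M {} (g u') \<psi>"
        then show "csat ?M {} (g u) (Dia \<psi>)" using gR gW Dia.prems(1) by auto
      qed
      also have "\<dots> \<longleftrightarrow> (\<exists>u'\<in>W. acc u u' \<and> subst s \<psi> \<in> u')" using Dia.IH sf by blast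
      finally show ?case using W_Dia Dia.prems(1) by simp
    qed (use s in auto)
    obtain u where u: "u \<in> W" "csat ?M {} (g u) (Neg \<chi>)" using gB n y by (meson subforms_self)
    then have "Neg (subst s \<chi>) \<in> u" using key by fastforce
    moreover have "subst s \<chi> \<in> u" using mcs_L[OF W_mcs[OF u(1)] subst_in[OF chi] sF] .
    ultimately show False using W_Neg[OF u(1) sF] by blast
  qed
qed

lemma block_final:
  assumes b: "block Rl M W {} H"
    and cov: "\<And>\<psi> y. \<psi> \<in> subforms \<phi> \<Longrightarrow> y \<in> W \<Longrightarrow> \<psi> \<in> y \<Longrightarrow> \<exists>w\<in>Rl \<inter> W. \<psi> \<in> w \<and> le y w"
    and f: "\<phi> \<in> Fm \<tau>"
  obtains z where "rooted_delta_model \<tau> M z" "sat M z \<phi> \<longleftrightarrow> \<phi> \<in> x" "frame_for L (frame_of M)"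
    "\<And>p. p \<in> \<tau> \<Longrightarrow> z \<in> val M p \<longleftrightarrow> Var p \<in> x"
proof -
  obtain h where h: "tmap Rl M h W" and d: "delta_model \<tau> M" and v: "vmap (frame_of M) W"
    using b unfolding block_def by (elim conjE exE) simp
  have g: "general_frame (frame_of M)" using d by (simp add: delta_model_def)
  obtain z where z: "root (frame_of M) z" "h z = x" using tmapD(6)[OF h] by auto
  have zW: "z \<in> worlds (frame_of M)" using z by (simp add: root_def)
  show thesis
  proof (rule that[of z])
    show "rooted_delta_model \<tau> M z" using z d by (simp add: rooted_delta_model_def)
    show "sat M z \<phi> \<longleftrightarrow> \<phi> \<in> x" using tmap_truth[OF h g cov f zW] z by simp
    show "frame_for L (frame_of M)" using vmap_valid v g by blast
    show "z \<in> val M p \<longleftrightarrow> Var p \<in> x" if "p \<in> \<tau>" for p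
      using tmapD(3)[OF h that zW] z by simp
  qed
qed

end

section \<open>Blocks on atomic frames\<close>

lemma kripke_simps [simp]:
  "worlds (kripke_frame V R) = V" "rel (kripke_frame V R) = R" "internal (kripke_frame V R) = Pow V"
  by (simp_all add: kripke_frame_def)

lemma general_kripke_frame: "V \<noteq> {} \<Longrightarrow> R \<subseteq> V \<times> V \<Longrightarrow> general_frame (kripke_frame V R)"
  by (auto simp: general_frame_def dia_set_def)

lemma worlds_irr_chain: "worlds (irr_chain m) = A ` {..<m}"
  by (auto simp: irr_chain_def)

lemma rel_irr_chain: "(y, z) \<in> rel (irr_chain m) \<longleftrightarrow> (\<exists>i j. y = A i \<and> z = A j \<and> i < j \<and> j < m)"
  by (auto simp: irr_chain_def)

lemma general_irr_chain: "0 < m \<Longrightarrow> general_frame (irr_chain m)"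
  unfolding irr_chain_def by (rule general_kripke_frame) auto

lemma worlds_refl_cluster: "worlds (refl_cluster k) = A ` {..<k}"
  by (auto simp: refl_cluster_def)

lemma rel_refl_cluster: "rel (refl_cluster k) = A ` {..<k} \<times> A ` {..<k}"
  by (auto simp: refl_cluster_def)

lemma general_refl_cluster: "0 < k \<Longrightarrow> general_frame (refl_cluster k)"
  unfolding refl_cluster_def by (rule general_kripke_frame) auto

lemma root_cluster_alt: "root_cluster k = A ` {..<k}"
  by (auto simp: root_cluster_def)

lemma worlds_C: "worlds (C_frame r k) = A ` {..<k} \<union> range B"
  by (simp add: C_frame_def C_worlds_def root_cluster_alt)

lemma rel_C: "(y, z) \<in> rel (C_frame r k) \<longleftrightarrow>
    (y \<in> A ` {..<k} \<and> z \<in> worlds (C_frame r k)) \<or>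
    (\<exists>n m. y = B n \<and> z = B m \<and> (m < n \<or> r \<and> m = n))"
  by (auto simp: C_frame_def C_rel_def C_worlds_def root_cluster_alt)

lemma generated_sub:
  "X \<in> generated V R G \<Longrightarrow> \<Union>G \<subseteq> V \<Longrightarrow> X \<subseteq> V"
  by (induction rule: generated.induct) (auto simp: dia_set_def)

lemma C_gen_sub: "i < k \<Longrightarrow> C_gen k i \<subseteq> C_worlds k"
  by (auto simp: C_gen_def C_worlds_def root_cluster_alt)

lemma internal_C_sub: "X \<in> internal (C_frame r k) \<Longrightarrow> X \<subseteq> worlds (C_frame r k)"
proof -
  assume X: "X \<in> internal (C_frame r k)"
  have "\<Union>({C_gen k i | i. i < k} \<union> {{B n} | n. True}) \<subseteq> C_worlds k"
    using C_gen_sub by (auto simp: C_worlds_def)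
  from generated_sub[OF _ this, of X "C_rel r k"] X show "X \<subseteq> worlds (C_frame r k)"
    by (simp add: C_frame_def)
qed

lemma general_C_frame:
  assumes "0 < k" shows "general_frame (C_frame r k)"
proof -
  have "internal (C_frame r k) \<subseteq> Pow (worlds (C_frame r k))" using internal_C_sub by blast
  moreover have "rel (C_frame r k) \<subseteq> worlds (C_frame r k) \<times> worlds (C_frame r k)"
    by (auto simp: C_frame_def C_rel_def C_worlds_def)
  moreover have "worlds (C_frame r k) \<noteq> {}" by (auto simp: worlds_C)
  ultimately show ?thesis unfolding general_frame_def
    by (auto simp: C_frame_def intro: generated.intros)
qed

lemma generated_Un:
  assumes "\<Union>G \<subseteq> V" "X \<in> generated V R G" "Y \<in> generated V R G"
  shows "X \<union> Y \<in> generated V R G"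
proof -
  have "V - ((V - X) \<inter> (V - Y)) \<in> generated V R G"
    using assms by (intro gen_compl gen_int)
  moreover have "V - ((V - X) \<inter> (V - Y)) = X \<union> Y"
    using generated_sub[OF assms(2,1)] generated_sub[OF assms(3,1)] by blast
  ultimately show ?thesis by simp
qed

lemma C_union_internal:
  assumes "I \<subseteq> {..<k}" shows "(\<Union>i\<in>I. C_gen k i) \<in> internal (C_frame r k)"
proof -
  let ?G = "{C_gen k i | i. i < k} \<union> {{B n} | n. True}"
  have G: "\<Union>?G \<subseteq> C_worlds k" using C_gen_sub by (auto simp: C_worlds_def)
  have "finite I" using assms finite_subset by blast
  then have "(\<Union>i\<in>I. C_gen k i) \<in> generated (C_worlds k) (C_rel r k) ?G"
    using assms
  proof (induction I rule: finite_induct)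
    case (insert i I)
    then have "C_gen k i \<in> generated (C_worlds k) (C_rel r k) ?G" by (auto intro: gen_base)
    then show ?case using insert generated_Un[OF G] by simp
  qed (simp add: gen_empty)
  then show ?thesis by (simp add: C_frame_def)
qed

text \<open>The sets with this property are closed under \<open>\<Diamond>\<close> because such a set contains some \<open>B m\<close>
  unless it is empty.\<close>

lemma C_internal_periodic:
  assumes "X \<in> internal (C_frame r k)" "0 < k"
  shows "\<exists>n0. \<forall>n\<ge>n0. B n \<in> X \<longleftrightarrow> A (n mod k) \<in> X"
proof -
  let ?G = "{C_gen k i | i. i < k} \<union> {{B n} | n. True}"
  have G: "\<Union>?G \<subseteq> C_worlds k" using C_gen_sub by (auto simp: C_worlds_def)
  have "X \<in> generated (C_worlds k) (C_rel r k) ?G" using assms by (simp add: C_frame_def)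
  then show ?thesis
  proof (induction rule: generated.induct)
    case (gen_base X)
    then consider i where "i < k" "X = C_gen k i" | n where "X = {B n}" by blast
    then show ?case
    proof cases
      case 2
      then show ?thesis by (intro exI[of _ "Suc n"]) auto
    qed (auto simp: C_gen_def)
  next
    case (gen_int X Y)
    then obtain a b where "\<forall>n\<ge>a. B n \<in> X \<longleftrightarrow> A (n mod k) \<in> X" "\<forall>n\<ge>b. B n \<in> Y \<longleftrightarrow> A (n mod k) \<in> Y"
      by blast
    then show ?case by (intro exI[of _ "max a b"]) auto
  next
    case (gen_dia X)
    then obtain a where a: "\<forall>n\<ge>a. B n \<in> X \<longleftrightarrow> A (n mod k) \<in> X" by blast
    have X: "X \<subseteq> C_worlds k" using generated_sub[OF gen_dia(1) G] .
    show ?case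
    proof (cases "\<exists>m. B m \<in> X")
      case True
      then obtain m where m: "B m \<in> X" by blast
      have "B n \<in> dia_set (C_worlds k) (C_rel r k) X" if "n > m" for n
        using m that by (auto simp: dia_set_def C_worlds_def C_rel_def)
      moreover have "A (n mod k) \<in> dia_set (C_worlds k) (C_rel r k) X" for n
        using m assms(2) by (auto simp: dia_set_def C_worlds_def C_rel_def root_cluster_alt)
      ultimately show ?thesis by (intro exI[of _ "Suc m"]) auto
    next
      case False
      have "A i \<notin> X" if "i < k" for i
      proof -
        have "a * k + i \<ge> a" "(a * k + i) mod k = i" using that by (auto intro: trans_le_add1)
        then show ?thesis using a False by metis
      qed
      then have "X = {}" using False X by (auto simp: C_worlds_def root_cluster_alt)
      then show ?thesis by (auto simp: dia_set_def)
    qed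
  qed (use assms in \<open>auto simp: C_worlds_def root_cluster_alt\<close>)
qed

text \<open>Far out, \<open>B n\<close> agrees with the point \<open>A (n mod k)\<close> on each
  formula. For a diamond: if its argument holds at some \<open>B m\<close> or later than the frame,
  the diamond is true at all large \<open>B n\<close> and in the root cluster; otherwise the
  induction hypothesis excludes it from the root cluster too.\<close>

lemma C_csat_periodic:
  assumes v: "\<And>p. v p \<in> internal (C_frame r k)" and k: "0 < k"
  shows "\<exists>n0. \<forall>n\<ge>n0. csat (Model (C_frame r k) v) S (B n) \<psi> \<longleftrightarrow>
     csat (Model (C_frame r k) v) S (A (n mod k)) \<psi>"
proof (induction \<psi>)
  case (Var p)
  then show ?case using C_internal_periodic[OF v[of p] k] by simp
next
  case (And \<psi> \<psi>')
  then obtain a b where "\<forall>n\<ge>a. csat (Model (C_frame r k) v) S (B n) \<psi> \<longleftrightarrow>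
     csat (Model (C_frame r k) v) S (A (n mod k)) \<psi>" "\<forall>n\<ge>b. csat (Model (C_frame r k) v) S (B n) \<psi>' \<longleftrightarrow>
     csat (Model (C_frame r k) v) S (A (n mod k)) \<psi>'" by blast
  then show ?case by (intro exI[of _ "max a b"]) auto
next
  case (Dia \<psi>)
  let ?M = "Model (C_frame r k) v"
  obtain a where a: "\<forall>n\<ge>a. csat ?M S (B n) \<psi> \<longleftrightarrow> csat ?M S (A (n mod k)) \<psi>" using Dia by blast
  show ?case
  proof (cases "\<psi> \<in> S \<or> (\<exists>m. csat ?M S (B m) \<psi>)")
    case True
    then obtain m where m: "\<psi> \<in> S \<or> csat ?M S (B m) \<psi>" by blast
    have bm: "B m \<in> worlds (C_frame r k)" by (simp add: worlds_C)
    have "csat ?M S (B n) (Dia \<psi>)" if "n > m" for n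
      using m that bm by (auto simp: rel_C)
    moreover have "csat ?M S (A (n mod k)) (Dia \<psi>)" for n
      using m bm k by (auto simp: rel_C)
    ultimately show ?thesis by (intro exI[of _ "Suc m"]) auto
  next
    case False
    have "\<not> csat ?M S (A i) \<psi>" if "i < k" for i
    proof -
      have "a * k + i \<ge> a" "(a * k + i) mod k = i" using that by (auto intro: trans_le_add1)
      then show ?thesis using a False by metis
    qed
    then have "\<not> csat ?M S z \<psi>" if "z \<in> worlds (C_frame r k)" for z
      using False that by (auto simp: worlds_C)
    then show ?thesis using False by auto
  qed
qed auto

text \<open>Makes precise that a formula sees only a bounded part of the sequence: whatever
  subformula is satisfied at all is already satisfied among the last \<open>N\<close>
  points.\<close>

lemma C_csat_bounded:
  assumes v: "\<And>p. v p \<in> internal (C_frame r k)" and k: "0 < k"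
  obtains N where "\<And>\<psi> z. \<psi> \<in> subforms \<chi> \<Longrightarrow> z \<in> worlds (C_frame r k) \<Longrightarrow>
    csat (Model (C_frame r k) v) S z \<psi> \<Longrightarrow> \<exists>m<N. csat (Model (C_frame r k) v) S (B m) \<psi>"
proof -
  let ?c = "csat (Model (C_frame r k) v) S"
  have "\<forall>\<psi>. \<exists>n0. \<forall>n\<ge>n0. ?c (B n) \<psi> \<longleftrightarrow> ?c (A (n mod k)) \<psi>"
    using C_csat_periodic[of v r k S, OF v k] by blast
  from choice[OF this] obtain n0
    where n0: "\<And>\<psi> n. n \<ge> n0 \<psi> \<Longrightarrow> ?c (B n) \<psi> \<longleftrightarrow> ?c (A (n mod k)) \<psi>" by blast
  \<comment> \<open>A common threshold for all subformulas. The index \<open>n1 * k + i\<close> is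
    beyond it, is congruent to \<open>i\<close> modulo \<open>k\<close>, and stays below the bound
    \<open>n1 * k + k\<close>.\<close>
  define n1 where "n1 = (\<Sum>\<psi>\<in>subforms \<chi>. n0 \<psi>)"
  have n1: "n0 \<psi> \<le> n1" if "\<psi> \<in> subforms \<chi>" for \<psi>
    unfolding n1_def by (rule member_le_sum) (use that in auto)
  have n1k: "n1 \<le> n1 * k" using k by simp
  show thesis
  proof (rule that[of "n1 * k + k"])
    fix \<psi> z assume p: "\<psi> \<in> subforms \<chi>" and z: "z \<in> worlds (C_frame r k)" "?c z \<psi>"
    have *: "\<exists>m<n1 * k + k. ?c (B m) \<psi>" if "i < k" "?c (A i) \<psi>" for i
    proof -
      have "n1 * k + i \<ge> n0 \<psi>" using n1[OF p] n1k by linarith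
      then have "?c (B (n1 * k + i)) \<psi>" using n0[of \<psi> "n1 * k + i"] that by simp
      then show ?thesis using that by (intro exI[of _ "n1 * k + i"]) auto
    qed
    show "\<exists>m<n1 * k + k. ?c (B m) \<psi>"
    proof (cases z)
      case (A i)
      then show ?thesis using * z by (auto simp: worlds_C)
    next
      case (B n)
      show ?thesis
      proof (cases "n < n1 * k + k")
        case False
        then have "n0 \<psi> \<le> n" using n1[OF p] n1k by linarith
        then show ?thesis using n0[of \<psi> n] z B *[of "n mod k"] k by simp
      qed (use z B in auto)
    qed
  qed
qed

text \<open>The canonical point copied by a world; along the \<open>B n\<close> the copies repeat
  with period \<open>k\<close>, in agreement with the generators \<open>C_gen\<close>.\<close>

fun copy :: "nat \<Rightarrow> (nat \<Rightarrow> form set) \<Rightarrow> point \<Rightarrow> form set" where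
  "copy k e (A i) = e i"
| "copy k e (B n) = e (n mod k)"

definition copy_model :: "point frame \<Rightarrow> nat \<Rightarrow> (nat \<Rightarrow> form set) \<Rightarrow> point model" where
  "copy_model F k e = Model F (\<lambda>p. {z \<in> worlds F. Var p \<in> copy k e z})"

lemma copy_model_simps [simp]:
  "frame_of (copy_model F k e) = F"
  "z \<in> val (copy_model F k e) p \<longleftrightarrow> z \<in> worlds F \<and> Var p \<in> copy k e z"
  by (simp_all add: copy_model_def)

lemma simple_atomic_irr:
  assumes "0 < m" shows "simple_atomic \<delta> (copy_model (irr_chain m) k e)"
proof -
  have "finite (worlds (irr_chain m))" "internal (irr_chain m) = Pow (worlds (irr_chain m))"
    by (simp add: worlds_irr_chain) (simp add: irr_chain_def)
  then show ?thesis
    using assms general_irr_chain unfolding simple_atomic_def simple_model_def delta_model_def atomic_frame_def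
    by auto
qed

lemma simple_atomic_cluster:
  assumes "0 < k" "k \<le> 2 ^ card \<delta>" shows "simple_atomic \<delta> (copy_model (refl_cluster k) k' e)"
proof -
  have "finite (worlds (refl_cluster k))" "internal (refl_cluster k) = Pow (worlds (refl_cluster k))"
    by (simp add: worlds_refl_cluster) (simp add: refl_cluster_def)
  then show ?thesis
    using assms general_refl_cluster unfolding simple_atomic_def simple_model_def delta_model_def atomic_frame_def
    by auto
qed

lemma val_copy_C:
  assumes k: "0 < k"
  shows "val (copy_model (C_frame r k) k e) p = (\<Union>i\<in>{i. i < k \<and> Var p \<in> e i}. C_gen k i)"
proof (intro set_eqI)
  fix z show "z \<in> val (copy_model (C_frame r k) k e) p \<longleftrightarrow> z \<in> (\<Union>i\<in>{i. i < k \<and> Var p \<in> e i}. C_gen k i)"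
    using k by (cases z) (auto simp: worlds_C C_gen_def)
qed

lemma simple_atomic_C:
  assumes "0 < k" "k \<le> 2 ^ card \<delta>" shows "simple_atomic \<delta> (copy_model (C_frame r k) k e)"
proof -
  have "\<exists>I\<subseteq>{..<k}. val (copy_model (C_frame r k) k e) p = (\<Union>i\<in>I. C_gen k i)" for p
    unfolding val_copy_C[OF assms(1)] by (rule exI[of _ "{i. i < k \<and> Var p \<in> e i}"]) auto
  moreover have "val (copy_model (C_frame r k) k e) p \<in> internal (C_frame r k)" for p
    unfolding val_copy_C[OF assms(1)] by (rule C_union_internal) auto
  moreover have "atomic_frame \<delta> (C_frame r k)"
    using assms unfolding atomic_frame_def by (cases r) auto
  moreover have "general_frame (C_frame r k)" by (rule general_C_frame[OF assms(1)])
  ultimately show ?thesis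
    unfolding simple_atomic_def simple_model_def delta_model_def copy_model_simps
    using assms(1) by (intro conjI disjI2 exI[of _ r] exI[of _ k]) simp_all
qed

lemma simple_atomic_delta: "simple_atomic \<delta> M \<Longrightarrow> delta_model \<delta> M"
  by (simp add: simple_atomic_def simple_model_def)

context K43_root
begin

text \<open>A finite run of irreflexive points is kept as it is. Its singletons are definable, so
  every valuation on the chain pulls back.\<close>

lemma block_irr:
  assumes up: "upset U" "upset U'" "U' \<subseteq> U" and m: "0 < m" and J: "U - U' = b ` {..<m}"
    and b: "\<And>i j. i < m \<Longrightarrow> j < m \<Longrightarrow> acc (b i) (b j) \<longleftrightarrow> i < j"
  shows "block Rl (copy_model (irr_chain m) k b) U U' (b ` {..<m})"
proof -
  let ?M = "copy_model (irr_chain m) k b"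
  have inj: "inj_on b {..<m}"
    by (rule inj_onI) (metis b lessThan_iff less_irrefl linorder_neqE_nat)
  have bW: "b i \<in> W" if "i < m" for i using J up that upset_sub by blast
  have "tmap Rl ?M (copy k b) (U - U')" unfolding tmap_def
  proof (intro conjI impI)
    assume "x \<in> U - U'"
    then obtain i where i: "i < m" "x = b i" using J by auto
    have "acc x (b j)" if "j < m" "j \<noteq> i" for j
      using root_le[OF bW[OF that(1)]] that i inj unfolding le_def by (auto dest: inj_onD)
    then have "i < j" if "j < m" "j \<noteq> i" for j using b i that by simp
    then have "root (irr_chain m) (A i)" using i unfolding root_def worlds_irr_chain rel_irr_chain by auto
    then show "\<exists>z. root (frame_of ?M) z \<and> copy k b z = x" using i by auto
  qed (use b J in \<open>auto simp: worlds_irr_chain rel_irr_chain\<close>)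
  moreover have "\<forall>z\<in>worlds (frame_of ?M). copy k b z \<in> b ` {..<m}"
    by (auto simp: worlds_irr_chain)
  moreover have "vmap (irr_chain m) (U - U')" unfolding vmap_def
  proof (intro allI impI)
    fix \<chi> S v
    define g where "g u = A (the_inv_into {..<m} b u)" for u
    have g: "g (b i) = A i" if "i < m" for i using that inj by (simp add: g_def the_inv_into_f_f)
    have "pullback (irr_chain m) (U - U') \<chi> S v g" unfolding pullback_def
    proof (intro conjI allI)
      fix p
      have e: "{u \<in> U - U'. g u \<in> v p} = (\<Union>i\<in>{i. i < m \<and> A i \<in> v p}. {b i})"
        unfolding J using g by auto
      show "dfn {u \<in> U - U'. g u \<in> v p}" unfolding e
        using b bW by (intro dfn_UN irr_singleton_dfn) auto
    qed (unfold J, use b g in \<open>auto simp: worlds_irr_chain rel_irr_chain\<close>)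
    then show "\<exists>g. pullback (irr_chain m) (U - U') \<chi> S v g" by blast
  qed
  ultimately show ?thesis unfolding block_def
    using up simple_atomic_delta[OF simple_atomic_irr[OF m]] by auto
qed

text \<open>The kept points need only be seen from the entire interval; they may be part of its last
  cluster. For validity, \<open>g\<close> retracts the interval to them, and each of them serves as
  its own witness for the back condition.\<close>

lemma block_cluster:
  assumes up: "upset U" "upset U'" "U' \<subseteq> U" and k: "0 < k" "k \<le> 2 ^ card \<tau>"
    and inj: "inj_on c {..<k}" and sub: "c ` {..<k} \<subseteq> U - U'"
    and last: "\<And>u i. u \<in> U - U' \<Longrightarrow> i < k \<Longrightarrow> acc u (c i)"
    and Rl: "Rl \<inter> (U - U') \<subseteq> c ` {..<k}" and root: "x \<in> U - U' \<Longrightarrow> x \<in> c ` {..<k}"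
  shows "block Rl (copy_model (refl_cluster k) k' c) U U' (c ` {..<k})"
proof -
  let ?M = "copy_model (refl_cluster k) k' c" and ?C = "c ` {..<k}"
  have "tmap Rl ?M (copy k' c) (U - U')" unfolding tmap_def
  proof (intro conjI impI)
    assume "x \<in> U - U'"
    then obtain i where i: "i < k" "x = c i" using root by auto
    then have "Defs.root (refl_cluster k) (A i)"
      unfolding root_def worlds_refl_cluster rel_refl_cluster by auto
    then show "\<exists>z. Defs.root (frame_of ?M) z \<and> copy k' c z = x" using i by auto
  qed (use sub last Rl in \<open>auto simp: worlds_refl_cluster rel_refl_cluster\<close>)
  moreover have "\<forall>z\<in>worlds (frame_of ?M). copy k' c z \<in> ?C"
    by (auto simp: worlds_refl_cluster)
  moreover have "vmap (refl_cluster k) (U - U')" unfolding vmap_def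
  proof (intro allI impI)
    fix \<chi> S v
    have C: "?C \<subseteq> W" "?C \<noteq> {}" using sub up upset_sub k by auto
    obtain g0 where g0: "\<And>u. g0 u \<in> ?C" "\<And>c'. c' \<in> ?C \<Longrightarrow> g0 c' = c'" "\<And>c'. dfn {u. g0 u = c'}"
      using retraction[of ?C] C by blast
    define g where "g u = A (the_inv_into {..<k} c (g0 u))" for u
    have g: "g (c i) = A i" if "i < k" for i using that inj g0(2) by (simp add: g_def the_inv_into_f_f)
    have gk: "\<exists>i<k. g u = A i \<and> g0 u = c i" for u
    proof -
      obtain i where i: "i < k" "g0 u = c i" using g0(1)[of u] by auto
      then have "g u = A i" using inj by (simp add: g_def the_inv_into_f_f)
      then show ?thesis using i by blast
    qed
    have "pullback (refl_cluster k) (U - U') \<chi> S v g" unfolding pullback_def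
    proof (intro conjI allI ballI impI)
      fix p
      have e: "{u \<in> U - U'. g u \<in> v p} = (U - U') \<inter> (\<Union>i\<in>{i. i < k \<and> A i \<in> v p}. {u. g0 u = c i})"
      proof (intro set_eqI)
        fix u
        obtain i where i: "i < k" "g u = A i" "g0 u = c i" using gk by blast
        have "j = i" if "j < k" "c j = c i" for j using inj i that by (auto dest: inj_onD)
        then show "u \<in> {u \<in> U - U'. g u \<in> v p} \<longleftrightarrow>
            u \<in> (U - U') \<inter> (\<Union>i\<in>{i. i < k \<and> A i \<in> v p}. {u. g0 u = c i})"
          using i by auto
      qed
      show "dfn {u \<in> U - U'. g u \<in> v p}" unfolding e
        using g0(3) up upset_dfn by (intro dfn_Int dfn_UN dfn_Diff) auto
    next
      fix \<psi> z assume z: "z \<in> worlds (refl_cluster k)" and c: "csat (Model (refl_cluster k) v) S z \<psi>"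
      then obtain i where i: "i < k" "z = A i" by (auto simp: worlds_refl_cluster)
      then show "\<exists>u\<in>U - U'. csat (Model (refl_cluster k) v) S (g u) \<psi>"
        using g c sub by (intro bexI[of _ "c i"]) auto
      fix u assume "u \<in> U - U'"
      then show "\<exists>u'\<in>U - U'. acc u u' \<and> csat (Model (refl_cluster k) v) S (g u') \<psi>"
        using i g c sub last by (intro bexI[of _ "c i"]) auto
    next
      fix u show "g u \<in> worlds (refl_cluster k)" using gk[of u] by (auto simp: worlds_refl_cluster)
    next
      fix u u' show "(g u, g u') \<in> rel (refl_cluster k)"
        using gk[of u] gk[of u'] by (auto simp: rel_refl_cluster)
    qed
    then show "\<exists>g. pullback (refl_cluster k) (U - U') \<chi> S v g" by blast
  qed
  ultimately show ?thesis unfolding block_def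
    using up simple_atomic_delta[OF simple_atomic_cluster[OF k]] by auto
qed

text \<open>Layers are numbered from the right, as the \<open>b_n\<close> are: \<open>f 0\<close> is
  what follows the interval, and each \<open>f (Suc j)\<close> adds one earlier layer. The sequence
  may depend on its length \<open>n\<close>, because a given formula only needs finitely many
  layers.\<close>

definition layers :: "bool \<Rightarrow> form set set \<Rightarrow> form set set \<Rightarrow> bool" where
  "layers r U U' \<longleftrightarrow> (\<forall>n. \<exists>f. f 0 = U' \<and> (\<forall>j\<le>n. upset (f j)) \<and> (\<forall>j<n. f j \<subseteq> f (Suc j)) \<and>
     f n \<subseteq> U \<and> f n \<noteq> U \<and>
     (\<forall>j<n. \<exists>w\<in>f (Suc j) - f j.
        if r then \<forall>u\<in>f (Suc j) - f j. acc u w else f (Suc j) - f j = {w} \<and> \<not> acc w w))"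

text \<open>With \<open>N\<close> from the bound for the formula at hand, the layer
  \<open>K j\<close> is sent to \<open>B j\<close>. A reflexive layer contains a point seen from the
  whole layer, matching a reflexive \<open>B j\<close>; an irreflexive layer is a single
  point.\<close>

lemma vmap_C:
  assumes up: "upset U" "upset U'" "U' \<subseteq> U" and k: "0 < k" and lay: "layers r U U'"
  shows "vmap (C_frame r k) (U - U')"
  unfolding vmap_def
proof (intro allI impI)
  fix \<chi> S and v :: "nat \<Rightarrow> point set" assume v: "\<forall>p. v p \<in> internal (C_frame r k)"
  let ?c = "csat (Model (C_frame r k) v) S"
  obtain N where N: "\<And>\<psi> z. \<psi> \<in> subforms \<chi> \<Longrightarrow> z \<in> worlds (C_frame r k) \<Longrightarrow> ?c z \<psi> \<Longrightarrow> \<exists>m<N. ?c (B m) \<psi>"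
    using C_csat_bounded[of v r k \<chi> S] v k by metis
  obtain f where f0: "f 0 = U'" and fup: "\<And>j. j \<le> N \<Longrightarrow> upset (f j)"
    and fstep: "\<And>j. j < N \<Longrightarrow> f j \<subseteq> f (Suc j)"
    and fN: "f N \<subseteq> U" "f N \<noteq> U"
    and fw: "\<And>j. j < N \<Longrightarrow> \<exists>w\<in>f (Suc j) - f j.
        if r then \<forall>u\<in>f (Suc j) - f j. acc u w else f (Suc j) - f j = {w} \<and> \<not> acc w w"
    using lay[unfolded layers_def, rule_format, of N] by auto
  have mono: "f i \<subseteq> f j" if "i \<le> j" "j \<le> N" for i j
    using that
  proof (induction j rule: dec_induct)
    case (step n)
    then show ?case using fstep[of n] by auto
  qed simp
  define K where "K j = f (Suc j) - f j" for j
  have Kne: "\<exists>w. w \<in> K j" if "j < N" for j using fw[OF that] by (auto simp: K_def)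
  have KJ: "K j \<subseteq> U - U'" if "j < N" for j
    using mono[of 0 j] mono[of "Suc j" N] that f0 fN by (auto simp: K_def)
  have Kex: "\<exists>j<N. u \<in> K j" if u: "u \<in> f N" "u \<notin> U'" for u
  proof -
    have "u \<in> f i \<Longrightarrow> i \<le> N \<Longrightarrow> \<exists>j<N. u \<in> K j" for i
      by (induction i) (use u f0 in \<open>auto simp: K_def Suc_le_eq\<close>)
    then show ?thesis using u by blast
  qed
  have Kord: "acc u u'" "\<not> acc u' u" if "i < j" "j < N" "u \<in> K j" "u' \<in> K i" for i j u u'
  proof -
    have a: "u' \<in> f j" "u \<notin> f j" "u \<in> W" "upset (f j)"
      using mono[of "Suc i" j] fup[of j] fup[of "Suc j"] upset_sub that by (auto simp: K_def)
    then show "acc u u'" "\<not> acc u' u" using upset_lt upset_acc by blast+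
  qed
  have Kuniq: "i = j" if "i < N" "j < N" "u \<in> K i" "u \<in> K j" for i j u
    using Kord[of i j u u] Kord[of j i u u] that by (meson linorder_neqE_nat)
  \<comment> \<open>Whatever precedes the \<open>N\<close> layers goes to \<open>A 0\<close>. Such
    points see all layers, and by the choice of \<open>N\<close> every satisfied subformula is
    satisfied in one of them.\<close>
  define g where "g u = (if \<exists>j<N. u \<in> K j then B (THE j. j < N \<and> u \<in> K j) else A 0)" for u
  have gK: "g u = B j" if "j < N" "u \<in> K j" for u j
  proof -
    have "(THE j. j < N \<and> u \<in> K j) = j" using that Kuniq by (intro the_equality) auto
    then show ?thesis using that by (auto simp: g_def)
  qed
  have gA: "g u = A 0" if "\<And>j. j < N \<Longrightarrow> u \<notin> K j" for u using that by (auto simp: g_def)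
  have gw: "g u \<in> worlds (C_frame r k)" for u using k by (auto simp: g_def worlds_C)
  have out: "u \<notin> f N" if "u \<in> U - U'" "\<And>j. j < N \<Longrightarrow> u \<notin> K j" for u using that Kex by blast
  have "pullback (C_frame r k) (U - U') \<chi> S v g" unfolding pullback_def
  proof (intro conjI allI ballI impI)
    fix p
    let ?X = "if A 0 \<in> v p then U - f N else {}"
    have KN: "u \<in> f N" if "j < N" "u \<in> K j" for j u using mono[of "Suc j" N] that by (auto simp: K_def)
    have e: "{u \<in> U - U'. g u \<in> v p} = (\<Union>j\<in>{j. j < N \<and> B j \<in> v p}. K j) \<union> ?X"
    proof (intro set_eqI)
      fix u
      show "u \<in> {u \<in> U - U'. g u \<in> v p} \<longleftrightarrow> u \<in> (\<Union>j\<in>{j. j < N \<and> B j \<in> v p}. K j) \<union> ?X"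
      proof (cases "\<exists>j<N. u \<in> K j")
        case True
        then obtain j where j: "j < N" "u \<in> K j" by blast
        have "u \<in> (\<Union>j\<in>{j. j < N \<and> B j \<in> v p}. K j) \<longleftrightarrow> B j \<in> v p"
          using Kuniq[OF _ j(1) _ j(2)] j by blast
        moreover have "u \<notin> ?X" using KN[OF j] by simp
        moreover have "u \<in> U - U'" using KJ[OF j(1)] j(2) by blast
        ultimately show ?thesis using gK[OF j] by simp
      next
        case False
        then have "g u = A 0" by (intro gA) auto
        moreover have "u \<in> U - f N \<longleftrightarrow> u \<in> U - U'" using out[of u] False mono[of 0 N] f0 by auto
        ultimately show ?thesis using False by auto
      qed
    qed
    have fd: "dfn (f j)" if "j \<le> N" for j using fup[OF that] by (rule upset_dfn)
    have "dfn (\<Union>j\<in>{j. j < N \<and> B j \<in> v p}. K j)"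
      unfolding K_def by (intro dfn_UN dfn_Diff fd) auto
    moreover have "dfn ?X" using dfn_Diff[OF upset_dfn[OF up(1)] fd[of N]] by simp
    ultimately show "dfn {u \<in> U - U'. g u \<in> v p}" unfolding e by (rule dfn_Un)
  next
    fix u u' assume u: "u \<in> U - U'" "u' \<in> U - U'" "acc u u'"
    show "(g u, g u') \<in> rel (C_frame r k)"
    proof (cases "\<exists>j<N. u \<in> K j")
      case True
      then obtain j where j: "j < N" "u \<in> K j" by blast
      have "u \<in> f (Suc j)" using j by (simp add: K_def)
      then have "u' \<in> f (Suc j)" using upset_acc[OF fup[of "Suc j"]] u up(1) upset_sub j by auto
      then have "u' \<in> f N" using mono[of "Suc j" N] j by auto
      then obtain i where i: "i < N" "u' \<in> K i" using Kex u by blast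
      have "i \<le> j" using Kord(2)[of j i u' u] i j u by (meson not_le)
      moreover have "r" if "i = j"
      proof (rule ccontr)
        assume "\<not> r"
        then obtain w where "K j = {w}" "\<not> acc w w" using fw[OF j(1)] by (auto simp: K_def)
        then show False using i j u that by auto
      qed
      ultimately show ?thesis using gK[OF j] gK[OF i] by (auto simp: rel_C le_less)
    next
      case False
      then have "g u = A 0" by (intro gA) auto
      then show ?thesis using gw[of u'] k by (auto simp: rel_C)
    qed
  next
    fix \<psi> z assume p: "\<psi> \<in> subforms \<chi>" and z: "z \<in> worlds (C_frame r k)" "?c z \<psi>"
    obtain m where m: "m < N" "?c (B m) \<psi>" using N[OF p z] by blast
    obtain w where w: "w \<in> K m" using Kne[OF m(1)] by blast
    have wc: "?c (g w) \<psi>" "w \<in> U - U'" using gK[OF m(1) w] m KJ[OF m(1)] w by auto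
    then show "\<exists>u\<in>U - U'. ?c (g u) \<psi>" by blast
    fix u assume u: "u \<in> U - U'" "(g u, z) \<in> rel (C_frame r k)"
    show "\<exists>u'\<in>U - U'. acc u u' \<and> ?c (g u') \<psi>"
    proof (cases "\<exists>j<N. u \<in> K j")
      case True
      then obtain j where j: "j < N" "u \<in> K j" by blast
      then obtain i where i: "z = B i" "i < j \<or> r \<and> i = j" using u(2) gK[OF j] by (auto simp: rel_C)
      show ?thesis
      proof (cases "i < j")
        case True
        obtain u' where u': "u' \<in> K i" using Kne[of i] True j by auto
        have "acc u u'" using Kord(1)[OF True j(1) j(2) u'] .
        moreover have "g u' = z" using gK[OF _ u'] True j i by simp
        moreover have "u' \<in> U - U'" using KJ[of i] True j u' by auto
        ultimately show ?thesis using z by blast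
      next
        case False
        then have "r" "i = j" using i by auto
        then obtain u' where u': "u' \<in> K j" "acc u u'" using fw[OF j(1)] j by (auto simp: K_def)
        moreover have "g u' = z" using gK[OF j(1) u'(1)] i \<open>i = j\<close> by simp
        moreover have "u' \<in> U - U'" using KJ[OF j(1)] u' by auto
        ultimately show ?thesis using z by blast
      qed
    next
      case False
      then have "u \<notin> f N" using out u by blast
      moreover have "w \<in> f N" using mono[of "Suc m" N] m w by (auto simp: K_def)
      ultimately have "acc u w" using upset_lt[OF fup[of N]] u up(1) upset_sub by auto
      then show ?thesis using wc by blast
    qed
  qed (use gw in simp)
  then show "\<exists>g. pullback (C_frame r k) (U - U') \<chi> S v g" by blast
qed

text \<open>As no relevant point lies in the interval, \<open>h\<close> needs no back condition and
  may send all worlds, including every \<open>B n\<close>, into one reflexive cluster. The layers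
  serve validity alone.\<close>

lemma block_C:
  assumes up: "upset U" "upset U'" "U' \<subseteq> U" and k: "0 < k" "k \<le> 2 ^ card \<tau>"
    and sub: "e ` {..<k} \<subseteq> U - U'" and refl: "\<And>i j. i < k \<Longrightarrow> j < k \<Longrightarrow> acc (e i) (e j)"
    and Rl: "Rl \<inter> (U - U') = {}" and root: "x \<in> U - U' \<Longrightarrow> x \<in> e ` {..<k}"
    and lay: "layers r U U'"
  shows "block Rl (copy_model (C_frame r k) k e) U U' (e ` {..<k})"
proof -
  let ?M = "copy_model (C_frame r k) k e"
  have range: "\<exists>i<k. copy k e z = e i" if "z \<in> worlds (C_frame r k)" for z
  proof (cases z)
    case (B n)
    then show ?thesis using k by (intro exI[of _ "n mod k"]) simp
  qed (use that in \<open>auto simp: worlds_C\<close>)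
  have w: "y \<in> worlds (C_frame r k)" "z \<in> worlds (C_frame r k)" if "(y, z) \<in> rel (C_frame r k)" for y z
    using that by (auto simp: rel_C worlds_C)
  have "tmap Rl ?M (copy k e) (U - U')" unfolding tmap_def
  proof (intro conjI impI ballI allI)
    assume "x \<in> U - U'"
    then obtain i where i: "i < k" "x = e i" using root by auto
    then have "Defs.root (C_frame r k) (A i)" unfolding root_def by (auto simp: worlds_C rel_C)
    then show "\<exists>z. Defs.root (frame_of ?M) z \<and> copy k e z = x" using i by auto
  next
    fix z assume "z \<in> worlds (frame_of ?M)"
    then show "copy k e z \<in> U - U'" using range[of z] sub by auto
  next
    fix y z assume "(y, z) \<in> rel (frame_of ?M)"
    then show "acc (copy k e y) (copy k e z)" using w[of y z] range[of y] range[of z] refl by auto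
  qed (use Rl in auto)
  moreover have "\<forall>z\<in>worlds (frame_of ?M). copy k e z \<in> e ` {..<k}"
    using range by fastforce
  ultimately show ?thesis unfolding block_def
    using up simple_atomic_delta[OF simple_atomic_C[OF k]] vmap_C[OF up k(1) lay] by auto
qed

end

section \<open>Chains of immediate predecessors and fibres of the restriction\<close>

context K43_root
begin

definition above :: "form set \<Rightarrow> form set set" where
  "above w = {u \<in> W. \<not> le u w}"

lemma upset_above: "w \<in> W \<Longrightarrow> risol w \<Longrightarrow> upset (above w)"
  unfolding upset_def
proof (intro conjI ballI impI)
  assume w: "w \<in> W" and r: "risol w"
  show "dfn (above w)"
    using dfn_compl[OF r[unfolded risol_def]] dfn_cong[of "above w" "- {u. le u w}"]
    by (simp add: above_def)
  fix u v assume "u \<in> above w" "v \<in> W" "le u v"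
  then show "v \<in> above w" using le_trans[of u v w] w by (auto simp: above_def)
qed (auto simp: above_def)

lemma upset_above_irr: "w \<in> W \<Longrightarrow> \<not> acc w w \<Longrightarrow> upset (above w)"
  using upset_above irr_risol by blast

lemma above_sub: "upset U \<Longrightarrow> w \<in> U \<Longrightarrow> above w \<subseteq> U"
proof
  fix u assume U: "upset U" and w: "w \<in> U" and u: "u \<in> above w"
  have "le w u" using u le_total[of u w] upset_sub[OF U w] by (auto simp: above_def)
  then show "u \<in> U" using upset_le[OF U w] u by (simp add: above_def)
qed

lemma ipred_unique:
  assumes "ipred p w" "u \<in> W" "le u w" "\<not> le u p" "\<not> acc w w" "w \<in> W"
  shows "u = w"
  using assms lt_irrefl2[of u w] unfolding ipred_def by blast

lemma chain_strict:
  assumes c: "\<And>j. j \<le> m \<Longrightarrow> c j \<in> W" "\<And>j. j < m \<Longrightarrow> ipred (c (Suc j)) (c j)" and ij: "i < j" "j \<le> m"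
  shows "\<not> le (c i) (c j)"
  using ij
proof (induction j)
  case (Suc j)
  have s: "\<not> le (c j) (c (Suc j))" using c(2)[of j] Suc.prems by (auto simp: ipred_def)
  show ?case
  proof (cases "i = j")
    case False
    then have n: "\<not> le (c i) (c j)" using Suc by simp
    have "le (c (Suc j)) (c j)" using s le_total[of "c j" "c (Suc j)"] c(1) Suc.prems by auto
    then show ?thesis using n le_trans[of "c i" "c (Suc j)" "c j"] c(1) Suc.prems by auto
  qed (use s in simp)
qed simp

lemma chain_acc:
  assumes c: "\<And>j. j \<le> m \<Longrightarrow> c j \<in> W" "\<And>j. j < m \<Longrightarrow> ipred (c (Suc j)) (c j)"
    and irr: "\<And>j. j \<le> m \<Longrightarrow> \<not> acc (c j) (c j)" and ij: "i \<le> m" "j \<le> m"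
  shows "acc (c i) (c j) \<longleftrightarrow> j < i"
proof
  assume a: "acc (c i) (c j)"
  show "j < i"
  proof (rule ccontr)
    assume "\<not> j < i"
    then have "i = j \<or> i < j" by auto
    then show False using chain_strict[of m c i j] c irr ij a acc_le by blast
  qed
next
  assume "j < i"
  then show "acc (c i) (c j)" using chain_strict[of m c j i] c ij lt_acc by blast
qed

lemma chain_cover:
  assumes c: "\<And>j. j \<le> m \<Longrightarrow> c j \<in> W" "\<And>j. j < m \<Longrightarrow> ipred (c (Suc j)) (c j)"
    and irr: "\<And>j. j \<le> m \<Longrightarrow> \<not> acc (c j) (c j)"
    and u: "u \<in> W" "le u (c 0)" "le (c m) u"
  shows "\<exists>j\<le>m. u = c j"
proof (rule ccontr)
  assume n: "\<not> ?thesis"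
  have "le u (c j)" if "j \<le> m" for j
    using that
  proof (induction j)
    case (Suc j)
    then have "u \<noteq> c j" "le u (c j)" using n by auto
    then have "\<not> le (c j) u" using lt_irrefl2[of u "c j"] u c irr Suc.prems by simp
    then show ?case using c(2)[of j] Suc.prems u unfolding ipred_def by auto
  qed (use u in simp)
  then show False using lt_irrefl2[of u "c m"] u c irr n by auto
qed

text \<open>Walking back from an irreflexive point by immediate predecessors inside an up-closed set
  goes on forever, hits the bottom of the set, or stops at a reflexive point.\<close>

lemma pred_chain_cases:
  assumes V: "V \<subseteq> W" "\<And>u v. u \<in> V \<Longrightarrow> v \<in> W \<Longrightarrow> le u v \<Longrightarrow> v \<in> V" and w: "w \<in> V" "\<not> acc w w"
  obtains (inf) c where "c 0 = w" "\<And>j. c j \<in> V" "\<And>j. \<not> acc (c j) (c j)" "\<And>j. ipred (c (Suc j)) (c j)"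
  | (bot) c m where "c 0 = w" "\<And>j. j \<le> m \<Longrightarrow> c j \<in> V" "\<And>j. j \<le> m \<Longrightarrow> \<not> acc (c j) (c j)"
      "\<And>j. j < m \<Longrightarrow> ipred (c (Suc j)) (c j)" "\<And>u. u \<in> V \<Longrightarrow> le (c m) u"
  | (refl) c m p where "c 0 = w" "\<And>j. j \<le> m \<Longrightarrow> c j \<in> V" "\<And>j. j \<le> m \<Longrightarrow> \<not> acc (c j) (c j)"
      "\<And>j. j < m \<Longrightarrow> ipred (c (Suc j)) (c j)" "ipred p (c m)" "p \<in> V" "acc p p"
proof -
  define c where "c = rec_nat w (\<lambda>_ u. SOME p. ipred p u)"
  have c0: "c 0 = w" and cS: "c (Suc j) = (SOME p. ipred p (c j))" for j by (simp_all add: c_def)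
  define P where "P n \<longleftrightarrow> (\<forall>j\<le>n. c j \<in> V \<and> \<not> acc (c j) (c j)) \<and> (\<forall>j<n. ipred (c (Suc j)) (c j))" for n
  show thesis
  proof (cases "\<forall>n. P n")
    case True
    then show ?thesis using inf[of c] c0 unfolding P_def by blast
  next
    case False
    define n where "n = (LEAST n. \<not> P n)"
    have nP: "\<not> P n" unfolding n_def by (rule LeastI_ex) (use False in blast)
    have "P 0" using w c0 by (simp add: P_def)
    then obtain m where m: "n = Suc m" using nP by (cases n) auto
    have Pm: "P m" using not_less_Least[of m "\<lambda>n. \<not> P n"] m unfolding n_def by auto
    then have cm: "c m \<in> V" "\<not> acc (c m) (c m)" "c m \<in> W" using V by (auto simp: P_def)
    show ?thesis
    proof (cases "\<forall>u\<in>V. le (c m) u")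
      case True
      then show ?thesis using bot[of c m] c0 Pm unfolding P_def by blast
    next
      case False
      then obtain u where u: "u \<in> V" "\<not> le (c m) u" by blast
      obtain p where "ipred p (c m)" using irr_ipred[OF cm(3,2), of u] u V by blast
      then have ip: "ipred (c (Suc m)) (c m)" unfolding cS by (rule someI)
      then have "c (Suc m) \<in> V" using u V unfolding ipred_def by blast
      \<comment> \<open>All other requirements hold at the least index where the chain breaks, so it
        breaks because the new point is reflexive.\<close>
      moreover have "acc (c (Suc m)) (c (Suc m))"
        using nP Pm ip calculation unfolding P_def m by (auto simp: le_Suc_eq less_Suc_eq)
      ultimately show ?thesis using refl[of c m "c (Suc m)"] c0 Pm ip unfolding P_def by blast
    qed
  qed
qed

text \<open>The limit is any maximal consistent extension of the formulas eventually true along the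
  chain. A point seeing the whole chain sees the limit, because each formula boxed at it holds all
  along the chain; applied to the limit itself this gives reflexivity. Definability of
  \<open>V\<close> keeps the limit inside \<open>V\<close>.\<close>

lemma pred_chain_limit:
  assumes V: "upset V" and c: "\<And>j. c j \<in> V" "\<And>j. ipred (c (Suc j)) (c j)"
  obtains a where "a \<in> V" "acc a a" "\<And>j. acc a (c j)" "\<And>j. \<not> le (c j) a"
    "\<And>u. u \<in> W \<Longrightarrow> (\<And>j. \<not> le (c j) u) \<Longrightarrow> le u a"
proof -
  let ?\<Gamma> = "{\<phi>. \<exists>n. \<forall>j\<ge>n. \<phi> \<in> c j}"
  have cW: "c j \<in> W" for j using c V upset_sub by blast
  have strict: "\<not> le (c i) (c j)" if "i < j" for i j
    using chain_strict[of j c i j] cW c that by simp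
  have down: "acc (c j) (c i)" if "i < j" for i j using strict[OF that] lt_acc cW by blast
  obtain \<kappa> where k: "\<kappa> \<in> Fm \<tau>" "\<And>u. u \<in> W \<Longrightarrow> u \<in> V \<longleftrightarrow> \<kappa> \<in> u"
    using upset_dfn[OF V] unfolding dfn_def by blast
  have fin: "\<exists>n. \<forall>j\<ge>n. set \<phi>s \<subseteq> c j" if "set \<phi>s \<subseteq> ?\<Gamma>" for \<phi>s
    using that
  proof (induction \<phi>s)
    case (Cons \<phi> \<phi>s)
    then obtain a b where "\<forall>j\<ge>a. \<phi> \<in> c j" "\<forall>j\<ge>b. set \<phi>s \<subseteq> c j" by auto
    then show ?case by (intro exI[of _ "max a b"]) auto
  qed simp
  have "con ?\<Gamma>" unfolding con_def
  proof (intro allI impI)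
    fix \<phi>s assume "set \<phi>s \<subseteq> ?\<Gamma>"
    then obtain n where "set \<phi>s \<subseteq> c n" using fin by blast
    then show "Neg (Conj \<phi>s) \<notin> L" using W_mcs[OF cW[of n]] by (simp add: mcs_def con_def)
  qed
  moreover have "?\<Gamma> \<subseteq> Fm \<tau>" using W_Fm[OF cW] by blast
  ultimately obtain a where a: "mcs \<tau> a" "?\<Gamma> \<subseteq> a" using mcs_extend by blast
  have all: "\<chi> \<in> a" if "\<And>j. \<chi> \<in> c j" for \<chi> using a that by blast
  have below: "acc u a" if u: "u \<in> W" "\<And>j. acc u (c j)" for u
    unfolding acc_def using u all by (auto simp: acc_def)
  have xa: "acc x (c j)" for j
    using le_acc_trans[OF root_W cW[of "Suc j"] cW[of j]] root_le[OF cW] down by blast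
  have aW: "a \<in> W" using below[OF root_W xa] a by (simp add: W_def le_def)
  have ac: "acc a (c j)" for j
  proof -
    have "Dia \<psi> \<in> a" if "\<psi> \<in> c j" for \<psi>
    proof -
      \<comment> \<open>The diamond of anything true at \<open>c j\<close> holds from
        \<open>c (Suc j)\<close> on, hence at the limit.\<close>
      have "\<forall>i\<ge>Suc j. Dia \<psi> \<in> c i" using down that W_Dia cW by (meson Suc_le_lessD)
      then show ?thesis using a by blast
    qed
    then show ?thesis using acc_iff_Dia a W_mcs cW by blast
  qed
  have lt: "\<not> le (c j) a" for j
  proof
    assume "le (c j) a"
    then have "le (c j) (c (Suc j))" using acc_le[OF ac] le_trans[OF cW aW cW] by blast
    then show False using strict[of j "Suc j"] by simp
  qed
  show thesis
  proof (rule that[of a])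
    show "a \<in> V" using k aW all c cW by blast
    show "acc a a" using below[OF aW ac] .
    show "le u a" if "u \<in> W" "\<And>j. \<not> le (c j) u" for u
      using below[of u] that lt_acc cW acc_le by blast
  qed (use ac lt in auto)
qed

lemma finite_greatest:
  assumes "finite S" "S \<noteq> {}" "S \<subseteq> W"
  obtains m where "m \<in> S" "\<forall>v\<in>S. le v m"
proof -
  have "\<exists>m\<in>S. \<forall>v\<in>S. le v m"
    using assms
  proof (induction S rule: finite_ne_induct)
    case (insert a S)
    then obtain m where m: "m \<in> S" "\<forall>v\<in>S. le v m" by auto
    have "le v a" if "le m a" "v \<in> S" for v
      using m that insert.prems le_trans[of v m a] by auto
    then show ?case using m le_total[of a m] insert.prems by auto
  qed simp
  then show thesis using that by blast
qed

definition blocks :: "form set set \<Rightarrow> point model list \<Rightarrow> form set set \<Rightarrow> form set set \<Rightarrow> form set set \<Rightarrow> bool" where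
  "blocks Rl Ms U V H \<longleftrightarrow> (\<exists>f. f 0 = U \<and> f (length Ms) = V \<and>
     (\<forall>i<length Ms. block Rl (Ms ! i) (f i) (f (Suc i)) H \<and> simple_atomic \<tau> (Ms ! i)))"

lemma blocks_Nil: "blocks Rl [] U U H"
  unfolding blocks_def by (intro exI[of _ "\<lambda>_. U"]) simp

lemma blocks_single:
  "block Rl M U V H \<Longrightarrow> simple_atomic \<tau> M \<Longrightarrow> H \<subseteq> H' \<Longrightarrow> blocks Rl [M] U V H'"
  unfolding blocks_def using block_mono by (intro exI[of _ "\<lambda>i. if i = 0 then U else V"]) simp

lemma blocks_append:
  assumes "blocks Rl Ms U V H" "blocks Rl Ns V Z H"
  shows "blocks Rl (Ms @ Ns) U Z H"
proof -
  obtain f where f: "f 0 = U" "f (length Ms) = V"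
    "\<And>i. i < length Ms \<Longrightarrow> block Rl (Ms ! i) (f i) (f (Suc i)) H \<and> simple_atomic \<tau> (Ms ! i)"
    using assms(1) unfolding blocks_def by blast
  obtain g where g: "g 0 = V" "g (length Ns) = Z"
    "\<And>i. i < length Ns \<Longrightarrow> block Rl (Ns ! i) (g i) (g (Suc i)) H \<and> simple_atomic \<tau> (Ns ! i)"
    using assms(2) unfolding blocks_def by blast
  let ?h = "\<lambda>i. if i \<le> length Ms then f i else g (i - length Ms)"
  show ?thesis unfolding blocks_def
  proof (intro exI[of _ ?h] conjI allI impI)
    fix i assume i: "i < length (Ms @ Ns)"
    show "block Rl ((Ms @ Ns) ! i) (?h i) (?h (Suc i)) H"
    proof (cases "i < length Ms")
      case False
      then have "?h i = g (i - length Ms)" "?h (Suc i) = g (Suc (i - length Ms))"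
        using f g by (auto simp: Suc_diff_le)
      then show ?thesis using g(3)[of "i - length Ms"] False i by (simp add: nth_append)
    qed (use f in \<open>simp add: nth_append\<close>)
    show "simple_atomic \<tau> ((Ms @ Ns) ! i)"
      using f(3)[of i] g(3)[of "i - length Ms"] i by (cases "i < length Ms") (simp_all add: nth_append)
  qed (use f g in auto)
qed

lemma blocks_simple: "blocks Rl Ms U V H \<Longrightarrow> M \<in> set Ms \<Longrightarrow> simple_atomic \<tau> M"
  unfolding blocks_def by (auto simp: in_set_conv_nth)

lemma blocks_block: "blocks Rl Ms U V H \<Longrightarrow> Ms \<noteq> [] \<Longrightarrow> block Rl (osum_model Ms) U V H"
  unfolding blocks_def using block_osum by blast

lemma blocks_types:
  assumes "blocks Rl Ms U V H" "M \<in> set Ms" "z \<in> worlds (frame_of M)"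
  shows "\<exists>u\<in>H. \<forall>p\<in>\<tau>. z \<in> val M p \<longleftrightarrow> Var p \<in> u"
proof -
  obtain i where i: "i < length Ms" "Ms ! i = M" using assms(2) by (auto simp: in_set_conv_nth)
  obtain f where "\<forall>i<length Ms. block Rl (Ms ! i) (f i) (f (Suc i)) H \<and> simple_atomic \<tau> (Ms ! i)"
    using assms(1) unfolding blocks_def by (elim exE conjE)
  then have "block Rl M (f i) (f (Suc i)) H" using i by auto
  then show ?thesis using assms(3) by (rule block_types)
qed

end

text \<open>One side of the construction: \<open>M\<close> over the large signature,
  \<open>Q\<close> over the shared one and common to both sides, and the finite set
  \<open>Rl\<close> of relevant points. The last assumption ensures that the root is always among
  the copied points.\<close>

locale K43_proj = K43_logic L + M: K43_root L \<delta> x + Q: K43_root L \<sigma> t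
  for L \<delta> x \<sigma> t +
  fixes Rl :: "form set set"
  assumes sig_sub: "\<sigma> \<subseteq> \<delta>" and root_proj: "x \<inter> Fm \<sigma> = t"
    and Rl_sub: "Rl \<subseteq> M.W" and Rl_finite: "finite Rl" and Rl_risol: "\<And>w. w \<in> Rl \<Longrightarrow> M.risol w"
    and root_rel: "x \<in> Rl \<or> (\<forall>u\<in>M.W. u \<inter> Fm \<sigma> = t \<longrightarrow> le u x)"
begin

definition pr :: "form set \<Rightarrow> form set" where
  "pr u = u \<inter> Fm \<sigma>"

lemma pr_mem: "\<phi> \<in> pr u \<longleftrightarrow> \<phi> \<in> u \<and> \<phi> \<in> Fm \<sigma>"
  by (simp add: pr_def)

lemma pr_root: "pr x = t"
  using root_proj by (simp add: pr_def)

lemma Fm_sub: "\<phi> \<in> Fm \<sigma> \<Longrightarrow> \<phi> \<in> Fm \<delta>"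
  using Fm_mono[OF sig_sub] by blast

lemma pr_mcs: "mcs \<delta> u \<Longrightarrow> mcs \<sigma> (pr u)"
  unfolding mcs_def using con_subset[of u "pr u"] Fm_sub by (auto simp: pr_def)

lemma pr_acc: "acc u v \<Longrightarrow> acc (pr u) (pr v)"
  by (auto simp: acc_def pr_def)

lemma pr_le: "le u v \<Longrightarrow> le (pr u) (pr v)"
  using pr_acc by (auto simp: le_def)

lemma pr_W: "u \<in> M.W \<Longrightarrow> pr u \<in> Q.W"
  using pr_mcs pr_le[of x u] pr_root by (auto simp: M.W_def Q.W_def)

lemma pr_eqI: "mcs \<delta> u \<Longrightarrow> q \<in> Q.W \<Longrightarrow> q \<subseteq> u \<Longrightarrow> pr u = q"
proof -
  assume u: "mcs \<delta> u" and q: "q \<in> Q.W" "q \<subseteq> u"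
  have "q \<subseteq> pr u" using q Q.W_Fm by (auto simp: pr_def)
  then show ?thesis using mcs_eqI[OF Q.W_mcs[OF q(1)] pr_mcs[OF u]] by simp
qed

lemma pr_lift:
  assumes u: "u \<in> M.W" and q: "q \<in> Q.W" and a: "acc (pr u) q"
  obtains v where "v \<in> M.W" "acc u v" "pr v = q"
proof -
  have "\<exists>v. mcs \<delta> v \<and> acc u v \<and> q \<subseteq> v"
  proof (rule acc_extend[OF M.W_mcs[OF u], of q])
    show "q \<subseteq> Fm \<delta>" using Q.W_Fm[OF q] Fm_sub by blast
    fix \<phi>s assume "set \<phi>s \<subseteq> q"
    then have "Conj \<phi>s \<in> q" using mcs_Conj Q.W_mcs q by blast
    then have "Dia (Conj \<phi>s) \<in> pr u" using acc_Dia Q.W_mcs pr_W u q a by blast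
    then show "Dia (Conj \<phi>s) \<in> u" by (simp add: pr_def)
  qed blast
  then show thesis using that M.W_succ[OF u] pr_eqI[OF _ q] by blast
qed

lemma pr_surj:
  assumes "q \<in> Q.W" obtains u where "u \<in> M.W" "pr u = q"
proof (cases "q = t")
  case True
  then show thesis using that[of x] pr_root by simp
next
  case False
  then have "acc (pr x) q" using Q.root_le[OF assms] pr_root by (simp add: le_def)
  then show thesis using pr_lift[of x q] assms that by auto
qed

text \<open>Distinct points of a fibre are comparable, and their projection would then see
  itself.\<close>

lemma irr_fibre:
  assumes "u \<in> M.W" "v \<in> M.W" "pr u = q" "pr v = q" "\<not> acc q q"
  shows "u = v"
  using M.le_total[of u v] assms pr_acc[of u v] pr_acc[of v u] unfolding le_def by auto

definition UP :: "form set \<Rightarrow> form set set" where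
  "UP q = {u \<in> M.W. \<not> le (pr u) q}"

lemma upset_UP:
  assumes q: "q \<in> Q.W" "Q.risol q" shows "M.upset (UP q)"
  unfolding M.upset_def
proof (intro conjI ballI impI)
  obtain \<kappa> where k: "\<kappa> \<in> Fm \<sigma>" "\<And>u. u \<in> Q.W \<Longrightarrow> le u q \<longleftrightarrow> \<kappa> \<in> u"
    using q(2) unfolding Q.risol_def Q.dfn_def by auto
  show "M.dfn (UP q)"
  proof (rule M.dfnI[of "Neg \<kappa>"])
    show "u \<in> UP q \<longleftrightarrow> Neg \<kappa> \<in> u" if "u \<in> M.W" for u
      using that k pr_W[OF that] Fm_sub[OF k(1)] by (simp add: UP_def pr_mem)
  qed (use k Fm_sub in simp)
  fix u v assume "u \<in> UP q" "v \<in> M.W" "le u v"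
  then show "v \<in> UP q" using pr_le[of u v] Q.le_trans[of "pr u" "pr v" q] pr_W q by (auto simp: UP_def)
qed (auto simp: UP_def)

definition ls :: "form set \<Rightarrow> form set" where
  "ls q = (SOME m. m \<in> M.W \<and> pr m = q \<and> (\<forall>v\<in>M.W. pr v = q \<longrightarrow> le v m))"

text \<open>A point lies over \<open>q\<close> exactly when it contains \<open>q\<close> as a set,
  so \<open>greatest_exists\<close> applies with \<open>q\<close> in place of \<Gamma>.\<close>

lemma ls:
  assumes q: "q \<in> Q.W"
  shows "ls q \<in> M.W" "pr (ls q) = q" "\<And>v. v \<in> M.W \<Longrightarrow> pr v = q \<Longrightarrow> le v (ls q)"
proof -
  obtain u where u: "u \<in> M.W" "pr u = q" using pr_surj q by blast
  then have "q \<subseteq> u" by (auto simp: pr_def)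
  then obtain m where m: "m \<in> M.W" "q \<subseteq> m" "\<And>v. v \<in> M.W \<Longrightarrow> q \<subseteq> v \<Longrightarrow> le v m"
    using M.greatest_exists[OF u(1)] by blast
  have "pr m = q" using pr_eqI m q M.W_mcs by blast
  moreover have "le v m" if "v \<in> M.W" "pr v = q" for v using m(3)[of v] that by (auto simp: pr_def)
  ultimately have "\<exists>m. m \<in> M.W \<and> pr m = q \<and> (\<forall>v\<in>M.W. pr v = q \<longrightarrow> le v m)" using m(1) by blast
  from someI_ex[OF this] show "ls q \<in> M.W" "pr (ls q) = q" "\<And>v. v \<in> M.W \<Longrightarrow> pr v = q \<Longrightarrow> le v (ls q)"
    unfolding ls_def by blast+
qed

text \<open>Reflexivity of \<open>q\<close> lets every point over or before it be lifted to a
  successor over \<open>q\<close>, which is at most as late as \<open>ls q\<close>. Consequently the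
  preimage of a cut after \<open>q\<close> is a cut after \<open>ls q\<close>.\<close>

lemma ls_reach:
  assumes q: "q \<in> Q.W" "acc q q" and u: "u \<in> M.W" "le (pr u) q"
  shows "acc u (ls q)"
proof -
  have "acc (pr u) q" using u q by (auto simp: le_def)
  then obtain v where v: "v \<in> M.W" "acc u v" "pr v = q" using pr_lift u q by blast
  then show ?thesis using M.acc_le_trans[OF u(1) v(1)] ls[OF q(1)] by blast
qed

lemma ls_le_iff:
  assumes q: "q \<in> Q.W" "acc q q" and u: "u \<in> M.W"
  shows "le u (ls q) \<longleftrightarrow> le (pr u) q"
  using ls_reach[OF q u] pr_le[of u "ls q"] ls(2)[OF q(1)] acc_le by auto

lemma irr_acc_ls:
  assumes "p \<in> Q.W" "q \<in> Q.W" "\<not> acc q q"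
  shows "acc (ls p) (ls q) \<longleftrightarrow> acc p q"
proof
  assume "acc (ls p) (ls q)"
  then show "acc p q" using pr_acc[of "ls p" "ls q"] ls assms by simp
next
  assume "acc p q"
  then have "acc (pr (ls p)) q" using ls(2) assms(1) by simp
  then obtain v where v: "v \<in> M.W" "acc (ls p) v" "pr v = q" using pr_lift[OF ls(1)] assms by blast
  have "v = ls q" using irr_fibre[OF v(1) ls(1)[OF assms(2)] v(3) ls(2)[OF assms(2)] assms(3)] .
  then show "acc (ls p) (ls q)" using v by simp
qed

text \<open>Used contrapositively: if later points accumulate at \<open>d\<close>, the last cluster
  over \<open>d\<close> contains no right-isolated and hence no relevant point. Otherwise points
  over \<open>d\<close> itself could be found after \<open>ls d\<close>.\<close>

lemma risol_proj:
  assumes d: "d \<in> Q.W" "acc d d" and v: "v \<in> M.W" "le v (ls d)" "le (ls d) v" "M.risol v"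
  shows "Q.risol d"
proof (rule ccontr)
  assume nr: "\<not> Q.risol d"
  obtain \<beta> where b: "\<beta> \<in> Fm \<delta>" "\<And>u. u \<in> M.W \<Longrightarrow> le u v \<longleftrightarrow> \<beta> \<in> u"
    using v(4) unfolding M.risol_def M.dfn_def by auto
  let ?e = "ls d"
  have e: "?e \<in> M.W" "pr ?e = d" using ls d by auto
  have "\<exists>u. mcs \<delta> u \<and> acc ?e u \<and> insert (Neg \<beta>) d \<subseteq> u"
  proof (rule acc_extend[OF M.W_mcs[OF e(1)], of "insert (Neg \<beta>) d"])
    show "insert (Neg \<beta>) d \<subseteq> Fm \<delta>" using Q.W_Fm[OF d(1)] Fm_sub b by auto
    fix \<phi>s assume s: "set \<phi>s \<subseteq> insert (Neg \<beta>) d"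
    define \<psi>s where "\<psi>s = filter (\<lambda>\<phi>. \<phi> \<in> d) \<phi>s"
    have "Conj \<psi>s \<in> d" using mcs_Conj[OF Q.W_mcs[OF d(1)], of \<psi>s] by (auto simp: \<psi>s_def)
    \<comment> \<open>The last point satisfying a finite part of \<open>d\<close> is right-isolated
      while \<open>d\<close> is not, so it lies strictly after \<open>d\<close>. Lifting it gives a
      successor of \<open>ls d\<close> outside the definable set up to \<open>v\<close>.\<close>
    then obtain m where m: "m \<in> Q.W" "Conj \<psi>s \<in> m" "le d m" "Q.risol m"
      using Q.greatest_formula[OF d(1)] d(1) by metis
    have md: "\<not> le m d" using nr m Q.risol_cong[of m d] d by blast
    then have "acc (pr ?e) m" using Q.lt_acc[OF d(1) m(1)] e by simp
    then obtain u where u: "u \<in> M.W" "acc ?e u" "pr u = m" using pr_lift[OF e(1) m(1)] by blast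
    have "\<not> le u v" using md pr_le[of u ?e] M.le_trans[of u v ?e] u e v by auto
    then have n: "Neg \<beta> \<in> u" using b u by simp
    have "set \<psi>s \<subseteq> u" using m(2) mcs_Conj[OF Q.W_mcs[OF m(1)]] u(3) by (auto simp: pr_def)
    then have "set \<phi>s \<subseteq> u" using s n by (auto simp: \<psi>s_def)
    then have "Conj \<phi>s \<in> u" using mcs_Conj M.W_mcs u by blast
    then show "Dia (Conj \<phi>s) \<in> ?e" using M.W_Dia[OF e(1)] u by blast
  qed blast
  then obtain u where u: "mcs \<delta> u" "acc ?e u" "Neg \<beta> \<in> u" "d \<subseteq> u" by auto
  have uW: "u \<in> M.W" using M.W_succ e u by blast
  have "le u ?e" using ls(3)[OF d(1) uW] pr_eqI[OF u(1) d(1) u(4)] by blast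
  then have "le u v" using M.le_trans uW e v by blast
  then show False using b uW u by simp
qed

end

text \<open>\<open>U0\<close> starts right before the fibre of \<open>d\<close>, or at a definable cut before it when the cluster of
  \<open>d\<close> is a limit from the left and hence the fibre itself need not start definably.\<close>

locale K43_start = K43_proj +
  fixes d :: "form set" and U0 :: "form set set"
  assumes d: "d \<in> Q.W" "acc d d" and U0: "M.upset U0"
    and start: "(\<forall>u\<in>U0. le d (pr u)) \<or>
      (\<forall>q\<in>Q.W. \<not> le d q \<longrightarrow> (\<exists>q'\<in>Q.W. \<not> le q' q \<and> \<not> le d q'))"
    and start_Rl: "\<And>w. w \<in> Rl \<Longrightarrow> w \<in> U0 \<Longrightarrow> le d (pr w)"
    and start_root: "x \<in> U0 \<Longrightarrow> le d t"
    and last_in: "ls d \<in> U0"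
begin

definition D :: "form set set" where
  "D = {u \<in> M.W. le d (pr u) \<and> le (pr u) d}"

lemma D_W: "u \<in> D \<Longrightarrow> u \<in> M.W"
  by (simp add: D_def)

lemma U0_W: "u \<in> U0 \<Longrightarrow> u \<in> M.W"
  using U0 M.upset_sub by blast

lemma ls_D: "ls d \<in> D"
  using ls d by (simp add: D_def)

text \<open>By \<open>start\<close>, a gap of the fibre of \<open>d\<close> inside \<open>U0\<close> would have to contain further points.\<close>

lemma limit_in_D:
  assumes X: "X \<subseteq> D" "X \<noteq> {}" and a: "a \<in> U0" "\<And>w. w \<in> X \<Longrightarrow> \<not> le w a"
    and mx: "\<And>u. u \<in> M.W \<Longrightarrow> (\<And>w. w \<in> X \<Longrightarrow> \<not> le w u) \<Longrightarrow> le u a"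
  shows "a \<in> D"
proof -
  have aW: "a \<in> M.W" using a U0_W by blast
  obtain w where w: "w \<in> X" "w \<in> D" "w \<in> M.W" using X D_W by blast
  have "le a w" using M.lt_acc[OF aW w(3) a(2)[OF w(1)]] acc_le by blast
  then have "le (pr a) (pr w)" by (rule pr_le)
  then have ad: "le (pr a) d" using Q.le_trans[of "pr a" "pr w" d] pr_W aW w d by (auto simp: D_def)
  have "le d (pr a)"
  proof (rule ccontr)
    assume n: "\<not> le d (pr a)"
    \<comment> \<open>The first alternative of \<open>start\<close> fails at \<open>a\<close>, so
      the second gives \<open>q\<close> strictly between the projection of \<open>a\<close> and
      \<open>d\<close>. A point over \<open>q\<close> after \<open>a\<close> still precedes all of
      \<open>X\<close>, against the choice of \<open>a\<close>.\<close>
    then obtain q where q: "q \<in> Q.W" "\<not> le q (pr a)" "\<not> le d q" using start a pr_W[OF aW] by blast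
    have "acc (pr a) q" using Q.lt_acc pr_W aW q by blast
    then obtain v where v: "v \<in> M.W" "acc a v" "pr v = q" using pr_lift aW q by blast
    have "\<not> le w' v" if "w' \<in> X" for w'
    proof
      assume "le w' v"
      then have "le (pr w') q" using pr_le v by blast
      moreover have wD: "w' \<in> D" using X that by blast
      moreover have "le d (pr w')" using wD by (simp add: D_def)
      ultimately show False using q(1,3) Q.le_trans[of d "pr w'" q] d(1) pr_W[OF D_W[OF wD]] by blast
    qed
    then have "le v a" using mx v by blast
    then show False using pr_le[of v a] v q by simp
  qed
  then show ?thesis using ad aW by (simp add: D_def)
qed

lemma ipred_in_D:
  assumes w: "w \<in> D" and p: "p \<in> U0" "M.ipred p w" shows "p \<in> D"
  by (rule limit_in_D[of "{w}"]) (use w p in \<open>auto simp: M.ipred_def\<close>)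

text \<open>If the root lies in the part still to be represented, it lies in the cluster of
  \<open>w\<close> and will be copied. Either it is relevant itself, or it is last over
  \<open>t\<close>, and \<open>w\<close> has a point over \<open>t\<close> at or after it.\<close>

lemma root_last:
  assumes V: "M.upset V" "V \<subseteq> U0" "x \<in> V" and w: "w \<in> D" "w \<in> V"
    and first: "\<And>v. v \<in> Rl \<Longrightarrow> v \<in> V \<Longrightarrow> le v w \<Longrightarrow> le w v"
  shows "le w x"
proof (cases "x \<in> Rl")
  case True
  then show ?thesis using first V M.root_le D_W w by blast
next
  case False
  then have l: "\<And>u. u \<in> M.W \<Longrightarrow> pr u = t \<Longrightarrow> le u x" using root_rel by (auto simp: pr_def)
  have wW: "w \<in> M.W" using w D_W by blast
  have "le d t" using start_root V by blast
  then have "le (pr w) t" using w Q.le_trans[of "pr w" d t] pr_W[OF wW] d by (auto simp: D_def)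
  show ?thesis
  proof (cases "pr w = t")
    case False
    then have "acc (pr w) t" using \<open>le (pr w) t\<close> by (simp add: le_def)
    then obtain v where v: "v \<in> M.W" "acc w v" "pr v = t" using pr_lift[OF wW Q.root_W] by blast
    then show ?thesis using l M.acc_le_trans[OF wW v(1) M.root_W] acc_le by blast
  qed (use l wW in simp)
qed

lemma cluster_enum:
  assumes w: "w \<in> M.W"
  obtains k :: nat and c where "0 < k" "k \<le> 2 ^ card \<delta>" "inj_on c {..<k}" "c ` {..<k} = M.cluster w"
proof -
  let ?C = "M.cluster w"
  have fin: "finite ?C" using M.finite_cluster w .
  obtain c where c: "bij_betw c {0..<card ?C} ?C" using ex_bij_betw_nat_finite[OF fin] by blast
  have "w \<in> ?C" using w by (simp add: M.cluster_def)
  then have "0 < card ?C" using fin card_gt_0_iff by blast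
  then show thesis using that[of "card ?C" c] c M.card_cluster[OF w]
    by (auto simp: bij_betw_def atLeast0LessThan)
qed

text \<open>By \<open>first\<close> and \<open>root_last\<close>, relevant points up to
  \<open>w\<close> and the root, if it is among these points, lie in the cluster of
  \<open>w\<close>; everything before that cluster may be collapsed into it.\<close>

lemma block_cluster_D:
  assumes V: "M.upset V" "V \<subseteq> U0" and w: "w \<in> D" "w \<in> V" "acc w w" "M.risol w"
    and first: "\<And>v. v \<in> Rl \<Longrightarrow> v \<in> V \<Longrightarrow> le v w \<Longrightarrow> le w v"
  obtains k :: nat and c where "0 < k" "c ` {..<k} = M.cluster w"
    "M.blocks Rl [copy_model (refl_cluster k) k c] V (M.above w) D"
proof -
  have wW: "w \<in> M.W" using w D_W by blast
  obtain k :: nat and c where k: "0 < k" "k \<le> 2 ^ card \<delta>" and c: "inj_on c {..<k}" "c ` {..<k} = M.cluster w"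
    using cluster_enum[OF wW] .
  have CD: "M.cluster w \<subseteq> D"
  proof
    fix u assume "u \<in> M.cluster w"
    then have u: "u \<in> M.W" "le u w" "le w u" by (auto simp: M.cluster_def)
    then show "u \<in> D" using pr_le[OF u(2)] pr_le[OF u(3)] Q.le_trans pr_W wW d w
      unfolding D_def by blast
  qed
  have acl: "acc u v" if "u \<in> M.W" "le u w" "v \<in> M.cluster w" for u v
  proof -
    have v: "v \<in> M.W" "le w v" using that by (auto simp: M.cluster_def)
    have "acc u w" using that w wW M.le_acc_trans by blast
    then show ?thesis using M.acc_le_trans that wW v by blast
  qed
  have "M.block Rl (copy_model (refl_cluster k) k c) V (M.above w) (c ` {..<k})"
  proof (rule M.block_cluster[OF V(1) _ _ k c(1)])
    show "M.upset (M.above w)" using M.upset_above wW w by blast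
    show "M.above w \<subseteq> V" using M.above_sub V w by blast
    show "c ` {..<k} \<subseteq> V - M.above w"
      unfolding c(2) using V w M.upset_le by (auto simp: M.cluster_def M.above_def)
    show "acc u (c i)" if "u \<in> V - M.above w" "i < k" for u i
    proof (rule acl)
      show "u \<in> M.W" using that V M.upset_sub by blast
      then show "le u w" using that by (simp add: M.above_def)
      show "c i \<in> M.cluster w" using that c(2) by blast
    qed
    show "Rl \<inter> (V - M.above w) \<subseteq> c ` {..<k}"
      unfolding c(2) using first V M.upset_sub[OF V(1)] by (auto simp: M.above_def M.cluster_def)
    show "x \<in> c ` {..<k}" if "x \<in> V - M.above w"
      unfolding c(2) using root_last[OF V _ w(1,2) first] that M.root_le[OF wW]
      by (auto simp: M.cluster_def)
  qed
  then have "M.blocks Rl [copy_model (refl_cluster k) k c] V (M.above w) D"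
    by (rule M.blocks_single[OF _ simple_atomic_cluster[OF k]]) (simp add: c(2) CD)
  then show thesis using that k c by blast
qed

text \<open>An irreflexive relevant point cannot absorb what precedes it, so its chain of immediate
  predecessors is followed back. The three ways in which the chain can behave each lead to one or
  two atomic components, all copying points over the cluster of \<open>d\<close>.\<close>

lemma block_relevant:
  assumes V: "M.upset V" "V \<subseteq> U0" and w: "w \<in> Rl" "w \<in> D" "w \<in> V"
    and first: "\<And>v. v \<in> Rl \<Longrightarrow> v \<in> V \<Longrightarrow> le v w \<Longrightarrow> le w v"
  obtains Ms where "length Ms \<le> 2" "M.blocks Rl Ms V (M.above w) D"
proof (cases "acc w w")
  case True
  obtain k c where "M.blocks Rl [copy_model (refl_cluster k) k c] V (M.above w) D"
    using block_cluster_D[OF V w(2,3) True Rl_risol[OF w(1)] first] .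
  then show thesis using that[of "[copy_model (refl_cluster k) k c]"] by simp
next
  case False
  have wW: "w \<in> M.W" using w D_W by blast
  have VW: "V \<subseteq> M.W" using V M.upset_sub by blast
  have root: "x = w" if "x \<in> V"
    using root_last[OF V that w(2,3) first] M.root_le[OF wW] M.lt_irrefl2[OF M.root_W wW] False by blast
  have Rel: "v = w" if "v \<in> Rl" "v \<in> V" "le v w" for v
    using first[OF that] M.lt_irrefl2[of v w] False that VW wW by blast
  have chain: "M.blocks Rl [copy_model (irr_chain (Suc m)) 1 (\<lambda>i. c (m - i))] Z (M.above w) D"
    if c: "c 0 = w" "\<And>j. j \<le> m \<Longrightarrow> c j \<in> D" "\<And>j. j \<le> m \<Longrightarrow> c j \<in> Z" "\<And>j. j \<le> m \<Longrightarrow> \<not> acc (c j) (c j)"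
      "\<And>j. j < m \<Longrightarrow> M.ipred (c (Suc j)) (c j)" and Z: "M.upset Z" "Z \<subseteq> V" "\<And>u. u \<in> Z \<Longrightarrow> le (c m) u" for c m Z
  proof -
    have cW: "c j \<in> M.W" if "j \<le> m" for j using c(2)[OF that] D_W by blast
    have im: "(\<lambda>i. c (m - i)) ` {..<Suc m} = c ` {..m}"
    proof (intro equalityI subsetI)
      fix u assume "u \<in> c ` {..m}"
      then obtain j where "j \<le> m" "u = c j" by auto
      then show "u \<in> (\<lambda>i. c (m - i)) ` {..<Suc m}" by (intro image_eqI[of _ _ "m - j"]) auto
    qed auto
    have wZ: "w \<in> Z" using c(1) c(3)[of 0] by simp
    have "Z - M.above w = c ` {..m}"
    proof (intro equalityI subsetI)
      fix u assume u: "u \<in> Z - M.above w"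
      then have "u \<in> M.W" "le u (c 0)" using Z VW c(1) by (auto simp: M.above_def)
      then show "u \<in> c ` {..m}" using M.chain_cover[of m c u] cW c Z u by auto
    next
      fix u assume "u \<in> c ` {..m}"
      then obtain j where j: "j \<le> m" "u = c j" by auto
      have "le (c j) w"
      proof (cases "j = 0")
        case False
        then show ?thesis using M.chain_acc[of m c j 0] cW c j acc_le by auto
      qed (use c in simp)
      then show "u \<in> Z - M.above w" using c(3) j by (simp add: M.above_def)
    qed
    then have J: "Z - M.above w = (\<lambda>i. c (m - i)) ` {..<Suc m}" using im by simp
    have "M.block Rl (copy_model (irr_chain (Suc m)) 1 (\<lambda>i. c (m - i))) Z (M.above w) ((\<lambda>i. c (m - i)) ` {..<Suc m})"
    proof (rule M.block_irr[OF Z(1) _ _ _ J])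
      show "M.upset (M.above w)" using M.upset_above_irr wW False by blast
      show "M.above w \<subseteq> Z" using M.above_sub Z(1) wZ by blast
      show "acc (c (m - i)) (c (m - j)) \<longleftrightarrow> i < j" if "i < Suc m" "j < Suc m" for i j
        using M.chain_acc[of m c "m - i" "m - j"] cW c that by auto
    qed simp
    moreover have "(\<lambda>i. c (m - i)) ` {..<Suc m} \<subseteq> D" using c(2) by auto
    ultimately show ?thesis using M.blocks_single simple_atomic_irr[of "Suc m" \<delta>] by simp
  qed
  have inD: "c j \<in> D" if "c 0 = w" "\<And>j. j \<le> m \<Longrightarrow> c j \<in> V" "\<And>j. j < m \<Longrightarrow> M.ipred (c (Suc j)) (c j)" "j \<le> m" for c m j
    using that(4)
  proof (induction j)
    case (Suc j)
    then show ?case using ipred_in_D[of "c j" "c (Suc j)"] that(2)[of "Suc j"] that(3)[of j] V by auto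
  qed (use that w in simp)
  have Vup: "\<And>u v. u \<in> V \<Longrightarrow> v \<in> M.W \<Longrightarrow> le u v \<Longrightarrow> v \<in> V" using M.upset_le[OF V(1)] .
  show thesis
  proof (rule M.pred_chain_cases[OF VW Vup w(3) False])
    fix c :: "nat \<Rightarrow> form set"
    assume inf: "c 0 = w" "\<And>j. c j \<in> V" "\<And>j. \<not> acc (c j) (c j)" "\<And>j. M.ipred (c (Suc j)) (c j)"
    have cD: "c j \<in> D" for j using inD[of c j j] inf by blast
    have cW: "c j \<in> M.W" for j using cD D_W by blast
    obtain a where a: "a \<in> V" "acc a a" "\<And>j. acc a (c j)" "\<And>j. \<not> le (c j) a"
        "\<And>u. u \<in> M.W \<Longrightarrow> (\<And>j. \<not> le (c j) u) \<Longrightarrow> le u a"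
      using M.pred_chain_limit[OF V(1), of c] inf by blast
    have aD: "a \<in> D" by (rule limit_in_D[of "range c"]) (use a V cD in auto)
    have strict: "\<not> le (c i) (c j)" if "i < j" for i j
      using M.chain_strict[of j c i j] cW inf that by simp
    have le: "le (c j) (c i)" if "i \<le> j" for i j
      using strict[of i j] M.le_total[OF cW[of i] cW[of j]] that by (cases "i = j") auto
    have up: "M.upset (M.above (c j))" for j using M.upset_above_irr cW inf by blast
    have subV: "M.above (c j) \<subseteq> V" for j using M.above_sub V inf by blast
    \<comment> \<open>The points \<open>c 1\<close>, \<open>c 2\<close> and so on are the layers of
      a \<open>C_frame\<close> copying the limit \<open>a\<close>; the relevant point
      \<open>c 0\<close> is left out and gets a one-point chain of its own.\<close>
    have lay: "M.layers False V (M.above (c 1))" unfolding M.layers_def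
    proof (intro allI exI[of _ "\<lambda>j. M.above (c (Suc j))"] conjI impI)
      fix n j
      show "M.above (c (Suc n)) \<noteq> V" using inf(2)[of "Suc n"] by (auto simp: M.above_def)
      show "M.above (c (Suc j)) \<subseteq> M.above (c (Suc (Suc j)))"
        using M.above_sub[OF up] strict[of "Suc j" "Suc (Suc j)"] cW by (auto simp: M.above_def)
      have "M.above (c (Suc (Suc j))) - M.above (c (Suc j)) = {c (Suc j)}"
        using M.ipred_unique[OF inf(4)[of "Suc j"]] inf(3) cW strict[of "Suc j" "Suc (Suc j)"]
        by (auto simp: M.above_def)
      then show "\<exists>w\<in>M.above (c (Suc (Suc j))) - M.above (c (Suc j)).
           if False then \<forall>u\<in>M.above (c (Suc (Suc j))) - M.above (c (Suc j)). acc u w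
           else M.above (c (Suc (Suc j))) - M.above (c (Suc j)) = {w} \<and> \<not> acc w w"
        using inf(3) by auto
    qed (use up subV in auto)
    have notin: "\<not> le w (c 1)" using strict[of 0 1] inf(1) by simp
    have "M.block Rl (copy_model (C_frame False 1) 1 (\<lambda>_. a)) V (M.above (c 1)) ((\<lambda>_. a) ` {..<1::nat})"
    proof (rule M.block_C[OF V(1) up subV _ _ _ _ _ _ lay])
      show "(\<lambda>_. a) ` {..<1::nat} \<subseteq> V - M.above (c 1)" using a acc_le by (auto simp: M.above_def)
      show "Rl \<inter> (V - M.above (c 1)) = {}"
      proof -
        have False if v: "v \<in> Rl" "v \<in> V" "le v (c 1)" for v
        proof -
          have "le v w" using M.le_trans[of v "c 1" w] v le[of 0 1] inf(1) VW cW wW by auto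
          then show False using Rel v notin by blast
        qed
        then show ?thesis using VW by (auto simp: M.above_def)
      qed
      show "x \<in> (\<lambda>_. a) ` {..<1::nat}" if "x \<in> V - M.above (c 1)"
        using root that notin wW by (auto simp: M.above_def)
    qed (use a in auto)
    then have b1: "M.blocks Rl [copy_model (C_frame False 1) 1 (\<lambda>_. a)] V (M.above (c 1)) D"
      by (rule M.blocks_single) (use aD in \<open>auto intro: simple_atomic_C\<close>)
    have b2: "M.blocks Rl [copy_model (irr_chain (Suc 0)) 1 (\<lambda>i. c (0 - i))] (M.above (c 1)) (M.above w) D"
    proof (rule chain[of c 0])
      show "le (c 0) u" if "u \<in> M.above (c 1)" for u
        using inf(4)[of 0] that by (auto simp: M.ipred_def M.above_def)
      show "c j \<in> M.above (c 1)" if "j \<le> 0" for j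
        using that notin inf(1) wW by (auto simp: M.above_def)
    qed (use cD inf(1,3) up subV in auto)
    from that[OF _ M.blocks_append[OF b1 b2]] show thesis by simp
  next
    fix c :: "nat \<Rightarrow> form set" and m
    assume bot: "c 0 = w" "\<And>j. j \<le> m \<Longrightarrow> c j \<in> V" "\<And>j. j \<le> m \<Longrightarrow> \<not> acc (c j) (c j)"
      "\<And>j. j < m \<Longrightarrow> M.ipred (c (Suc j)) (c j)" "\<And>u. u \<in> V \<Longrightarrow> le (c m) u"
    then have "M.blocks Rl [copy_model (irr_chain (Suc m)) 1 (\<lambda>i. c (m - i))] V (M.above w) D"
      using inD[of c m] V by (intro chain) auto
    from that[OF _ this] show thesis by simp
  next
    fix c :: "nat \<Rightarrow> form set" and m p
    assume refl: "c 0 = w" "\<And>j. j \<le> m \<Longrightarrow> c j \<in> V" "\<And>j. j \<le> m \<Longrightarrow> \<not> acc (c j) (c j)"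
      "\<And>j. j < m \<Longrightarrow> M.ipred (c (Suc j)) (c j)" "M.ipred p (c m)" "p \<in> V" "acc p p"
    have cD: "c j \<in> D" if "j \<le> m" for j using inD[of c m j] refl that by blast
    have cW: "c j \<in> M.W" if "j \<le> m" for j using cD D_W that by blast
    have pW: "p \<in> M.W" using refl VW by blast
    have pD: "p \<in> D" using ipred_in_D[of "c m" p] cD[of m] refl V by auto
    have pr: "M.risol p" using M.ipred_risol_irr[OF cW[of m] _ refl(5)] refl(3)[of m] by simp
    have upp: "M.upset (M.above p)" using M.upset_above pW pr by blast
    have pm: "\<not> le (c m) p" using refl(5) by (simp add: M.ipred_def)
    have cp: "\<not> le (c j) p" if "j \<le> m" for j
    proof
      assume l: "le (c j) p"
      have "le (c m) (c j)" using M.chain_acc[of m c m j] cW refl that acc_le by (cases "j = m") auto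
      then show False using pm l M.le_trans[of "c m" "c j" p] cW pW that by auto
    qed
    \<comment> \<open>All of \<open>V\<close> up to \<open>p\<close> collapses to the single point
      \<open>p\<close>, because neither a relevant point nor the root lies at or before
      \<open>p\<close>.\<close>
    have "M.block Rl (copy_model (refl_cluster 1) 1 (\<lambda>_. p)) V (M.above p) ((\<lambda>_. p) ` {..<1::nat})"
    proof (rule M.block_cluster[OF V(1) upp])
      show "M.above p \<subseteq> V" using M.above_sub V refl by blast
      show "(\<lambda>_. p) ` {..<1::nat} \<subseteq> V - M.above p" using refl by (auto simp: M.above_def)
      show "acc u p" if "u \<in> V - M.above p" for u
        using that VW refl(7) M.le_acc_trans[of u p p] pW by (auto simp: M.above_def)
      have wp: "\<not> le w p" using cp[of 0] refl(1) by simp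
      then have pw: "le p w" using M.lt_acc[OF pW wW] acc_le by blast
      show "Rl \<inter> (V - M.above p) \<subseteq> (\<lambda>_. p) ` {..<1::nat}"
      proof
        fix v assume v: "v \<in> Rl \<inter> (V - M.above p)"
        then have "le v p" "v \<in> M.W" using VW by (auto simp: M.above_def)
        then have "v = w" using Rel[of v] v pw M.le_trans[of v p w] pW wW by blast
        then show "v \<in> (\<lambda>_. p) ` {..<1::nat}" using \<open>le v p\<close> wp by simp
      qed
      show "x \<in> (\<lambda>_. p) ` {..<1::nat}" if "x \<in> V - M.above p"
        using root that wp wW by (auto simp: M.above_def)
    qed (auto simp: inj_on_def)
    then have b1: "M.blocks Rl [copy_model (refl_cluster 1) 1 (\<lambda>_. p)] V (M.above p) D"
      by (rule M.blocks_single) (use pD in \<open>auto intro: simple_atomic_cluster\<close>)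
    have b2: "M.blocks Rl [copy_model (irr_chain (Suc m)) 1 (\<lambda>i. c (m - i))] (M.above p) (M.above w) D"
    proof (rule chain[of c m])
      show "le (c m) u" if "u \<in> M.above p" for u
        using refl(5) that by (auto simp: M.ipred_def M.above_def)
      show "M.above p \<subseteq> V" using M.above_sub V refl by blast
      show "c j \<in> M.above p" if "j \<le> m" for j
        using that cp cW by (auto simp: M.above_def)
    qed (use cD refl upp in auto)
    from that[OF _ M.blocks_append[OF b1 b2]] show thesis by simp
  qed
qed

text \<open>Recursion to the greatest relevant point strictly before \<open>w\<close> reduces the
  number of relevant points, and each round adds at most two components.\<close>

lemma blocks_upto:
  assumes "w \<in> Rl" "w \<in> U0" "w \<in> D"
  shows "\<exists>Ms. length Ms \<le> 2 * card {v \<in> Rl. v \<in> U0 \<and> le v w} \<and> M.blocks Rl Ms U0 (M.above w) D"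
  using assms
proof (induction "card {v \<in> Rl. v \<in> U0 \<and> le v w}" arbitrary: w rule: less_induct)
  case less
  let ?S = "{v \<in> Rl. v \<in> U0 \<and> \<not> le w v}"
  let ?T = "\<lambda>w. {v \<in> Rl. v \<in> U0 \<and> le v w}"
  have wW: "w \<in> M.W" using less D_W by blast
  have finT: "finite (?T u)" for u using Rl_finite by simp
  have sub: "?S \<subseteq> ?T w" using M.lt_acc acc_le wW Rl_sub by blast
  show ?case
  proof (cases "?S = {}")
    case True
    have first: "\<And>v. v \<in> Rl \<Longrightarrow> v \<in> U0 \<Longrightarrow> le v w \<Longrightarrow> le w v" using True by blast
    obtain Ms where "length Ms \<le> 2" "M.blocks Rl Ms U0 (M.above w) D"
      using block_relevant[OF U0 subset_refl less(2,4,3) first] .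
    moreover have "0 < card (?T w)" using less(2,3) finT[of w] card_gt_0_iff[of "?T w"] le_refl[of w] by blast
    ultimately show ?thesis by (intro exI[of _ Ms]) auto
  next
    case False
    obtain v where v: "v \<in> ?S" "\<And>u. u \<in> ?S \<Longrightarrow> le u v"
      using M.finite_greatest[OF _ False] Rl_finite Rl_sub by auto
    have vW: "v \<in> M.W" using v Rl_sub by blast
    have vw: "le v w" using sub v by blast
    have vD: "v \<in> D" using start_Rl[of v] v vW pr_le[OF vw] less(4) Q.le_trans[of "pr v" "pr w" d] pr_W wW d
      by (auto simp: D_def)
    have "?T v \<subseteq> ?T w - {w}"
      using v vw M.le_trans[OF _ vW wW] Rl_sub by auto
    then have "?T v \<subset> ?T w" using less(2,3) by auto
    then have c: "card (?T v) < card (?T w)" using finT psubset_card_mono by blast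
    obtain Ms where Ms: "length Ms \<le> 2 * card (?T v)" "M.blocks Rl Ms U0 (M.above v) D"
      using less(1)[OF c] v vD by blast
    have upv: "M.upset (M.above v)" using M.upset_above vW Rl_risol v by blast
    have "M.above v \<subseteq> U0" using M.above_sub U0 v by blast
    moreover have "w \<in> M.above v" using v wW by (simp add: M.above_def)
    moreover have "le w u" if "u \<in> Rl" "u \<in> M.above v" "le u w" for u
      using v(2)[of u] that M.above_sub[OF U0, of v] v(1) by (auto simp: M.above_def)
    ultimately obtain Ns where Ns: "length Ns \<le> 2" "M.blocks Rl Ns (M.above v) (M.above w) D"
      using block_relevant[OF upv _ less(2,4)] by blast
    have "M.blocks Rl (Ms @ Ns) U0 (M.above w) D" using M.blocks_append Ms Ns by blast
    then show ?thesis using Ms(1) Ns(1) c by (intro exI[of _ "Ms @ Ns"]) auto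
  qed
qed

text \<open>Cutting right after the last relevant point before \<open>ls d\<close> leaves an
  interval \<open>V\<close> whose relevant points do not strictly precede the last cluster over
  \<open>d\<close>, so that one further component can finish the fibre.\<close>

lemma prefix_blocks:
  obtains Ms V where "length Ms \<le> 2 * card Rl" "M.blocks Rl Ms U0 V D" "M.upset V" "V \<subseteq> U0" "ls d \<in> V"
    "\<And>v. v \<in> Rl \<Longrightarrow> v \<in> V \<Longrightarrow> le v (ls d) \<Longrightarrow> le (ls d) v"
proof -
  let ?S = "{v \<in> Rl. v \<in> U0 \<and> \<not> le (ls d) v}"
  have e: "ls d \<in> M.W" "pr (ls d) = d" using ls d by auto
  show thesis
  proof (cases "?S = {}")
    case True
    then show thesis using that[of "[]" U0] M.blocks_Nil U0 last_in by auto
  next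
    case False
    obtain v where v: "v \<in> ?S" "\<And>u. u \<in> ?S \<Longrightarrow> le u v"
      using M.finite_greatest[OF _ False] Rl_finite Rl_sub by auto
    have vW: "v \<in> M.W" using v Rl_sub by blast
    have "le v (ls d)" using M.lt_acc[OF vW e(1)] v acc_le by blast
    then have vD: "v \<in> D" using start_Rl[of v] v vW pr_le[of v "ls d"] e by (auto simp: D_def)
    obtain Ms where Ms: "length Ms \<le> 2 * card {u \<in> Rl. u \<in> U0 \<and> le u v}" "M.blocks Rl Ms U0 (M.above v) D"
      using blocks_upto[of v] v vD by blast
    have "card {u \<in> Rl. u \<in> U0 \<and> le u v} \<le> card Rl" using Rl_finite by (intro card_mono) auto
    then have len: "length Ms \<le> 2 * card Rl" using Ms by simp
    show thesis
    proof (rule that[OF len Ms(2)])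
      show "M.upset (M.above v)" using M.upset_above vW Rl_risol v by blast
      show sub: "M.above v \<subseteq> U0" using M.above_sub U0 v by blast
      show "ls d \<in> M.above v" using v e by (simp add: M.above_def)
      show "le (ls d) u" if "u \<in> Rl" "u \<in> M.above v" "le u (ls d)" for u
        using v(2)[of u] that sub by (auto simp: M.above_def)
    qed
  qed
qed

end

section \<open>Blocks over a single cluster\<close>

lemma at_type_eqI:
  "(\<And>p. p \<in> \<sigma> \<Longrightarrow> y \<in> val M p \<longleftrightarrow> z \<in> val N p) \<Longrightarrow> at_type \<sigma> M y = at_type \<sigma> N z"
  unfolding at_type_def by blast

definition lit_type :: "nat set \<Rightarrow> form set \<Rightarrow> form set" where
  "lit_type \<sigma> u = {Var p | p. p \<in> \<sigma> \<and> Var p \<in> u} \<union> {Neg (Var p) | p. p \<in> \<sigma> \<and> Var p \<notin> u}"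

lemma at_type_lit:
  "(\<And>p. p \<in> \<sigma> \<Longrightarrow> y \<in> val M p \<longleftrightarrow> Var p \<in> u) \<Longrightarrow> at_type \<sigma> M y = lit_type \<sigma> u"
  unfolding at_type_def lit_type_def by blast

lemma final_cluster_osum:
  assumes k: "0 < k"
  shows "final_cluster (osum_frame (Fs @ [refl_cluster k])) ({length Fs} \<times> A ` {..<k})" (is "final_cluster ?F ?C")
    and "\<not> degenerate (osum_frame (Fs @ [refl_cluster k])) ({length Fs} \<times> A ` {..<k})"
proof -
  let ?n = "length Fs"
  have r: "((?n, y), (j, z)) \<in> rel ?F \<longleftrightarrow> j = ?n \<and> y \<in> A ` {..<k} \<and> z \<in> A ` {..<k}" for y j z
    by (auto simp: rel_osum rel_refl_cluster nth_append)
  have r': "((j, z), (?n, y)) \<in> rel ?F \<Longrightarrow> j \<le> ?n" for y j z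
    by (auto simp: rel_osum)
  have w: "(?n, A 0) \<in> worlds ?F" using k by (auto simp: worlds_osum worlds_refl_cluster)
  have "cluster_of ?F (?n, A 0) = ?C"
    unfolding cluster_of_def using k r by auto
  then have "is_cluster ?F ?C" unfolding is_cluster_def using w by metis
  then show "final_cluster ?F ?C" unfolding final_cluster_def using r by auto
  show "\<not> degenerate ?F ?C"
  proof
    assume "degenerate ?F ?C"
    then obtain x where x: "?C = {x}" "(x, x) \<notin> rel ?F" unfolding degenerate_def by blast
    have "(?n, A 0) \<in> ?C" using k by auto
    then have "x = (?n, A 0)" using x by simp
    then show False using x r k by auto
  qed
qed

context K43_root
begin

text \<open>Phrased in the model of \<open>t\<close> so that one choice serves both sides: from
  \<open>p\<close>, arbitrarily long sequences of right-isolated points run back without passing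
  \<open>d\<close>. Pulling them back along the restriction maps yields
  \<open>layers\<close>.\<close>

definition lay :: "bool \<Rightarrow> form set \<Rightarrow> form set \<Rightarrow> bool" where
  "lay r d p \<longleftrightarrow> (\<forall>n. \<exists>c. c 0 = p \<and> (\<forall>j\<le>n. c j \<in> W \<and> risol (c j) \<and> \<not> le (c j) d) \<and>
     (\<forall>j<n. \<not> le (c j) (c (Suc j))) \<and>
     (\<forall>j<n. if r then acc (c j) (c j) else \<not> acc (c j) (c j) \<and> ipred (c (Suc j)) (c j)))"

lemma layI_chain:
  assumes "\<And>j. c j \<in> W" "\<And>j. \<not> le (c j) d" "\<And>j. \<not> acc (c j) (c j)" "\<And>j. ipred (c (Suc j)) (c j)"
  shows "lay False d (c 0)"
  unfolding lay_def
  by (intro allI exI[of _ c]) (use assms irr_risol in \<open>auto simp: ipred_def\<close>)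

lemma blocks_mono:
  assumes "blocks Rl Ms U V H" "H \<subseteq> H'" shows "blocks Rl Ms U V H'"
proof -
  obtain f where "f 0 = U" "f (length Ms) = V"
    "\<forall>i<length Ms. block Rl (Ms ! i) (f i) (f (Suc i)) H \<and> simple_atomic \<tau> (Ms ! i)"
    using assms(1) unfolding blocks_def by (elim exE conjE)
  then show ?thesis unfolding blocks_def by (intro exI[of _ f]) (simp add: block_mono[OF _ assms(2)])
qed

end

context K43_proj
begin

lemma ls_Var: "q \<in> Q.W \<Longrightarrow> p \<in> \<sigma> \<Longrightarrow> Var p \<in> ls q \<longleftrightarrow> Var p \<in> q"
  using ls(2)[of q] pr_mem[of "Var p" "ls q"] by auto

lemma UP_sub:
  assumes q: "q \<in> Q.W" "p \<in> Q.W" "le p q" shows "UP q \<subseteq> UP p"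
  using Q.le_trans[OF pr_W q(2,1)] q by (auto simp: UP_def)

lemma UP_cong:
  assumes "q \<in> Q.W" "p \<in> Q.W" "le p q" "le q p" shows "UP q = UP p"
  using UP_sub assms by blast

lemma circ_blocks:
  assumes q: "q \<in> Q.W" "acc q q" "Q.risol q" and d: "d \<in> Q.W" "Q.risol d" "\<not> le q d"
    and rel: "\<And>w. w \<in> Rl \<Longrightarrow> le (pr w) q \<Longrightarrow> le (pr w) d" and root: "le t d"
  shows "M.blocks Rl [copy_model (refl_cluster 1) 1 (\<lambda>_. ls q)] (UP d) (UP q) UNIV"
proof -
  have dq: "le d q" using d q Q.le_total by blast
  have "M.block Rl (copy_model (refl_cluster 1) 1 (\<lambda>_. ls q)) (UP d) (UP q) ((\<lambda>_. ls q) ` {..<1::nat})"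
  proof (rule M.block_cluster)
    show "M.upset (UP d)" "M.upset (UP q)" using upset_UP q d by auto
    show "UP q \<subseteq> UP d" using UP_sub[OF q(1) d(1) dq] .
    show "(\<lambda>_. ls q) ` {..<1::nat} \<subseteq> UP d - UP q" using ls[OF q(1)] d by (auto simp: UP_def)
    show "acc u (ls q)" if "u \<in> UP d - UP q" for u
      using that ls_reach[OF q(1,2)] by (auto simp: UP_def)
    show "Rl \<inter> (UP d - UP q) \<subseteq> (\<lambda>_. ls q) ` {..<1::nat}"
      using rel by (auto simp: UP_def)
    show "x \<in> (\<lambda>_. ls q) ` {..<1::nat}" if "x \<in> UP d - UP q"
      using that root pr_root by (simp add: UP_def)
  qed (auto simp: inj_on_def)
  then show ?thesis by (rule M.blocks_single) (auto intro: simple_atomic_cluster)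
qed

lemma chain_blocks:
  assumes c: "\<And>j. j \<le> m \<Longrightarrow> c j \<in> Q.W" "\<And>j. j \<le> m \<Longrightarrow> \<not> acc (c j) (c j)"
      "\<And>j. j < m \<Longrightarrow> Q.ipred (c (Suc j)) (c j)"
    and Z: "M.upset Z" "\<And>u. u \<in> M.W \<Longrightarrow> u \<in> Z \<longleftrightarrow> le (c m) (pr u)"
  shows "M.blocks Rl [copy_model (irr_chain (Suc m)) 1 (\<lambda>i. ls (c (m - i)))] Z (UP (c 0)) UNIV"
proof -
  let ?b = "\<lambda>i. ls (c (m - i))"
  have cl: "le (c j) (c 0)" "le (c m) (c j)" if "j \<le> m" for j
  proof -
    have "acc (c j) (c 0) \<longleftrightarrow> 0 < j" "acc (c m) (c j) \<longleftrightarrow> j < m"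
      using Q.chain_acc[of m c j 0] Q.chain_acc[of m c m j] c that by auto
    then show "le (c j) (c 0)" "le (c m) (c j)"
      using that by (auto simp: le_def le_less)
  qed
  have mem: "u \<in> Z - UP (c 0) \<longleftrightarrow> (\<exists>j\<le>m. u = ls (c j))" for u
  proof
    assume u: "u \<in> Z - UP (c 0)"
    have uW: "u \<in> M.W" using u Z M.upset_sub by blast
    have "le (c m) (pr u)" "le (pr u) (c 0)" using u Z uW by (auto simp: UP_def)
    then obtain j where j: "j \<le> m" "pr u = c j"
      using Q.chain_cover[of m c "pr u"] c pr_W[OF uW] by blast
    then have "u = ls (c j)" using irr_fibre[of u "ls (c j)" "c j"] uW ls c by auto
    then show "\<exists>j\<le>m. u = ls (c j)" using j by blast
  next
    assume "\<exists>j\<le>m. u = ls (c j)"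
    then obtain j where j: "j \<le> m" "u = ls (c j)" by blast
    then show "u \<in> Z - UP (c 0)" using ls[of "c j"] c Z cl by (auto simp: UP_def)
  qed
  have J: "Z - UP (c 0) = ?b ` {..<Suc m}"
  proof (intro set_eqI iffI)
    fix u assume "u \<in> Z - UP (c 0)"
    then obtain j where "j \<le> m" "u = ls (c j)" using mem by blast
    then show "u \<in> ?b ` {..<Suc m}" by (intro image_eqI[of _ _ "m - j"]) auto
  next
    fix u assume "u \<in> ?b ` {..<Suc m}"
    then obtain i where "u = ls (c (m - i))" by auto
    moreover have "m - i \<le> m" by simp
    ultimately show "u \<in> Z - UP (c 0)" using mem[of u] by blast
  qed
  have "M.block Rl (copy_model (irr_chain (Suc m)) 1 ?b) Z (UP (c 0)) (?b ` {..<Suc m})"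
  proof (rule M.block_irr[OF Z(1) _ _ _ J])
    show "M.upset (UP (c 0))" using upset_UP Q.irr_risol c by blast
    show "UP (c 0) \<subseteq> Z"
    proof
      fix u assume u: "u \<in> UP (c 0)"
      then have uW: "u \<in> M.W" "\<not> le (pr u) (c 0)" by (auto simp: UP_def)
      have "le (c 0) (pr u)" using uW Q.le_total[of "pr u" "c 0"] pr_W c by blast
      then have "le (c m) (pr u)" using Q.le_trans[of "c m" "c 0" "pr u"] cl[of 0] c pr_W uW by auto
      then show "u \<in> Z" using Z uW by blast
    qed
    show "acc (?b i) (?b j) \<longleftrightarrow> i < j" if "i < Suc m" "j < Suc m" for i j
      using irr_acc_ls[of "c (m - i)" "c (m - j)"] Q.chain_acc[of m c "m - i" "m - j"] c that by auto
  qed simp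
  then show ?thesis by (rule M.blocks_single) (auto intro: simple_atomic_irr)
qed

text \<open>Layers are preimages of the stretches between consecutive \<open>c j\<close>. Over a
  reflexive \<open>c j\<close> the whole stretch sees \<open>ls (c j)\<close>; over an irreflexive
  one the stretch is a singleton by \<open>irr_fibre\<close>.\<close>

lemma layers_UP:
  assumes lay: "Q.lay r d p" and d: "d \<in> Q.W" and Z: "M.upset Z" "ls d \<in> Z"
  shows "M.layers r Z (UP p)"
  unfolding M.layers_def
proof
  fix n
  obtain c where c: "c 0 = p" "\<And>j. j \<le> n \<Longrightarrow> c j \<in> Q.W" "\<And>j. j \<le> n \<Longrightarrow> Q.risol (c j)"
      "\<And>j. j \<le> n \<Longrightarrow> \<not> le (c j) d" "\<And>j. j < n \<Longrightarrow> \<not> le (c j) (c (Suc j))"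
      "\<And>j. j < n \<Longrightarrow> if r then acc (c j) (c j) else \<not> acc (c j) (c j) \<and> Q.ipred (c (Suc j)) (c j)"
    using lay[unfolded Q.lay_def, rule_format, of n] by auto
  have le: "le (c (Suc j)) (c j)" if "j < n" for j
    using c(5)[OF that] Q.le_total[of "c j" "c (Suc j)"] c(2) that by auto
  let ?f = "\<lambda>j. UP (c j)"
  show "\<exists>f. f 0 = UP p \<and> (\<forall>j\<le>n. M.upset (f j)) \<and> (\<forall>j<n. f j \<subseteq> f (Suc j)) \<and> f n \<subseteq> Z \<and> f n \<noteq> Z \<and>
     (\<forall>j<n. \<exists>w\<in>f (Suc j) - f j.
        if r then \<forall>u\<in>f (Suc j) - f j. acc u w else f (Suc j) - f j = {w} \<and> \<not> acc w w)"
  proof (intro exI[of _ ?f] conjI allI impI)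
    fix j assume j: "j \<le> n"
    then show "M.upset (UP (c j))" using upset_UP c by blast
  next
    fix j assume j: "j < n"
    then show "UP (c j) \<subseteq> UP (c (Suc j))" using UP_sub[of "c j" "c (Suc j)"] le c by auto
  next
    have dc: "le d (c n)" using c(4)[of n] c(2)[of n] d Q.le_total[of d "c n"] by auto
    show "UP (c n) \<subseteq> Z"
    proof
      fix u assume "u \<in> UP (c n)"
      then have u: "u \<in> M.W" "\<not> le (pr u) (c n)" by (auto simp: UP_def)
      have "\<not> le u (ls d)"
        using pr_le[of u "ls d"] ls(2)[OF d] u Q.le_trans[OF pr_W[OF u(1)] d c(2)[of n] _ dc] by auto
      then have "le (ls d) u" using M.le_total[of u "ls d"] u ls d by auto
      then show "u \<in> Z" using Z M.upset_le u by blast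
    qed
    have "ls d \<notin> UP (c n)" using dc ls d by (simp add: UP_def)
    then show "UP (c n) \<noteq> Z" using Z by blast
  next
    fix j assume j: "j < n"
    let ?w = "ls (c j)"
    have cj: "c j \<in> Q.W" "c (Suc j) \<in> Q.W" using c(2) j by auto
    have w: "?w \<in> UP (c (Suc j)) - UP (c j)" using ls[OF cj(1)] c(5)[OF j] by (auto simp: UP_def)
    show "\<exists>w\<in>UP (c (Suc j)) - UP (c j).
        if r then \<forall>u\<in>UP (c (Suc j)) - UP (c j). acc u w else UP (c (Suc j)) - UP (c j) = {w} \<and> \<not> acc w w"
    proof (rule bexI[OF _ w], cases r)
      case True
      then have "acc (c j) (c j)" using c(6)[OF j] by simp
      then show "if r then \<forall>u\<in>UP (c (Suc j)) - UP (c j). acc u ?w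
        else UP (c (Suc j)) - UP (c j) = {?w} \<and> \<not> acc ?w ?w"
        using True ls_reach[OF cj(1)] by (auto simp: UP_def)
    next
      case False
      then have irr: "\<not> acc (c j) (c j)" and ip: "Q.ipred (c (Suc j)) (c j)" using c(6)[OF j] by auto
      have "u = ?w" if u: "u \<in> UP (c (Suc j)) - UP (c j)" for u
      proof -
        have uW: "u \<in> M.W" "\<not> le (pr u) (c (Suc j))" "le (pr u) (c j)" using u by (auto simp: UP_def)
        have "pr u = c j" using Q.ipred_unique[OF ip pr_W[OF uW(1)] uW(3,2) irr cj(1)] .
        then show ?thesis using irr_fibre[OF uW(1) ls(1)[OF cj(1)] _ ls(2)[OF cj(1)] irr] by simp
      qed
      then have "UP (c (Suc j)) - UP (c j) = {?w}" using w by blast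
      moreover have "\<not> acc ?w ?w" using irr_acc_ls[OF cj(1,1) irr] irr by simp
      ultimately show "if r then \<forall>u\<in>UP (c (Suc j)) - UP (c j). acc u ?w
        else UP (c (Suc j)) - UP (c j) = {?w} \<and> \<not> acc ?w ?w"
        using False by simp
    qed
  qed (use c in simp)
qed

lemma block_limit:
  assumes lay: "Q.lay r d p" and d: "d \<in> Q.W" "acc d d" and p: "p \<in> Q.W" "Q.risol p" "\<not> le p d"
    and Z: "M.upset Z" "ls d \<in> Z" and k: "0 < k" "k \<le> 2 ^ card \<delta>"
    and e: "e ` {..<k} \<subseteq> M.cluster (ls d)"
    and Rl: "Rl \<inter> (Z - UP p) = {}" and root: "x \<in> Z - UP p \<Longrightarrow> x \<in> e ` {..<k}"
  shows "M.blocks Rl [copy_model (C_frame r k) k e] Z (UP p) (M.cluster (ls d))"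
proof -
  have dp: "le d p" using p d Q.le_total by blast
  have eW: "ls d \<in> M.W" using ls d by blast
  have refl: "acc (ls d) (ls d)" using ls_reach[OF d eW] ls(2) d by simp
  have C: "u \<in> M.W" "le u (ls d)" "le (ls d) u" if "u \<in> M.cluster (ls d)" for u
    using that by (auto simp: M.cluster_def)
  have "M.block Rl (copy_model (C_frame r k) k e) Z (UP p) (e ` {..<k})"
  proof (rule M.block_C[OF Z(1) upset_UP[OF p(1,2)] _ k _ _ Rl root layers_UP[OF lay d(1) Z]])
    show "UP p \<subseteq> Z"
    proof
      fix u assume "u \<in> UP p"
      then have u: "u \<in> M.W" "\<not> le (pr u) p" by (auto simp: UP_def)
      have "\<not> le u (ls d)"
        using pr_le[of u "ls d"] ls(2)[OF d(1)] u Q.le_trans[OF pr_W[OF u(1)] d(1) p(1) _ dp] by auto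
      then have "le (ls d) u" using M.le_total[of u "ls d"] u eW by auto
      then show "u \<in> Z" using Z M.upset_le u by blast
    qed
    show "e ` {..<k} \<subseteq> Z - UP p"
    proof
      fix u assume "u \<in> e ` {..<k}"
      then have u: "u \<in> M.cluster (ls d)" using e by blast
      have "le (pr u) d" using pr_le[OF C(2)[OF u]] ls(2)[OF d(1)] by simp
      then have "le (pr u) p" using Q.le_trans[OF pr_W[OF C(1)[OF u]] d(1) p(1) _ dp] by blast
      then show "u \<in> Z - UP p" using M.upset_le[OF Z] C[OF u] by (auto simp: UP_def)
    qed
    show "acc (e i) (e j)" if "i < k" "j < k" for i j
    proof -
      have u: "e i \<in> M.cluster (ls d)" "e j \<in> M.cluster (ls d)" using e that by auto
      have "acc (e i) (ls d)" using M.le_acc_trans[OF C(1)[OF u(1)] eW eW C(2)[OF u(1)] refl] .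
      then show ?thesis using M.acc_le_trans[OF C(1)[OF u(1)] eW C(1)[OF u(2)] _ C(3)[OF u(2)]] by blast
    qed
  qed
  from M.blocks_single[OF this simple_atomic_C[OF k] e] show ?thesis .
qed

text \<open>From \<open>ls d\<close> a point over any member of the cluster is visible, and that
  point sees \<open>ls d\<close> back.\<close>

lemma cluster_surj:
  assumes d: "d \<in> Q.W" "acc d d" and q: "q \<in> Q.cluster d"
  obtains u where "u \<in> M.cluster (ls d)" "pr u = q"
proof -
  have q': "q \<in> Q.W" "le d q" "le q d" using q by (auto simp: Q.cluster_def)
  have eW: "ls d \<in> M.W" "pr (ls d) = d" using ls d by auto
  have "acc (pr (ls d)) q" using eW Q.acc_le_trans[OF d(1,1) q'(1) d(2) q'(2)] by simp
  then obtain u where u: "u \<in> M.W" "acc (ls d) u" "pr u = q" using pr_lift[OF eW(1) q'(1)] by blast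
  then have "acc u (ls d)" using ls_reach[OF d u(1)] q' by simp
  then show thesis using that[of u] u acc_le by (auto simp: M.cluster_def)
qed

lemma cluster_pr:
  assumes d: "d \<in> Q.W" and u: "u \<in> M.cluster (ls d)" shows "pr u \<in> Q.cluster d"
  using u pr_le[of u "ls d"] pr_le[of "ls d" u] ls(2)[OF d] pr_W by (auto simp: M.cluster_def Q.cluster_def)

end

context K43_start
begin

lemma D_pr: "u \<in> D \<Longrightarrow> pr u \<in> Q.cluster d"
  using pr_W by (auto simp: D_def Q.cluster_def)

lemma D_type:
  assumes "\<exists>u\<in>D. \<forall>p\<in>\<delta>. y \<in> val M p \<longleftrightarrow> Var p \<in> u"
  shows "at_type \<sigma> M y \<in> lit_type \<sigma> ` Q.cluster d"
proof -
  obtain u where u: "u \<in> D" "\<forall>p\<in>\<delta>. y \<in> val M p \<longleftrightarrow> Var p \<in> u" using assms by blast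
  have "at_type \<sigma> M y = lit_type \<sigma> (pr u)"
    by (rule at_type_lit) (use u(2) sig_sub pr_mem[of _ u] in auto)
  then show ?thesis using D_pr[OF u(1)] by blast
qed

text \<open>All copied points project into the cluster of \<open>d\<close>, and the last component,
  being the full cluster of \<open>ls d\<close>, projects onto it. The same types thus occur in the
  final cluster as in the whole sum, whatever the cluster sizes on the two sides.\<close>

lemma fibre_blocks:
  assumes r: "Q.risol d"
  obtains Ms k c where "length Ms \<le> 2 * card Rl" "0 < (k::nat)"
    "M.blocks Rl (Ms @ [copy_model (refl_cluster k) k c]) U0 (UP d) D"
    "at_type \<sigma> (osum_model (Ms @ [copy_model (refl_cluster k) k c])) `
       worlds (frame_of (osum_model (Ms @ [copy_model (refl_cluster k) k c]))) \<subseteq> lit_type \<sigma> ` Q.cluster d"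
    "lit_type \<sigma> ` Q.cluster d \<subseteq>
       at_type \<sigma> (osum_model (Ms @ [copy_model (refl_cluster k) k c])) ` ({length Ms} \<times> A ` {..<k})"
proof -
  obtain Ms V where Ms: "length Ms \<le> 2 * card Rl" "M.blocks Rl Ms U0 V D" and V: "M.upset V" "V \<subseteq> U0"
    "ls d \<in> V" and first: "\<And>v. v \<in> Rl \<Longrightarrow> v \<in> V \<Longrightarrow> le v (ls d) \<Longrightarrow> le (ls d) v"
    using prefix_blocks by blast
  have eW: "ls d \<in> M.W" using ls d by blast
  have refl: "acc (ls d) (ls d)" using ls_reach[OF d eW] ls(2) d by simp
  have ab: "M.above (ls d) = UP d" using ls_le_iff[OF d] by (auto simp: M.above_def UP_def)
  have "M.risol (ls d)" unfolding M.risol_def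
  proof (subst M.dfn_cong)
    show "M.dfn (- UP d)" using M.dfn_compl M.upset_dfn upset_UP d r by blast
    show "u \<in> {u. le u (ls d)} \<longleftrightarrow> u \<in> - UP d" if "u \<in> M.W" for u
      using that ls_le_iff[OF d] by (auto simp: UP_def)
  qed
  then obtain k c where k: "0 < (k::nat)" "c ` {..<k} = M.cluster (ls d)"
    "M.blocks Rl [copy_model (refl_cluster k) k c] V (M.above (ls d)) D"
    using block_cluster_D[OF V(1,2) ls_D V(3) refl _ first] by blast
  let ?Ns = "Ms @ [copy_model (refl_cluster k) k c]"
  let ?N = "osum_model ?Ns"
  have b: "M.blocks Rl ?Ns U0 (UP d) D" using M.blocks_append[OF Ms(2) k(3)] ab by simp
  show thesis
  proof (rule that[OF Ms(1) k(1) b]; rule subsetI)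
    fix T assume "T \<in> at_type \<sigma> ?N ` worlds (frame_of ?N)"
    then obtain y where y: "y \<in> worlds (frame_of ?N)" "T = at_type \<sigma> ?N y" by blast
    have "M.block Rl ?N U0 (UP d) D" using M.blocks_block[OF b] by simp
    from M.block_types[OF this y(1)] show "T \<in> lit_type \<sigma> ` Q.cluster d"
      unfolding y(2) by (rule D_type)
  next
    fix T assume "T \<in> lit_type \<sigma> ` Q.cluster d"
    then obtain q where q: "q \<in> Q.cluster d" "T = lit_type \<sigma> q" by blast
    obtain u where u: "u \<in> M.cluster (ls d)" "pr u = q" using cluster_surj[OF d q(1)] .
    then obtain j where j: "j < k" "c j = u" using k(2) by (metis imageE lessThan_iff)
    have "at_type \<sigma> ?N (length Ms, A j) = lit_type \<sigma> q"
      by (rule at_type_lit) (use j u(2) pr_mem[of _ u] in \<open>auto simp: val_osum worlds_refl_cluster\<close>)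
    then show "T \<in> at_type \<sigma> ?N ` ({length Ms} \<times> A ` {..<k})"
      using q(2) j(1) by (intro image_eqI[of _ _ "(length Ms, A j)"]) auto
  qed
qed

text \<open>The root cluster of the \<open>C_frame\<close> is indexed by the cluster of
  \<open>d\<close> rather than by that of \<open>ls d\<close>, so that both sides use the same
  \<open>k\<close>. The points of \<open>ls d\<close>'s cluster enter only as chosen preimages
  \<open>e i\<close> of the \<open>q i\<close>.\<close>

lemma fibre_limit_blocks:
  assumes nr: "\<not> Q.risol d" and lay: "Q.lay r d p" and p: "p \<in> Q.W" "Q.risol p" "\<not> le p d"
    and rel: "\<And>w. w \<in> Rl \<Longrightarrow> le (pr w) p \<Longrightarrow> le (pr w) d"
    and k: "0 < k" "k \<le> 2 ^ card \<delta>" and q: "q ` {..<k} = Q.cluster d"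
  obtains Ms V e where "length Ms \<le> 2 * card Rl"
    "M.blocks Rl Ms U0 V D" "M.blocks Rl [copy_model (C_frame r k) k e] V (UP p) D"
    "\<forall>M\<in>set Ms. \<forall>y\<in>worlds (frame_of M). at_type \<sigma> M y \<in> lit_type \<sigma> ` Q.cluster d"
    "\<forall>i<k. at_type \<sigma> (copy_model (C_frame r k) k e) (A i) = lit_type \<sigma> (q i)"
proof -
  obtain Ms V where Ms: "length Ms \<le> 2 * card Rl" "M.blocks Rl Ms U0 V D" and V: "M.upset V" "V \<subseteq> U0"
    "ls d \<in> V" and first: "\<And>v. v \<in> Rl \<Longrightarrow> v \<in> V \<Longrightarrow> le v (ls d) \<Longrightarrow> le (ls d) v"
    using prefix_blocks by blast
  have eW: "ls d \<in> M.W" using ls d by blast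
  \<comment> \<open>The last condition reserves \<open>x\<close> for the index of \<open>t\<close>,
    so that a root lying in this cluster is among the copied points.\<close>
  have "\<exists>u. u \<in> M.cluster (ls d) \<and> pr u = q i \<and> (x \<in> M.cluster (ls d) \<longrightarrow> q i = t \<longrightarrow> u = x)" if i: "i < k" for i
  proof (cases "x \<in> M.cluster (ls d) \<and> q i = t")
    case True
    then show ?thesis using pr_root by auto
  next
    case False
    have "q i \<in> Q.cluster d" using q i by blast
    then obtain u where "u \<in> M.cluster (ls d)" "pr u = q i" by (rule cluster_surj[OF d])
    then show ?thesis using False by blast
  qed
  then obtain e where e: "\<And>i. i < k \<Longrightarrow> e i \<in> M.cluster (ls d)" "\<And>i. i < k \<Longrightarrow> pr (e i) = q i"
    "\<And>i. i < k \<Longrightarrow> x \<in> M.cluster (ls d) \<Longrightarrow> q i = t \<Longrightarrow> e i = x" by metis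
  have "M.blocks Rl [copy_model (C_frame r k) k e] V (UP p) (M.cluster (ls d))"
  proof (rule block_limit[OF lay d p V(1,3) k])
    show "e ` {..<k} \<subseteq> M.cluster (ls d)" using e by auto
    show "Rl \<inter> (V - UP p) = {}"
    proof (rule ccontr)
      assume "Rl \<inter> (V - UP p) \<noteq> {}"
      then obtain v where v: "v \<in> Rl" "v \<in> V" "v \<notin> UP p" by blast
      have vW: "v \<in> M.W" using v Rl_sub by blast
      have "le (pr v) d" using rel v vW by (simp add: UP_def)
      then have "le v (ls d)" using ls_le_iff[OF d vW] by simp
      then show False using risol_proj[OF d vW _ first[OF v(1,2)] Rl_risol[OF v(1)]] nr by blast
    qed
    assume xV: "x \<in> V - UP p"
    then have "le (ls d) x" using root_last[OF V(1,2) _ ls_D V(3) first] by blast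
    then have xC: "x \<in> M.cluster (ls d)" using M.root_le[OF eW] by (simp add: M.cluster_def)
    then have "t \<in> Q.cluster d" using cluster_pr[OF d(1)] pr_root by metis
    then obtain i where "i < k" "q i = t" using q by (metis imageE lessThan_iff)
    then show "x \<in> e ` {..<k}" using e(3) xC by blast
  qed
  moreover have "M.cluster (ls d) \<subseteq> D"
    using cluster_pr[OF d(1)] by (auto simp: D_def Q.cluster_def M.cluster_def)
  ultimately have "M.blocks Rl [copy_model (C_frame r k) k e] V (UP p) D" by (rule M.blocks_mono)
  moreover have "at_type \<sigma> M y \<in> lit_type \<sigma> ` Q.cluster d" if "M \<in> set Ms" "y \<in> worlds (frame_of M)" for M y
    using M.blocks_types[OF Ms(2) that] by (rule D_type)
  moreover have "at_type \<sigma> (copy_model (C_frame r k) k e) (A i) = lit_type \<sigma> (q i)" if "i < k" for i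
    by (rule at_type_lit) (use that e(2)[OF that] pr_mem[of _ "e i"] in \<open>auto simp: worlds_C\<close>)
  ultimately show thesis using that[OF Ms] by blast
qed

end

section \<open>Matching the two sides\<close>

locale K43_pair = K43_logic L + Q: K43_root L \<sigma> t +
    S1: K43_proj L \<delta> x\<^sub>1 \<sigma> t R\<^sub>1 + S2: K43_proj L \<delta> x\<^sub>2 \<sigma> t R\<^sub>2
  for L \<delta> \<sigma> t x\<^sub>1 x\<^sub>2 R\<^sub>1 R\<^sub>2 +
  fixes bound :: nat
  assumes bound: "2 * card R\<^sub>1 + 1 \<le> bound" "2 * card R\<^sub>2 + 1 \<le> bound"
begin

text \<open>Including \<open>t\<close> guarantees a relevant point at or before any point and keeps
  the roots out of gaps.\<close>

definition RQ :: "form set set" where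
  "RQ = S1.pr ` R\<^sub>1 \<union> S2.pr ` R\<^sub>2 \<union> {t}"

lemma RQ: "finite RQ" "RQ \<subseteq> Q.W" "t \<in> RQ"
  using S1.Rl_finite S2.Rl_finite S1.pr_W S2.pr_W S1.Rl_sub S2.Rl_sub by (auto simp: RQ_def)

lemma card_RQ: "card RQ \<le> card R\<^sub>1 + card R\<^sub>2 + 1"
proof -
  have "card RQ \<le> card (S1.pr ` R\<^sub>1 \<union> S2.pr ` R\<^sub>2) + card {t}"
    unfolding RQ_def by (rule card_Un_le)
  also have "card (S1.pr ` R\<^sub>1 \<union> S2.pr ` R\<^sub>2) \<le> card (S1.pr ` R\<^sub>1) + card (S2.pr ` R\<^sub>2)"
    by (rule card_Un_le)
  also have "card (S1.pr ` R\<^sub>1) \<le> card R\<^sub>1" using S1.Rl_finite by (rule card_image_le)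
  also have "card (S2.pr ` R\<^sub>2) \<le> card R\<^sub>2" using S2.Rl_finite by (rule card_image_le)
  finally show ?thesis by simp
qed

text \<open>One pair of the final decomposition, viewed as a relation between pairs of definable
  cuts so that pairs compose by iteration. Which points are copied is forgotten here, matching
  having been checked already.\<close>

definition pg :: "form set set \<times> form set set \<Rightarrow> form set set \<times> form set set \<Rightarrow> bool" where
  "pg P P' \<longleftrightarrow> (\<exists>Ms\<^sub>1 Ms\<^sub>2.
     S1.M.blocks R\<^sub>1 Ms\<^sub>1 (fst P) (fst P') UNIV \<and> S2.M.blocks R\<^sub>2 Ms\<^sub>2 (snd P) (snd P') UNIV \<and>
     Ms\<^sub>1 \<noteq> [] \<and> Ms\<^sub>2 \<noteq> [] \<and> length Ms\<^sub>1 \<le> bound \<and> length Ms\<^sub>2 \<le> bound \<and> 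
     sigma_matching \<delta> \<sigma> Ms\<^sub>1 Ms\<^sub>2)"

lemma pgI:
  assumes "S1.M.blocks R\<^sub>1 Ms\<^sub>1 U\<^sub>1 V\<^sub>1 H\<^sub>1" "S2.M.blocks R\<^sub>2 Ms\<^sub>2 U\<^sub>2 V\<^sub>2 H\<^sub>2" "Ms\<^sub>1 \<noteq> []" "Ms\<^sub>2 \<noteq> []"
    "length Ms\<^sub>1 \<le> bound" "length Ms\<^sub>2 \<le> bound" "sigma_matching \<delta> \<sigma> Ms\<^sub>1 Ms\<^sub>2"
  shows "pg (U\<^sub>1, U\<^sub>2) (V\<^sub>1, V\<^sub>2)"
  unfolding pg_def fst_conv snd_conv
  using S1.M.blocks_mono[OF assms(1) subset_UNIV] S2.M.blocks_mono[OF assms(2) subset_UNIV] assms(3-)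
  by blast

lemma pg_single:
  assumes b: "S1.M.blocks R\<^sub>1 [copy_model F k e\<^sub>1] U\<^sub>1 V\<^sub>1 H\<^sub>1" "S2.M.blocks R\<^sub>2 [copy_model F k e\<^sub>2] U\<^sub>2 V\<^sub>2 H\<^sub>2"
    and at: "\<And>z p. p \<in> \<sigma> \<Longrightarrow> Var p \<in> copy k e\<^sub>1 z \<longleftrightarrow> Var p \<in> copy k e\<^sub>2 z"
  shows "pg (U\<^sub>1, U\<^sub>2) (V\<^sub>1, V\<^sub>2)"
proof (rule pgI[OF b])
  have s: "simple_atomic \<delta> (copy_model F k e\<^sub>1)" "simple_atomic \<delta> (copy_model F k e\<^sub>2)"
    using S1.M.blocks_simple[OF b(1)] S2.M.blocks_simple[OF b(2)] by auto
  have "matching_a \<delta> \<sigma> [copy_model F k e\<^sub>1] [copy_model F k e\<^sub>2]"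
    unfolding matching_a_def using s at
    by (intro exI[of _ "copy_model F k e\<^sub>1"] exI[of _ "copy_model F k e\<^sub>2"] exI[of _ F])
      (auto simp: simple_atomic_def intro!: at_type_eqI)
  then show "sigma_matching \<delta> \<sigma> [copy_model F k e\<^sub>1] [copy_model F k e\<^sub>2]"
    by (simp add: sigma_matching_def)
qed (use bound in auto)

abbreviation UPP :: "form set \<Rightarrow> form set set \<times> form set set" where
  "UPP q \<equiv> (S1.UP q, S2.UP q)"

definition steps :: "nat \<Rightarrow> form set set \<times> form set set \<Rightarrow> form set set \<times> form set set \<Rightarrow> bool" where
  "steps n P P' \<longleftrightarrow> (\<exists>m\<le>n. (pg ^^ m) P P')"

lemma steps_refl: "steps 0 P P"
  by (simp add: steps_def)

lemma steps_pg: "pg P P' \<Longrightarrow> steps 1 P P'"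
  unfolding steps_def by (intro exI[of _ 1]) auto

lemma steps_trans: "steps m P P' \<Longrightarrow> steps n P' P'' \<Longrightarrow> steps (m + n) P P''"
proof -
  assume "steps m P P'" "steps n P' P''"
  then obtain i j where i: "i \<le> m" "(pg ^^ i) P P'" and j: "j \<le> n" "(pg ^^ j) P' P''"
    unfolding steps_def by blast
  have "(pg ^^ (i + j)) P P''" unfolding relpowp_add using i(2) j(2) by (rule relcomppI)
  then show ?thesis unfolding steps_def using i(1) j(1) by (intro exI[of _ "i + j"]) simp
qed

lemma steps_mono: "steps m P P' \<Longrightarrow> m \<le> n \<Longrightarrow> steps n P P'"
  unfolding steps_def using order_trans[of _ m n] by blast

lemma ls_Var_eq: "q \<in> Q.W \<Longrightarrow> p \<in> \<sigma> \<Longrightarrow> Var p \<in> S1.ls q \<longleftrightarrow> Var p \<in> S2.ls q"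
  using S1.ls_Var S2.ls_Var by simp

lemma copy_cong:
  assumes "\<And>i. Var p \<in> e\<^sub>1 i \<longleftrightarrow> Var p \<in> e\<^sub>2 i"
  shows "Var p \<in> copy k e\<^sub>1 z \<longleftrightarrow> Var p \<in> copy k e\<^sub>2 z"
  using assms by (cases z) auto

text \<open>After \<open>d\<close> and up to \<open>q\<close> nothing relevant from either side
  occurs, so the same atomic frame with copies of last points over the same points can be used on
  both sides, which gives matching of kind (a).\<close>

definition gap :: "form set \<Rightarrow> form set \<Rightarrow> bool" where
  "gap d q \<longleftrightarrow> d \<in> Q.W \<and> q \<in> Q.W \<and> \<not> le q d \<and> (\<forall>r\<in>RQ. le r q \<longrightarrow> le r d)"

lemma gap_trans:
  assumes g: "gap d q" and p: "p \<in> Q.W" "le p q" "\<not> le p d"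
  shows "gap d p" "\<not> le q p \<Longrightarrow> gap p q"
proof -
  have r: "r \<in> Q.W" if "r \<in> RQ" for r using RQ that by blast
  show "gap d p" using g p r Q.le_trans[of _ p q] unfolding gap_def by blast
  have "le d p" using g p Q.le_total unfolding gap_def by blast
  then show "gap p q" if "\<not> le q p" using g p that r Q.le_trans[of _ d p] unfolding gap_def by blast
qed

lemma gap_rel:
  assumes "gap d q"
  shows "w \<in> R\<^sub>1 \<Longrightarrow> le (S1.pr w) q \<Longrightarrow> le (S1.pr w) d" "w \<in> R\<^sub>2 \<Longrightarrow> le (S2.pr w) q \<Longrightarrow> le (S2.pr w) d"
    "le t d"
  using assms RQ Q.root_le unfolding gap_def RQ_def by auto

lemma pg_circ:
  assumes g: "gap d q" and q: "acc q q" "Q.risol q" and d: "Q.risol d"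
  shows "pg (UPP d) (UPP q)"
proof (rule pg_single)
  have *: "d \<in> Q.W" "q \<in> Q.W" "\<not> le q d" using g by (auto simp: gap_def)
  show "S1.M.blocks R\<^sub>1 [copy_model (refl_cluster 1) 1 (\<lambda>_. S1.ls q)] (S1.UP d) (S1.UP q) UNIV"
    by (rule S1.circ_blocks) (use * q d gap_rel[OF g] in auto)
  show "S2.M.blocks R\<^sub>2 [copy_model (refl_cluster 1) 1 (\<lambda>_. S2.ls q)] (S2.UP d) (S2.UP q) UNIV"
    by (rule S2.circ_blocks) (use * q d gap_rel[OF g] in auto)
  show "Var p \<in> copy 1 (\<lambda>_. S1.ls q) z \<longleftrightarrow> Var p \<in> copy 1 (\<lambda>_. S2.ls q) z" if "p \<in> \<sigma>" for z p
    using ls_Var_eq[OF *(2) that] by (rule copy_cong)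
qed

lemma pg_chain:
  assumes c: "\<And>j. j \<le> m \<Longrightarrow> c j \<in> Q.W" "\<And>j. j \<le> m \<Longrightarrow> \<not> acc (c j) (c j)"
      "\<And>j. j < m \<Longrightarrow> Q.ipred (c (Suc j)) (c j)"
    and Z1: "S1.M.upset Z\<^sub>1" "\<And>u. u \<in> S1.M.W \<Longrightarrow> u \<in> Z\<^sub>1 \<longleftrightarrow> le (c m) (S1.pr u)"
    and Z2: "S2.M.upset Z\<^sub>2" "\<And>u. u \<in> S2.M.W \<Longrightarrow> u \<in> Z\<^sub>2 \<longleftrightarrow> le (c m) (S2.pr u)"
  shows "pg (Z\<^sub>1, Z\<^sub>2) (UPP (c 0))"
proof (rule pg_single)
  show "S1.M.blocks R\<^sub>1 [copy_model (irr_chain (Suc m)) 1 (\<lambda>i. S1.ls (c (m - i)))] Z\<^sub>1 (S1.UP (c 0)) UNIV"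
    using S1.chain_blocks[of m c, OF c Z1] .
  show "S2.M.blocks R\<^sub>2 [copy_model (irr_chain (Suc m)) 1 (\<lambda>i. S2.ls (c (m - i)))] Z\<^sub>2 (S2.UP (c 0)) UNIV"
    using S2.chain_blocks[of m c, OF c Z2] .
  show "Var p \<in> copy 1 (\<lambda>i. S1.ls (c (m - i))) z \<longleftrightarrow> Var p \<in> copy 1 (\<lambda>i. S2.ls (c (m - i))) z"
    if "p \<in> \<sigma>" for z p
    using ls_Var_eq[OF c(1) that] by (intro copy_cong) auto
qed

lemma pg_chain_UP:
  assumes c: "\<And>j. j \<le> m \<Longrightarrow> c j \<in> Q.W" "\<And>j. j \<le> m \<Longrightarrow> \<not> acc (c j) (c j)"
      "\<And>j. j < m \<Longrightarrow> Q.ipred (c (Suc j)) (c j)"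
    and p: "p \<in> Q.W" "Q.risol p" "\<And>u. u \<in> Q.W \<Longrightarrow> \<not> le u p \<longleftrightarrow> le (c m) u"
  shows "pg (UPP p) (UPP (c 0))"
  using pg_chain[of m c, OF c S1.upset_UP[OF p(1,2)] _ S2.upset_UP[OF p(1,2)]] p(3) S1.pr_W S2.pr_W
  by (simp add: S1.UP_def S2.UP_def)

lemma ipred_above: "Q.ipred p w \<Longrightarrow> w \<in> Q.W \<Longrightarrow> u \<in> Q.W \<Longrightarrow> \<not> le u p \<longleftrightarrow> le w u"
  unfolding Q.ipred_def using Q.le_trans by blast

lemma above_chain_cases:
  assumes "d \<in> Q.W" "w \<in> Q.W" "\<not> le w d" "\<not> acc w w"
  obtains (inf) c where "c 0 = w" "\<And>j. c j \<in> Q.W" "\<And>j. \<not> le (c j) d" "\<And>j. \<not> acc (c j) (c j)"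
      "\<And>j. Q.ipred (c (Suc j)) (c j)"
  | (bot) c m where "c 0 = w" "\<And>j. j \<le> m \<Longrightarrow> c j \<in> Q.W" "\<And>j. j \<le> m \<Longrightarrow> \<not> acc (c j) (c j)"
      "\<And>j. j < m \<Longrightarrow> Q.ipred (c (Suc j)) (c j)" "Q.ipred d (c m)"
  | (refl) c m p where "c 0 = w" "\<And>j. j \<le> m \<Longrightarrow> c j \<in> Q.W" "\<And>j. j \<le> m \<Longrightarrow> \<not> acc (c j) (c j)"
      "\<And>j. j < m \<Longrightarrow> Q.ipred (c (Suc j)) (c j)" "Q.ipred p (c m)" "p \<in> Q.W" "Q.risol p"
      "\<not> le p d" "acc p p" "le p w" "\<not> le w p"
proof (rule Q.pred_chain_cases[of "{u \<in> Q.W. \<not> le u d}" w])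
  show "v \<in> {u \<in> Q.W. \<not> le u d}" if "u \<in> {u \<in> Q.W. \<not> le u d}" "v \<in> Q.W" "le u v" for u v
    using that Q.le_trans assms(1) by blast
  fix c :: "nat \<Rightarrow> form set"
  assume "c 0 = w" "\<And>j. c j \<in> {u \<in> Q.W. \<not> le u d}" "\<And>j. \<not> acc (c j) (c j)"
    "\<And>j. Q.ipred (c (Suc j)) (c j)"
  then show thesis using inf[of c] by blast
next
  fix c :: "nat \<Rightarrow> form set" and m
  assume b: "c 0 = w" "\<And>j. j \<le> m \<Longrightarrow> c j \<in> {u \<in> Q.W. \<not> le u d}" "\<And>j. j \<le> m \<Longrightarrow> \<not> acc (c j) (c j)"
    "\<And>j. j < m \<Longrightarrow> Q.ipred (c (Suc j)) (c j)" "\<And>u. u \<in> {u \<in> Q.W. \<not> le u d} \<Longrightarrow> le (c m) u"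
  have "Q.ipred d (c m)" unfolding Q.ipred_def using b(2)[of m] b(5) assms(1) by blast
  then show thesis using bot[of c m] b by blast
next
  fix c :: "nat \<Rightarrow> form set" and m p
  assume b: "c 0 = w" "\<And>j. j \<le> m \<Longrightarrow> c j \<in> {u \<in> Q.W. \<not> le u d}" "\<And>j. j \<le> m \<Longrightarrow> \<not> acc (c j) (c j)"
    "\<And>j. j < m \<Longrightarrow> Q.ipred (c (Suc j)) (c j)" "Q.ipred p (c m)" "p \<in> {u \<in> Q.W. \<not> le u d}" "acc p p"
  have cW: "c j \<in> Q.W" if "j \<le> m" for j using b(2)[OF that] by blast
  have p: "p \<in> Q.W" "\<not> le p d" using b(6) by auto
  have r: "Q.risol p" using Q.ipred_risol_irr[OF cW[of m] b(3)[of m] b(5)] by simp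
  have pm: "\<not> le (c m) p" using b(5) by (simp add: Q.ipred_def)
  have "le (c m) w"
  proof (cases "m = 0")
    case False
    then show ?thesis using Q.chain_acc[of m c m 0] cW b acc_le by auto
  qed (use b in simp)
  moreover have "le p (c m)" using pm p cW[of m] Q.le_total by blast
  ultimately have "le p w" "\<not> le w p"
    using Q.le_trans[of p "c m" w] Q.le_trans[of "c m" w p] p cW[of m] pm assms(2) by auto
  then show thesis using refl[of c m p] b(1,3,4,5,7) cW p r by blast
qed (use assms in auto)

text \<open>An infinite irreflexive chain back from \<open>q\<close> that stays after
  \<open>d\<close> has a reflexive limit \<open>a\<close>, and the whole gap becomes a
  \<open>C_frame\<close> with \<open>k = 1\<close> copying the last points over
  \<open>a\<close>.\<close>

lemma pg_limit_chain:
  assumes g: "gap d q" and d: "Q.risol d" and q: "Q.risol q"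
    and c: "c 0 = q" "\<And>j. c j \<in> Q.W" "\<And>j. \<not> le (c j) d" "\<And>j. \<not> acc (c j) (c j)"
      "\<And>j. Q.ipred (c (Suc j)) (c j)"
  shows "pg (UPP d) (UPP q)"
proof -
  have dq: "d \<in> Q.W" "q \<in> Q.W" "\<not> le q d" using g by (auto simp: gap_def)
  have up: "Q.upset (Q.above d)" using Q.upset_above dq d by blast
  obtain a where a: "a \<in> Q.above d" "acc a a" "\<And>j. \<not> le (c j) a"
  proof (rule Q.pred_chain_limit[of "Q.above d" c, OF up _ c(5)])
    show "c j \<in> Q.above d" for j using c(2,3)[of j] by (simp add: Q.above_def)
  qed blast
  have aW: "a \<in> Q.W" "\<not> le a d" using a by (auto simp: Q.above_def)
  have lay: "Q.lay False a q" using Q.layI_chain[of c a] c a by simp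
  have qa: "\<not> le q a" using a(3)[of 0] c by simp
  have le1: "(1::nat) \<le> 2 ^ card \<delta>" by simp
  show ?thesis
  proof (rule pg_single)
    show "S1.M.blocks R\<^sub>1 [copy_model (C_frame False 1) 1 (\<lambda>_. S1.ls a)] (S1.UP d) (S1.UP q) (S1.M.cluster (S1.ls a))"
      by (rule S1.block_limit[OF lay aW(1) a(2) dq(2) q qa S1.upset_UP[OF dq(1) d] _ _ le1])
        (use S1.ls[OF aW(1)] aW(2) gap_rel[OF g] S1.pr_root in \<open>auto simp: S1.UP_def S1.M.cluster_def\<close>)
    show "S2.M.blocks R\<^sub>2 [copy_model (C_frame False 1) 1 (\<lambda>_. S2.ls a)] (S2.UP d) (S2.UP q) (S2.M.cluster (S2.ls a))"
      by (rule S2.block_limit[OF lay aW(1) a(2) dq(2) q qa S2.upset_UP[OF dq(1) d] _ _ le1])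
        (use S2.ls[OF aW(1)] aW(2) gap_rel[OF g] S2.pr_root in \<open>auto simp: S2.UP_def S2.M.cluster_def\<close>)
    show "Var p \<in> copy 1 (\<lambda>_. S1.ls a) z \<longleftrightarrow> Var p \<in> copy 1 (\<lambda>_. S2.ls a) z" if "p \<in> \<sigma>" for z p
      using ls_Var_eq[OF aW(1) that] by (rule copy_cong)
  qed
qed

text \<open>Two pairs are needed at most when the chain back from an irreflexive \<open>q\<close>
  stops at a reflexive \<open>p\<close>: one reflexive point for everything up to \<open>p\<close>,
  and one chain from there to \<open>q\<close>.\<close>

lemma gap_isolated:
  assumes g: "gap d q" and q: "Q.risol q" and d: "Q.risol d"
  shows "steps 2 (UPP d) (UPP q)"
proof (cases "acc q q")
  case True
  then show ?thesis using steps_mono[OF steps_pg[OF pg_circ[OF g True q d]]] by simp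
next
  case False
  have dq: "d \<in> Q.W" "q \<in> Q.W" "\<not> le q d" using g by (auto simp: gap_def)
  show ?thesis
  proof (rule above_chain_cases[OF dq False])
    fix c :: "nat \<Rightarrow> form set"
    assume "c 0 = q" "\<And>j. c j \<in> Q.W" "\<And>j. \<not> le (c j) d" "\<And>j. \<not> acc (c j) (c j)"
      "\<And>j. Q.ipred (c (Suc j)) (c j)"
    then have "pg (UPP d) (UPP q)" by (rule pg_limit_chain[OF g d q])
    from steps_mono[OF steps_pg[OF this]] show ?thesis by simp
  next
    fix c :: "nat \<Rightarrow> form set" and m
    assume b: "c 0 = q" "\<And>j. j \<le> m \<Longrightarrow> c j \<in> Q.W" "\<And>j. j \<le> m \<Longrightarrow> \<not> acc (c j) (c j)"
      "\<And>j. j < m \<Longrightarrow> Q.ipred (c (Suc j)) (c j)" "Q.ipred d (c m)"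
    have "pg (UPP d) (UPP (c 0))"
      using ipred_above[OF b(5) b(2)[of m]] by (intro pg_chain_UP[of m c] b dq d) auto
    then show ?thesis using steps_mono[OF steps_pg] b(1) by simp
  next
    fix c :: "nat \<Rightarrow> form set" and m p
    assume b: "c 0 = q" "\<And>j. j \<le> m \<Longrightarrow> c j \<in> Q.W" "\<And>j. j \<le> m \<Longrightarrow> \<not> acc (c j) (c j)"
      "\<And>j. j < m \<Longrightarrow> Q.ipred (c (Suc j)) (c j)" "Q.ipred p (c m)" "p \<in> Q.W" "Q.risol p"
      "\<not> le p d" "acc p p" "le p q" "\<not> le q p"
    have "pg (UPP p) (UPP (c 0))"
      using ipred_above[OF b(5) b(2)[of m]] by (intro pg_chain_UP[of m c] b) auto
    moreover have "pg (UPP d) (UPP p)"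
      using pg_circ[OF gap_trans(1)[OF g b(6,10,8)] b(9,7) d] .
    ultimately have "steps (1 + 1) (UPP d) (UPP (c 0))" by (intro steps_trans[OF steps_pg steps_pg])
    then show ?thesis using b(1) by (simp add: numeral_2_eq_2)
  qed
qed

text \<open>When \<open>d\<close> is not right-isolated, layers accumulating towards it must be
  found. Either the reflexive right-isolated clusters between \<open>d\<close> and \<open>q\<close>
  have no least one and serve as layers themselves, or before the least one an infinite chain of
  irreflexive points runs back.\<close>

lemma gap_limit_refl:
  assumes g: "gap d q" and q: "Q.risol q" "acc q q" and d: "\<not> Q.risol d"
  shows "\<exists>p r. Q.risol p \<and> gap d p \<and> Q.lay r d p \<and> steps 1 (UPP p) (UPP q)"
proof -
  have dq: "d \<in> Q.W" "q \<in> Q.W" "\<not> le q d" using g by (auto simp: gap_def)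
  define P where "P p \<longleftrightarrow> p \<in> Q.W \<and> Q.risol p \<and> acc p p \<and> \<not> le p d \<and> le p q" for p
  have Pq: "P q" using dq q by (simp add: P_def)
  show ?thesis
  proof (cases "\<forall>p. P p \<longrightarrow> (\<exists>p'. P p' \<and> \<not> le p p')")
    case True
    define c where "c = rec_nat q (\<lambda>_ u. SOME p. P p \<and> \<not> le u p)"
    have c0: "c 0 = q" and cS: "c (Suc j) = (SOME p. P p \<and> \<not> le (c j) p)" for j by (simp_all add: c_def)
    have cP: "P (c j)" for j
    proof (induction j)
      case (Suc j)
      then have "\<exists>p'. P p' \<and> \<not> le (c j) p'" using True by blast
      from someI_ex[OF this] show ?case unfolding cS by blast
    qed (use Pq c0 in simp)
    have cl: "\<not> le (c j) (c (Suc j))" for j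
    proof -
      have "\<exists>p'. P p' \<and> \<not> le (c j) p'" using True cP by blast
      from someI_ex[OF this] show ?thesis unfolding cS by blast
    qed
    have "Q.lay True d q" unfolding Q.lay_def
      using cP cl c0 by (intro allI exI[of _ c]) (auto simp: P_def)
    then show ?thesis using q g steps_mono[OF steps_refl, of 1] by blast
  next
    case False
    then obtain p1 where p1: "p1 \<in> Q.W" "Q.risol p1" "acc p1 p1" "\<not> le p1 d" "le p1 q"
      and mn: "\<And>p'. P p' \<Longrightarrow> le p1 p'" unfolding P_def by blast
    \<comment> \<open>\<open>m\<close> cannot lie in the cluster of \<open>d\<close>, which is not
      isolated, and it is irreflexive because \<open>p1\<close> is least. Its predecessors neither
      end at \<open>d\<close>, which would isolate \<open>d\<close>, nor reach a reflexive point,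
      which would precede \<open>p1\<close>.\<close>
    obtain m where m: "m \<in> Q.W" "Q.risol m" "le d m" "\<not> acc p1 m"
      using Q.risol_between[OF dq(1) p1(1,4)] .
    have m1: "\<not> le p1 m" using m(4) p1(3) by (auto simp: le_def)
    have md: "\<not> le m d" using m d Q.risol_cong[OF m(1) dq(1)] by blast
    have mp1: "le m p1" using m1 m(1) p1(1) Q.le_total by blast
    have mq: "le m q" "\<not> le q m"
      using Q.le_trans[of m p1 q] Q.le_trans[of p1 q m] m(1) p1 dq mp1 m1 by blast+
    have irr: "\<not> acc m m" using mn[of m] m m1 md mq by (auto simp: P_def)
    have gm: "gap d m" "gap m q" using gap_trans[OF g m(1) mq(1) md] mq(2) by auto
    have st: "steps 1 (UPP m) (UPP q)" using steps_pg[OF pg_circ[OF gm(2) q(2,1) m(2)]] .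
    show ?thesis
    proof (rule above_chain_cases[OF dq(1) m(1) md irr])
      fix c :: "nat \<Rightarrow> form set"
      assume c: "c 0 = m" "\<And>j. c j \<in> Q.W" "\<And>j. \<not> le (c j) d" "\<And>j. \<not> acc (c j) (c j)"
        "\<And>j. Q.ipred (c (Suc j)) (c j)"
      have "Q.lay False d m" using Q.layI_chain[of c d] c by simp
      then show ?thesis using m(2) gm(1) st by blast
    next
      fix c :: "nat \<Rightarrow> form set" and n
      assume "\<And>j. j \<le> n \<Longrightarrow> c j \<in> Q.W" "\<And>j. j \<le> n \<Longrightarrow> \<not> acc (c j) (c j)" "Q.ipred d (c n)"
      then show ?thesis using Q.ipred_risol_irr[of "c n" d] d by blast
    next
      fix p assume p: "p \<in> Q.W" "Q.risol p" "\<not> le p d" "acc p p" "le p m" "\<not> le m p"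
      have "le p q" using Q.le_trans[OF p(1) m(1) dq(2) p(5) mq(1)] .
      then have "le p1 p" using mn p by (simp add: P_def)
      then have "le p1 m" using Q.le_trans[OF p1(1) p(1) m(1) _ p(5)] by blast
      then show ?thesis using m1 by blast
    qed
  qed
qed

text \<open>For irreflexive \<open>q\<close> the chain back from it either is infinite and gives the
  layers directly, or stops at a reflexive point from which the reflexive case takes over; this
  accounts for the second step.\<close>

lemma gap_limit:
  assumes g: "gap d q" and q: "Q.risol q" and d: "\<not> Q.risol d"
  shows "\<exists>p r. Q.risol p \<and> gap d p \<and> Q.lay r d p \<and> steps 2 (UPP p) (UPP q)"
proof (cases "acc q q")
  case True
  then show ?thesis using gap_limit_refl[OF g q True d] steps_mono[of 1 _ _ 2] by fastforce
next
  case False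
  have dq: "d \<in> Q.W" "q \<in> Q.W" "\<not> le q d" using g by (auto simp: gap_def)
  show ?thesis
  proof (rule above_chain_cases[OF dq False])
    fix c :: "nat \<Rightarrow> form set"
    assume c: "c 0 = q" "\<And>j. c j \<in> Q.W" "\<And>j. \<not> le (c j) d" "\<And>j. \<not> acc (c j) (c j)"
      "\<And>j. Q.ipred (c (Suc j)) (c j)"
    have "Q.lay False d q" using Q.layI_chain[of c d] c by simp
    then show ?thesis using q g steps_mono[OF steps_refl, of 2] by blast
  next
    fix c :: "nat \<Rightarrow> form set" and n
    assume "\<And>j. j \<le> n \<Longrightarrow> c j \<in> Q.W" "\<And>j. j \<le> n \<Longrightarrow> \<not> acc (c j) (c j)" "Q.ipred d (c n)"
    then show ?thesis using Q.ipred_risol_irr[of "c n" d] d by blast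
  next
    fix c :: "nat \<Rightarrow> form set" and m p
    assume b: "c 0 = q" "\<And>j. j \<le> m \<Longrightarrow> c j \<in> Q.W" "\<And>j. j \<le> m \<Longrightarrow> \<not> acc (c j) (c j)"
      "\<And>j. j < m \<Longrightarrow> Q.ipred (c (Suc j)) (c j)" "Q.ipred p (c m)" "p \<in> Q.W" "Q.risol p"
      "\<not> le p d" "acc p p" "le p q" "\<not> le q p"
    have "pg (UPP p) (UPP (c 0))"
      using ipred_above[OF b(5) b(2)[of m]] by (intro pg_chain_UP[of m c] b) auto
    then have st: "steps 1 (UPP p) (UPP q)" using steps_pg b(1) by simp
    obtain p' r where p': "Q.risol p'" "gap d p'" "Q.lay r d p'" "steps 1 (UPP p') (UPP p)"
      using gap_limit_refl[OF gap_trans(1)[OF g b(6,10,8)] b(7,9) d] by blast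
    have "steps 2 (UPP p') (UPP q)" using steps_trans[OF p'(4) st] by (simp add: numeral_2_eq_2)
    then show ?thesis using p' by blast
  qed
qed

abbreviation start1 :: "form set \<Rightarrow> form set set \<Rightarrow> bool" where
  "start1 d U \<equiv> K43_start L \<delta> x\<^sub>1 \<sigma> t R\<^sub>1 d U"

abbreviation start2 :: "form set \<Rightarrow> form set set \<Rightarrow> bool" where
  "start2 d U \<equiv> K43_start L \<delta> x\<^sub>2 \<sigma> t R\<^sub>2 d U"

text \<open>Both final clusters realize exactly the types of the cluster of \<open>d\<close>, and no
  other types occur in either sum, which is matching of kind (b).\<close>

lemma pg_fibre:
  assumes s1: "start1 d U\<^sub>1" and s2: "start2 d U\<^sub>2" and r: "Q.risol d"
  shows "pg (U\<^sub>1, U\<^sub>2) (UPP d)"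
proof -
  interpret T1: K43_start L \<delta> x\<^sub>1 \<sigma> t R\<^sub>1 d U\<^sub>1 by fact
  interpret T2: K43_start L \<delta> x\<^sub>2 \<sigma> t R\<^sub>2 d U\<^sub>2 by fact
  obtain Ms\<^sub>1 k\<^sub>1 c\<^sub>1 where m1: "length Ms\<^sub>1 \<le> 2 * card R\<^sub>1" "0 < (k\<^sub>1::nat)"
    "S1.M.blocks R\<^sub>1 (Ms\<^sub>1 @ [copy_model (refl_cluster k\<^sub>1) k\<^sub>1 c\<^sub>1]) U\<^sub>1 (S1.UP d) T1.D"
    "at_type \<sigma> (osum_model (Ms\<^sub>1 @ [copy_model (refl_cluster k\<^sub>1) k\<^sub>1 c\<^sub>1])) `
       worlds (frame_of (osum_model (Ms\<^sub>1 @ [copy_model (refl_cluster k\<^sub>1) k\<^sub>1 c\<^sub>1]))) \<subseteq> lit_type \<sigma> ` Q.cluster d"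
    "lit_type \<sigma> ` Q.cluster d \<subseteq>
       at_type \<sigma> (osum_model (Ms\<^sub>1 @ [copy_model (refl_cluster k\<^sub>1) k\<^sub>1 c\<^sub>1])) ` ({length Ms\<^sub>1} \<times> A ` {..<k\<^sub>1})"
    using T1.fibre_blocks[OF r] .
  obtain Ms\<^sub>2 k\<^sub>2 c\<^sub>2 where m2: "length Ms\<^sub>2 \<le> 2 * card R\<^sub>2" "0 < (k\<^sub>2::nat)"
    "S2.M.blocks R\<^sub>2 (Ms\<^sub>2 @ [copy_model (refl_cluster k\<^sub>2) k\<^sub>2 c\<^sub>2]) U\<^sub>2 (S2.UP d) T2.D"
    "at_type \<sigma> (osum_model (Ms\<^sub>2 @ [copy_model (refl_cluster k\<^sub>2) k\<^sub>2 c\<^sub>2])) `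
       worlds (frame_of (osum_model (Ms\<^sub>2 @ [copy_model (refl_cluster k\<^sub>2) k\<^sub>2 c\<^sub>2]))) \<subseteq> lit_type \<sigma> ` Q.cluster d"
    "lit_type \<sigma> ` Q.cluster d \<subseteq>
       at_type \<sigma> (osum_model (Ms\<^sub>2 @ [copy_model (refl_cluster k\<^sub>2) k\<^sub>2 c\<^sub>2])) ` ({length Ms\<^sub>2} \<times> A ` {..<k\<^sub>2})"
    using T2.fibre_blocks[OF r] .
  let ?N1 = "Ms\<^sub>1 @ [copy_model (refl_cluster k\<^sub>1) k\<^sub>1 c\<^sub>1]" and ?N2 = "Ms\<^sub>2 @ [copy_model (refl_cluster k\<^sub>2) k\<^sub>2 c\<^sub>2]"
  let ?C1 = "{length Ms\<^sub>1} \<times> A ` {..<k\<^sub>1}" and ?C2 = "{length Ms\<^sub>2} \<times> A ` {..<k\<^sub>2}"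
  have "matching_b \<sigma> (osum_model ?N1) (osum_model ?N2)"
    unfolding matching_b_def
  proof (rule exI[of _ ?C1], rule exI[of _ ?C2], intro conjI ballI)
    show "final_cluster (frame_of (osum_model ?N1)) ?C1" "\<not> degenerate (frame_of (osum_model ?N1)) ?C1"
      using final_cluster_osum[OF m1(2), of "map frame_of Ms\<^sub>1"] by (simp_all add: frame_of_osum)
    show "final_cluster (frame_of (osum_model ?N2)) ?C2" "\<not> degenerate (frame_of (osum_model ?N2)) ?C2"
      using final_cluster_osum[OF m2(2), of "map frame_of Ms\<^sub>2"] by (simp_all add: frame_of_osum)
    fix y assume "y \<in> worlds (frame_of (osum_model ?N1))"
    then have "at_type \<sigma> (osum_model ?N1) y \<in> at_type \<sigma> (osum_model ?N2) ` ?C2"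
      using m1(4) m2(5) by blast
    then show "\<exists>z\<in>?C2. at_type \<sigma> (osum_model ?N1) y = at_type \<sigma> (osum_model ?N2) z" by (rule imageE) blast
  next
    fix y assume "y \<in> worlds (frame_of (osum_model ?N2))"
    then have "at_type \<sigma> (osum_model ?N2) y \<in> at_type \<sigma> (osum_model ?N1) ` ?C1"
      using m2(4) m1(5) by blast
    then show "\<exists>z\<in>?C1. at_type \<sigma> (osum_model ?N1) z = at_type \<sigma> (osum_model ?N2) y"
      by (rule imageE) (rule bexI, rule sym, assumption+)
  qed
  then have "sigma_matching \<delta> \<sigma> ?N1 ?N2" by (simp add: sigma_matching_def)
  then show ?thesis using m1(1) m2(1) bound by (intro pgI[OF m1(3) m2(3)]) auto
qed

lemma pg_fibre_limit:
  assumes s1: "start1 d U\<^sub>1" and s2: "start2 d U\<^sub>2" and nr: "\<not> Q.risol d"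
    and p: "Q.risol p" "gap d p" "Q.lay r d p"
  shows "pg (U\<^sub>1, U\<^sub>2) (UPP p)"
proof -
  interpret T1: K43_start L \<delta> x\<^sub>1 \<sigma> t R\<^sub>1 d U\<^sub>1 by fact
  interpret T2: K43_start L \<delta> x\<^sub>2 \<sigma> t R\<^sub>2 d U\<^sub>2 by fact
  have pW: "p \<in> Q.W" "\<not> le p d" using p by (auto simp: gap_def)
  let ?C = "Q.cluster d"
  have fin: "finite ?C" using Q.finite_cluster T1.d by blast
  obtain q where "bij_betw q {0..<card ?C} ?C" using ex_bij_betw_nat_finite[OF fin] by blast
  then have q: "q ` {..<card ?C} = ?C" by (simp add: bij_betw_def atLeast0LessThan)
  have "d \<in> ?C" using T1.d by (simp add: Q.cluster_def)
  then have k0: "0 < card ?C" using fin card_gt_0_iff by blast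
  \<comment> \<open>Clusters of \<open>Q\<close> are bounded through the shared signature, which is
    contained in \<delta>.\<close>
  have "card ?C \<le> 2 ^ card \<sigma>" using Q.card_cluster T1.d by blast
  also have "\<dots> \<le> 2 ^ card \<delta>"
    using card_mono[OF S1.M.finite_sig S1.sig_sub] by (intro power_increasing) auto
  finally have k: "card ?C \<le> 2 ^ card \<delta>" .
  let ?k = "card ?C"
  obtain Ms\<^sub>1 V\<^sub>1 e\<^sub>1 where m1: "length Ms\<^sub>1 \<le> 2 * card R\<^sub>1" "S1.M.blocks R\<^sub>1 Ms\<^sub>1 U\<^sub>1 V\<^sub>1 T1.D"
    "S1.M.blocks R\<^sub>1 [copy_model (C_frame r ?k) ?k e\<^sub>1] V\<^sub>1 (S1.UP p) T1.D"
    "\<forall>M\<in>set Ms\<^sub>1. \<forall>y\<in>worlds (frame_of M). at_type \<sigma> M y \<in> lit_type \<sigma> ` ?C"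
    "\<forall>i<?k. at_type \<sigma> (copy_model (C_frame r ?k) ?k e\<^sub>1) (A i) = lit_type \<sigma> (q i)"
    using T1.fibre_limit_blocks[OF nr p(3) pW(1) p(1) pW(2) gap_rel(1)[OF p(2)] k0 k q] .
  obtain Ms\<^sub>2 V\<^sub>2 e\<^sub>2 where m2: "length Ms\<^sub>2 \<le> 2 * card R\<^sub>2" "S2.M.blocks R\<^sub>2 Ms\<^sub>2 U\<^sub>2 V\<^sub>2 T2.D"
    "S2.M.blocks R\<^sub>2 [copy_model (C_frame r ?k) ?k e\<^sub>2] V\<^sub>2 (S2.UP p) T2.D"
    "\<forall>M\<in>set Ms\<^sub>2. \<forall>y\<in>worlds (frame_of M). at_type \<sigma> M y \<in> lit_type \<sigma> ` ?C"
    "\<forall>i<?k. at_type \<sigma> (copy_model (C_frame r ?k) ?k e\<^sub>2) (A i) = lit_type \<sigma> (q i)"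
    using T2.fibre_limit_blocks[OF nr p(3) pW(1) p(1) pW(2) gap_rel(2)[OF p(2)] k0 k q] .
  let ?M1 = "copy_model (C_frame r ?k) ?k e\<^sub>1" and ?M2 = "copy_model (C_frame r ?k) ?k e\<^sub>2"
  let ?N1 = "Ms\<^sub>1 @ [?M1]" and ?N2 = "Ms\<^sub>2 @ [?M2]"
  have onto: "\<exists>z\<in>root_cluster ?k. at_type \<sigma> ?M1 z = T" "\<exists>z\<in>root_cluster ?k. at_type \<sigma> ?M2 z = T"
    if "T \<in> lit_type \<sigma> ` ?C" for T
  proof -
    have "T \<in> lit_type \<sigma> ` q ` {..<?k}" using that q by simp
    then obtain j where j: "j < ?k" "T = lit_type \<sigma> (q j)" by blast
    then have "A j \<in> root_cluster ?k" by (simp add: root_cluster_alt)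
    then show "\<exists>z\<in>root_cluster ?k. at_type \<sigma> ?M1 z = T" "\<exists>z\<in>root_cluster ?k. at_type \<sigma> ?M2 z = T"
      using m1(5) m2(5) j by blast+
  qed
  have "matching_c \<delta> \<sigma> ?N1 ?N2"
    unfolding matching_c_def
  proof (intro conjI exI[of _ r] exI[of _ ?k] ballI)
    fix y assume "y \<in> root_cluster ?k"
    then show "at_type \<sigma> (last ?N1) y = at_type \<sigma> (last ?N2) y"
      using m1(5) m2(5) by (auto simp: root_cluster_alt)
  next
    fix M y assume "M \<in> set (butlast ?N1)" "y \<in> worlds (frame_of M)"
    then have "at_type \<sigma> M y \<in> lit_type \<sigma> ` ?C" using m1(4) by simp
    then show "\<exists>z\<in>root_cluster ?k. at_type \<sigma> M y = at_type \<sigma> (last ?N2) z" using onto(2) by fastforce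
  next
    fix M y assume "M \<in> set (butlast ?N2)" "y \<in> worlds (frame_of M)"
    then have "at_type \<sigma> M y \<in> lit_type \<sigma> ` ?C" using m2(4) by simp
    then show "\<exists>z\<in>root_cluster ?k. at_type \<sigma> (last ?N1) z = at_type \<sigma> M y" using onto(1) by simp
  qed (use k0 k in auto)
  then have "sigma_matching \<delta> \<sigma> ?N1 ?N2" by (simp add: sigma_matching_def)
  then show ?thesis
    using m1(1) m2(1) bound
    by (intro pgI[OF S1.M.blocks_append[OF m1(2,3)] S2.M.blocks_append[OF m2(2,3)]]) auto
qed

text \<open>The cut must come after all relevant points strictly before \<open>d\<close>, of which
  \<open>b\<close> is the greatest. If \<open>d\<close> has an immediate predecessor, the cut is
  placed there; if not, \<open>d\<close> is a limit from the left and any right-isolated point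
  between \<open>b\<close> and \<open>d\<close> will do.\<close>

lemma start_exists:
  assumes d: "d \<in> Q.W" "acc d d" and dt: "\<not> le d t"
  obtains p where "p \<in> Q.W" "Q.risol p" "\<not> le d p" "start1 d (S1.UP p)" "start2 d (S2.UP p)"
proof -
  let ?S = "{r \<in> RQ. \<not> le d r}"
  have S: "finite ?S" "?S \<noteq> {}" "?S \<subseteq> Q.W" using RQ dt by auto
  obtain b where b': "b \<in> ?S" "\<forall>r\<in>?S. le r b"
    by (rule Q.finite_greatest[OF S])
  then have b: "b \<in> Q.W" "\<not> le d b" "\<And>r. r \<in> RQ \<Longrightarrow> \<not> le d r \<Longrightarrow> le r b"
    using S(3) by auto
  let ?lim = "\<forall>q\<in>Q.W. \<not> le d q \<longrightarrow> (\<exists>q'\<in>Q.W. \<not> le q' q \<and> \<not> le d q')"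
  obtain p where p: "p \<in> Q.W" "Q.risol p" "\<not> le d p" "le b p" "(\<forall>u\<in>Q.W. \<not> le u p \<longrightarrow> le d u) \<or> ?lim"
  proof (cases "\<exists>p. Q.ipred p d")
    case True
    then obtain p where p: "Q.ipred p d" by blast
    then show thesis using that[of p] Q.ipred_risol_refl[OF d p] b unfolding Q.ipred_def by blast
  next
    case False
    then have "?lim" unfolding Q.ipred_def by blast
    moreover obtain m where m: "m \<in> Q.W" "Q.risol m" "le b m" "\<not> acc d m"
      using Q.risol_between[OF b(1) d(1) b(2)] .
    moreover have "\<not> le d m" using m d by (auto simp: le_def)
    ultimately show thesis using that by blast
  qed
  have rel: "le r p" if "r \<in> RQ" "\<not> le d r" for r
    using b(3)[OF that] Q.le_trans[of r b p] RQ that b p by blast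
  have s1: "start1 d (S1.UP p)"
  proof (unfold_locales)
    show "d \<in> Q.W" "acc d d" "S1.M.upset (S1.UP p)" using d S1.upset_UP p by auto
    show "(\<forall>u\<in>S1.UP p. le d (S1.pr u)) \<or> ?lim" using p(5) S1.pr_W by (auto simp: S1.UP_def)
    show "le d (S1.pr w)" if "w \<in> R\<^sub>1" "w \<in> S1.UP p" for w
      using rel[of "S1.pr w"] that by (auto simp: S1.UP_def RQ_def)
    show "le d t" if "x\<^sub>1 \<in> S1.UP p" using rel[of t] that RQ S1.pr_root by (auto simp: S1.UP_def)
    show "S1.ls d \<in> S1.UP p" using S1.ls[OF d(1)] p by (simp add: S1.UP_def)
  qed
  have s2: "start2 d (S2.UP p)"
  proof (unfold_locales)
    show "d \<in> Q.W" "acc d d" "S2.M.upset (S2.UP p)" using d S2.upset_UP p by auto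
    show "(\<forall>u\<in>S2.UP p. le d (S2.pr u)) \<or> ?lim" using p(5) S2.pr_W by (auto simp: S2.UP_def)
    show "le d (S2.pr w)" if "w \<in> R\<^sub>2" "w \<in> S2.UP p" for w
      using rel[of "S2.pr w"] that by (auto simp: S2.UP_def RQ_def)
    show "le d t" if "x\<^sub>2 \<in> S2.UP p" using rel[of t] that RQ S2.pr_root by (auto simp: S2.UP_def)
    show "S2.ls d \<in> S2.UP p" using S2.ls[OF d(1)] p by (simp add: S2.UP_def)
  qed
  show thesis using that p s1 s2 by blast
qed

lemma start_root_cluster:
  assumes d: "d \<in> Q.W" "acc d d" and dt: "le d t"
  shows "start1 d S1.M.W" "start2 d S2.M.W"
proof -
  have le: "le d q" if "q \<in> Q.W" for q using Q.le_trans[OF d(1) Q.root_W that dt Q.root_le[OF that]] .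
  show "start1 d S1.M.W"
  proof (unfold_locales)
    show "(\<forall>u\<in>S1.M.W. le d (S1.pr u)) \<or>
      (\<forall>q\<in>Q.W. \<not> le d q \<longrightarrow> (\<exists>q'\<in>Q.W. \<not> le q' q \<and> \<not> le d q'))" using le S1.pr_W by blast
  qed (use d dt le S1.pr_W S1.Rl_sub S1.M.upset_W S1.ls in auto)
  show "start2 d S2.M.W"
  proof (unfold_locales)
    show "(\<forall>u\<in>S2.M.W. le d (S2.pr u)) \<or>
      (\<forall>q\<in>Q.W. \<not> le d q \<longrightarrow> (\<exists>q'\<in>Q.W. \<not> le q' q \<and> \<not> le d q'))" using le S2.pr_W by blast
  qed (use d dt le S2.pr_W S2.Rl_sub S2.M.upset_W S2.ls in auto)
qed

abbreviation rank :: "form set \<Rightarrow> nat" where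
  "rank q \<equiv> card {r \<in> RQ. le r q}"

text \<open>\<open>T\<close> is the cut reached after treating \<open>d\<close>: right after its
  fibre, or further on when \<open>d\<close> is reflexive and not isolated. The cut before the fibre
  has smaller rank, so the hypothesis gives at most \<open>4 * rank d - 4\<close> pairs, and one is
  added.\<close>

lemma steps_relevant:
  assumes d: "d \<in> RQ"
    and IH: "\<And>p. p \<in> Q.W \<Longrightarrow> Q.risol p \<Longrightarrow> rank p < rank d \<Longrightarrow>
      steps (4 * rank p) (S1.M.W, S2.M.W) (UPP p)"
    and refl: "\<And>U\<^sub>1 U\<^sub>2. acc d d \<Longrightarrow> start1 d U\<^sub>1 \<Longrightarrow> start2 d U\<^sub>2 \<Longrightarrow> pg (U\<^sub>1, U\<^sub>2) T"
    and irr: "\<not> acc d d \<Longrightarrow> T = UPP d"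
  shows "steps (4 * rank d - 3) (S1.M.W, S2.M.W) T"
proof -
  have dW: "d \<in> Q.W" using d RQ by blast
  have fin: "finite {r \<in> RQ. le r q}" for q using RQ by simp
  have pos: "0 < rank d" using d fin[of d] card_gt_0_iff[of "{r \<in> RQ. le r d}"] le_refl[of d] by blast
  have less: "rank p < rank d" if "p \<in> Q.W" "\<not> le d p" for p
  proof (rule psubset_card_mono[OF fin])
    have "le p d" using that dW Q.le_total by blast
    then have "{r \<in> RQ. le r p} \<subseteq> {r \<in> RQ. le r d}" using Q.le_trans[of _ p d] RQ(2) that(1) dW by blast
    moreover have "d \<in> {r \<in> RQ. le r d}" "d \<notin> {r \<in> RQ. le r p}" using d that by auto
    ultimately show "{r \<in> RQ. le r p} \<subset> {r \<in> RQ. le r d}" by blast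
  qed
  have ext: "steps (4 * rank d - 3) (S1.M.W, S2.M.W) T"
    if "p \<in> Q.W" "Q.risol p" "\<not> le d p" "pg (UPP p) T" for p
    using steps_mono[OF steps_trans[OF IH[OF that(1,2) less[OF that(1,3)]] steps_pg[OF that(4)]]]
      less[OF that(1,3)] by simp
  have init: "steps (4 * rank d - 3) (S1.M.W, S2.M.W) T" if "pg (S1.M.W, S2.M.W) T"
    using steps_mono[OF steps_pg[OF that]] pos by simp
  show ?thesis
  proof (cases "acc d d")
    case True
    show ?thesis
    proof (cases "le d t")
      case True
      then show ?thesis using init refl start_root_cluster dW \<open>acc d d\<close> by blast
    next
      case False
      then obtain p where "p \<in> Q.W" "Q.risol p" "\<not> le d p" "start1 d (S1.UP p)" "start2 d (S2.UP p)"
        using start_exists dW \<open>acc d d\<close> by blast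
      then show ?thesis using ext refl \<open>acc d d\<close> by blast
    qed
  next
    case False
    show ?thesis
    proof (cases "d = t")
      case True
      have "pg (S1.M.W, S2.M.W) (UPP ((\<lambda>_. d) (0::nat)))"
        by (rule pg_chain[of 0]) (use dW False True Q.root_le S1.pr_W S2.pr_W S1.M.upset_W S2.M.upset_W in auto)
      then show ?thesis using init irr[OF False] by simp
    next
      case dt: False
      then have "\<not> le d t" using Q.lt_irrefl2[OF Q.root_W dW] Q.root_le[OF dW] False by blast
      then obtain p where p: "Q.ipred p d" using Q.irr_ipred[OF dW False Q.root_W] by blast
      have p': "p \<in> Q.W" "\<not> le d p" "Q.risol p"
        using p Q.ipred_risol_irr[OF dW False p] unfolding Q.ipred_def by auto
      have "pg (UPP p) (UPP ((\<lambda>_. d) (0::nat)))"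
        by (rule pg_chain_UP[of 0]) (use dW False p' ipred_above[OF p dW] in auto)
      then show ?thesis using ext[OF p'(1,3,2)] irr[OF False] by simp
    qed
  qed
qed

text \<open>With \<open>d\<close> the last relevant point up to \<open>q\<close>, the fibre of
  \<open>d\<close> is followed by a gap costing at most two pairs, which the \<open>- 3\<close> in
  \<open>steps_relevant\<close> leaves room for.\<close>

lemma steps_main:
  assumes "q \<in> Q.W" "Q.risol q"
  shows "steps (4 * rank q) (S1.M.W, S2.M.W) (UPP q)"
  using assms
proof (induction "rank q" arbitrary: q rule: less_induct)
  case less
  let ?S = "{r \<in> RQ. le r q}"
  have S: "finite ?S" "?S \<noteq> {}" "?S \<subseteq> Q.W" using RQ Q.root_le[OF less(2)] by auto
  obtain d where d: "d \<in> ?S" "\<forall>r\<in>?S. le r d" by (rule Q.finite_greatest[OF S])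
  have dW: "d \<in> Q.W" "d \<in> RQ" "le d q" using d RQ by auto
  have "{r \<in> RQ. le r d} = ?S" using d(2) dW Q.le_trans[OF _ dW(1) less(2) _ dW(3)] RQ(2) by blast
  then have rank: "rank d = rank q" by simp
  have IH: "steps (4 * rank p) (S1.M.W, S2.M.W) (UPP p)" if "p \<in> Q.W" "Q.risol p" "rank p < rank d" for p
    using less(1)[of p] that rank by simp
  have pos: "0 < rank q" using S card_gt_0_iff by blast
  have main: "steps (4 * rank q - 3) (S1.M.W, S2.M.W) (UPP d)" if "Q.risol d"
    using steps_relevant[OF dW(2) IH pg_fibre[OF _ _ that]] rank by simp
  show ?case
  proof (cases "le q d")
    case True
    then have "Q.risol d" using Q.risol_cong[OF dW(1) less(2) dW(3)] less(3) by blast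
    moreover have "UPP d = UPP q"
      using S1.UP_cong[OF dW(1) less(2) True dW(3)] S2.UP_cong[OF dW(1) less(2) True dW(3)] by simp
    ultimately show ?thesis using steps_mono[OF main, of "4 * rank q"] by simp
  next
    case False
    then have g: "gap d q" using d(2) dW less(2) by (auto simp: gap_def)
    show ?thesis
    proof (cases "Q.risol d")
      case True
      then show ?thesis
        using steps_mono[OF steps_trans[OF main gap_isolated[OF g less(3)]], of "4 * rank q"] pos by simp
    next
      case nr: False
      then obtain p r where p: "Q.risol p" "gap d p" "Q.lay r d p" "steps 2 (UPP p) (UPP q)"
        using gap_limit[OF g less(3)] by blast
      have "steps (4 * rank q - 3) (S1.M.W, S2.M.W) (UPP p)"
        using steps_relevant[OF dW(2) IH pg_fibre_limit[OF _ _ nr p(1-3)]] rank Q.irr_risol[OF dW(1)] nr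
        by auto
      from steps_mono[OF steps_trans[OF this p(4)], of "4 * rank q"] show ?thesis using pos by simp
    qed
  qed
qed

text \<open>Applied to a last point of \<open>Q\<close>, after which the remaining cut is empty on
  both sides.\<close>

lemma decomposition:
  obtains N Ms\<^sub>1 Ms\<^sub>2 where "N \<le> 4 * card RQ"
    "S1.M.block R\<^sub>1 (osum_model (map (\<lambda>l. osum_model (Ms\<^sub>1 l)) [0..<N])) S1.M.W {} UNIV"
    "S2.M.block R\<^sub>2 (osum_model (map (\<lambda>l. osum_model (Ms\<^sub>2 l)) [0..<N])) S2.M.W {} UNIV"
    "\<forall>l<N. Ms\<^sub>1 l \<noteq> [] \<and> length (Ms\<^sub>1 l) \<le> bound \<and> (\<forall>M\<in>set (Ms\<^sub>1 l). simple_atomic \<delta> M) \<and>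
       Ms\<^sub>2 l \<noteq> [] \<and> length (Ms\<^sub>2 l) \<le> bound \<and> (\<forall>M\<in>set (Ms\<^sub>2 l). simple_atomic \<delta> M) \<and>
       sigma_matching \<delta> \<sigma> (Ms\<^sub>1 l) (Ms\<^sub>2 l)"
proof -
  obtain q where q: "q \<in> Q.W" "\<And>v. v \<in> Q.W \<Longrightarrow> Top \<in> v \<Longrightarrow> le v q" "Q.risol q"
    using Q.greatest_formula[OF Q.root_W Q.W_Top[OF Q.root_W]] by blast
  have "UPP q = ({}, {})" using q(2) S1.pr_W S2.pr_W by (auto simp: S1.UP_def S2.UP_def)
  then have "steps (4 * rank q) (S1.M.W, S2.M.W) ({}, {})" using steps_main[OF q(1,3)] by simp
  then obtain N where N: "N \<le> 4 * rank q" "(pg ^^ N) (S1.M.W, S2.M.W) ({}, {})" unfolding steps_def by blast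
  have "rank q \<le> card RQ" using RQ by (intro card_mono) auto
  then have N4: "N \<le> 4 * card RQ" using N by simp
  obtain f where f: "f 0 = (S1.M.W, S2.M.W)" "f N = ({}, {})" "\<And>i. i < N \<Longrightarrow> pg (f i) (f (Suc i))"
    using N(2) unfolding relpowp_fun_conv by blast
  have "N \<noteq> 0" using f(1,2) S1.M.root_W by (metis empty_iff fst_conv)
  have "\<forall>i. \<exists>Ms\<^sub>1 Ms\<^sub>2. i < N \<longrightarrow> S1.M.blocks R\<^sub>1 Ms\<^sub>1 (fst (f i)) (fst (f (Suc i))) UNIV \<and>
     S2.M.blocks R\<^sub>2 Ms\<^sub>2 (snd (f i)) (snd (f (Suc i))) UNIV \<and>
     Ms\<^sub>1 \<noteq> [] \<and> Ms\<^sub>2 \<noteq> [] \<and> length Ms\<^sub>1 \<le> bound \<and> length Ms\<^sub>2 \<le> bound \<and> 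
     sigma_matching \<delta> \<sigma> Ms\<^sub>1 Ms\<^sub>2"
    using f(3) unfolding pg_def by blast
  then obtain Ms\<^sub>1 Ms\<^sub>2 where
    b1: "\<And>i. i < N \<Longrightarrow> S1.M.blocks R\<^sub>1 (Ms\<^sub>1 i) (fst (f i)) (fst (f (Suc i))) UNIV" and
    b2: "\<And>i. i < N \<Longrightarrow> S2.M.blocks R\<^sub>2 (Ms\<^sub>2 i) (snd (f i)) (snd (f (Suc i))) UNIV" and
    m: "\<And>i. i < N \<Longrightarrow> Ms\<^sub>1 i \<noteq> [] \<and> Ms\<^sub>2 i \<noteq> [] \<and> length (Ms\<^sub>1 i) \<le> bound \<and> length (Ms\<^sub>2 i) \<le> bound \<and> 
     sigma_matching \<delta> \<sigma> (Ms\<^sub>1 i) (Ms\<^sub>2 i)" by metis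
  show thesis
  proof (rule that[OF N4, of Ms\<^sub>1 Ms\<^sub>2])
    have "S1.M.block R\<^sub>1 (osum_model (map (\<lambda>l. osum_model (Ms\<^sub>1 l)) [0..<N])) (fst (f 0))
       (fst (f (length (map (\<lambda>l. osum_model (Ms\<^sub>1 l)) [0..<N])))) UNIV"
      using b1 m \<open>N \<noteq> 0\<close> S1.M.blocks_block by (intro S1.M.block_osum[of _ _ "\<lambda>i. fst (f i)"]) auto
    then show "S1.M.block R\<^sub>1 (osum_model (map (\<lambda>l. osum_model (Ms\<^sub>1 l)) [0..<N])) S1.M.W {} UNIV"
      using f by simp
    have "S2.M.block R\<^sub>2 (osum_model (map (\<lambda>l. osum_model (Ms\<^sub>2 l)) [0..<N])) (snd (f 0))
       (snd (f (length (map (\<lambda>l. osum_model (Ms\<^sub>2 l)) [0..<N])))) UNIV"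
      using b2 m \<open>N \<noteq> 0\<close> S2.M.blocks_block by (intro S2.M.block_osum[of _ _ "\<lambda>i. snd (f i)"]) auto
    then show "S2.M.block R\<^sub>2 (osum_model (map (\<lambda>l. osum_model (Ms\<^sub>2 l)) [0..<N])) S2.M.W {} UNIV"
      using f by simp
    show "\<forall>l<N. Ms\<^sub>1 l \<noteq> [] \<and> length (Ms\<^sub>1 l) \<le> bound \<and> (\<forall>M\<in>set (Ms\<^sub>1 l). simple_atomic \<delta> M) \<and>
       Ms\<^sub>2 l \<noteq> [] \<and> length (Ms\<^sub>2 l) \<le> bound \<and> (\<forall>M\<in>set (Ms\<^sub>2 l). simple_atomic \<delta> M) \<and>
       sigma_matching \<delta> \<sigma> (Ms\<^sub>1 l) (Ms\<^sub>2 l)"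
      using m S1.M.blocks_simple[OF b1] S2.M.blocks_simple[OF b2] by simp
  qed
qed

end

section \<open>From a missing interpolant to roots and relevant points\<close>

context K43_logic
begin

text \<open>The consequences of \<phi>\<open>\<^sub>1\<close> over \<sigma> are jointly consistent
  with the negation of \<phi>\<open>\<^sub>2\<close>, since otherwise a conjunction of them would be
  an interpolant. The \<sigma>-part of an extension \<open>v\<close> is then consistent with
  \<phi>\<open>\<^sub>1\<close>, because any formula refuting it would be one of these
  consequences.\<close>

lemma inseparable_pair:
  assumes no: "\<not> (\<exists>\<iota>. craig_interpolant L \<phi>\<^sub>1 \<phi>\<^sub>2 \<iota>)"
    and f: "\<phi>\<^sub>1 \<in> Fm \<delta>" "\<phi>\<^sub>2 \<in> Fm \<delta>" and s: "\<sigma> = sig \<phi>\<^sub>1 \<inter> sig \<phi>\<^sub>2" "\<sigma> \<subseteq> \<delta>"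
  obtains u v where "mcs \<delta> u" "mcs \<delta> v" "\<phi>\<^sub>1 \<in> u" "Neg \<phi>\<^sub>2 \<in> v" "u \<inter> Fm \<sigma> = v \<inter> Fm \<sigma>"
proof -
  have sub: "Fm \<sigma> \<subseteq> Fm \<delta>" using Fm_mono s(2) .
  let ?S = "{\<iota> \<in> Fm \<sigma>. Imp \<phi>\<^sub>1 \<iota> \<in> L}"
  have imp: "Imp \<phi>\<^sub>1 (Conj \<phi>s) \<in> L" if "set \<phi>s \<subseteq> ?S" for \<phi>s
    using that
  proof (induction \<phi>s)
    case Nil
    show ?case by (rule taut) simp
  next
    case (Cons \<phi> \<phi>s)
    then have "Imp \<phi>\<^sub>1 \<phi> \<in> L" "Imp \<phi>\<^sub>1 (Conj \<phi>s) \<in> L" by auto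
    then show ?case by (rule taut_mp2) auto
  qed
  have "con (?S \<union> {Neg \<phi>\<^sub>2})"
  proof (rule ccontr)
    assume "\<not> con (?S \<union> {Neg \<phi>\<^sub>2})"
    then obtain as bs where as: "set as \<subseteq> ?S" and bs: "set bs \<subseteq> {Neg \<phi>\<^sub>2}"
      and i: "Imp (Conj as) (Neg (Conj bs)) \<in> L" by (rule not_conD)
    have "Imp (Conj as) \<phi>\<^sub>2 \<in> L" by (rule taut_mp[OF i]) (use bs in auto)
    moreover have "Conj as \<in> Fm \<sigma>" using as by auto
    ultimately have "craig_interpolant L \<phi>\<^sub>1 \<phi>\<^sub>2 (Conj as)"
      using imp[OF as] s(1) unfolding craig_interpolant_def Fm_def by blast
    then show False using no by blast
  qed
  moreover have "?S \<union> {Neg \<phi>\<^sub>2} \<subseteq> Fm \<delta>" using sub f by auto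
  ultimately obtain v where v: "mcs \<delta> v" "?S \<union> {Neg \<phi>\<^sub>2} \<subseteq> v" using mcs_extend by blast
  have "con ((v \<inter> Fm \<sigma>) \<union> {\<phi>\<^sub>1})"
  proof (rule ccontr)
    assume "\<not> con ((v \<inter> Fm \<sigma>) \<union> {\<phi>\<^sub>1})"
    then obtain as bs where as: "set as \<subseteq> v \<inter> Fm \<sigma>" and bs: "set bs \<subseteq> {\<phi>\<^sub>1}"
      and i: "Imp (Conj as) (Neg (Conj bs)) \<in> L" by (rule not_conD)
    have "Imp \<phi>\<^sub>1 (Neg (Conj as)) \<in> L" by (rule taut_mp[OF i]) (use bs in auto)
    moreover have "Conj as \<in> Fm \<sigma>" using as by auto
    ultimately have "Neg (Conj as) \<in> v" using v(2) by auto
    moreover have "Conj as \<in> v" using mcs_Conj[OF v(1)] as by auto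
    ultimately show False using mcs_Neg[OF v(1)] mcs_Fm[OF v(1)] by blast
  qed
  moreover have "(v \<inter> Fm \<sigma>) \<union> {\<phi>\<^sub>1} \<subseteq> Fm \<delta>" using sub f by auto
  ultimately obtain u where u: "mcs \<delta> u" "(v \<inter> Fm \<sigma>) \<union> {\<phi>\<^sub>1} \<subseteq> u" using mcs_extend by blast
  have "u \<inter> Fm \<sigma> = v \<inter> Fm \<sigma>"
  proof (intro equalityI subsetI)
    fix \<psi> assume p: "\<psi> \<in> u \<inter> Fm \<sigma>"
    show "\<psi> \<in> v \<inter> Fm \<sigma>"
    proof (rule ccontr)
      assume "\<psi> \<notin> v \<inter> Fm \<sigma>"
      then have "Neg \<psi> \<in> v \<inter> Fm \<sigma>" using p mcs_Neg[OF v(1)] sub by auto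
      then show False using u p mcs_Neg[OF u(1)] sub by blast
    qed
  qed (use u in auto)
  then show thesis using that u v by blast
qed

text \<open>The root is chosen last among the points over \<open>t\<close> satisfying \<open>\<phi>\<close>; this makes it isolated from
  the right unless it lies in the last cluster over \<open>t\<close>.\<close>

lemma root_and_relevant_points:
  assumes f: "finite \<delta>" "\<sigma> \<subseteq> \<delta>" and u: "mcs \<delta> u" "\<phi> \<in> u" and t: "u \<inter> Fm \<sigma> = t"
  obtains x Rl where "\<phi> \<in> x" "K43_proj L \<delta> x \<sigma> t Rl" "card Rl \<le> card (subforms \<phi>) + 1"
    "\<And>\<psi> y. \<psi> \<in> subforms \<phi> \<Longrightarrow> y \<in> K43_root.W L \<delta> x \<Longrightarrow> \<psi> \<in> y \<Longrightarrow>
       \<exists>w\<in>Rl \<inter> K43_root.W L \<delta> x. \<psi> \<in> w \<and> le y w"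
proof -
  interpret U: K43_root L \<delta> u by unfold_locales (use f u in auto)
  have fs: "finite \<sigma>" using f finite_subset by blast
  have sub: "Fm \<sigma> \<subseteq> Fm \<delta>" using Fm_mono f(2) .
  have restr: "mcs \<sigma> (v \<inter> Fm \<sigma>)" if "mcs \<delta> v" for v
    using that con_subset[of v "v \<inter> Fm \<sigma>"] sub unfolding mcs_def by auto
  have tm: "mcs \<sigma> t" using restr[OF u(1)] t by simp
  have over: "v \<inter> Fm \<sigma> = t" if "mcs \<delta> v" "t \<subseteq> v" for v
  proof -
    have "t \<subseteq> v \<inter> Fm \<sigma>" using that t by auto
    then show ?thesis using mcs_eqI[OF tm restr[OF that(1)]] by simp
  qed
  have "insert \<phi> t \<subseteq> u" using u t by auto
  then obtain x where x: "x \<in> U.W" "insert \<phi> t \<subseteq> x" "\<And>v. v \<in> U.W \<Longrightarrow> insert \<phi> t \<subseteq> v \<Longrightarrow> le v x"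
    using U.greatest_exists[OF U.root_W] by blast
  interpret M: K43_root L \<delta> x by unfold_locales (use f U.W_mcs x in auto)
  interpret Q: K43_root L \<sigma> t by unfold_locales (use fs tm in auto)
  have xt: "x \<inter> Fm \<sigma> = t" using over[OF M.root_mcs] x by blast
  have MU: "v \<in> U.W" if "v \<in> M.W" for v
    using that U.W_succ[OF x(1), of v] x(1) unfolding M.W_def le_def by auto
  have mx: "le v x" if "v \<in> M.W" "insert \<phi> t \<subseteq> v" for v using x(3) MU that by blast
  have le_restr: "le (v \<inter> Fm \<sigma>) (w \<inter> Fm \<sigma>)" if "le v w" for v w
    using that by (auto simp: le_def acc_def)
  have rW: "v \<inter> Fm \<sigma> \<in> Q.W" if "v \<in> M.W" for v
    using restr[OF M.W_mcs[OF that]] le_restr[OF M.root_le[OF that]] xt by (simp add: Q.W_def)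
  let ?S = "{\<psi> \<in> subforms \<phi>. \<exists>y\<in>M.W. \<psi> \<in> y}"
  have "\<forall>\<psi>\<in>?S. \<exists>m. m \<in> M.W \<and> \<psi> \<in> m \<and> (\<forall>v\<in>M.W. \<psi> \<in> v \<longrightarrow> le v m) \<and> M.risol m"
  proof
    fix \<psi> assume "\<psi> \<in> ?S"
    then obtain y where "y \<in> M.W" "\<psi> \<in> y" by blast
    then obtain m where "m \<in> M.W" "\<psi> \<in> m" "\<And>v. v \<in> M.W \<Longrightarrow> \<psi> \<in> v \<Longrightarrow> le v m" "M.risol m"
      using M.greatest_formula[of y \<psi>] by blast
    then show "\<exists>m. m \<in> M.W \<and> \<psi> \<in> m \<and> (\<forall>v\<in>M.W. \<psi> \<in> v \<longrightarrow> le v m) \<and> M.risol m" by blast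
  qed
  from bchoice[OF this] obtain g where g: "\<And>\<psi>. \<psi> \<in> ?S \<Longrightarrow>
      g \<psi> \<in> M.W \<and> \<psi> \<in> g \<psi> \<and> (\<forall>v\<in>M.W. \<psi> \<in> v \<longrightarrow> le v (g \<psi>)) \<and> M.risol (g \<psi>)"
    by blast
  have fin: "finite ?S" by simp
  have cg: "card (g ` ?S) \<le> card (subforms \<phi>)"
    using card_image_le[OF fin, of g] card_mono[of "subforms \<phi>" ?S] by (auto intro: order_trans)
  have cov: "\<exists>w\<in>g ` ?S. w \<in> M.W \<and> \<psi> \<in> w \<and> le y w" if "\<psi> \<in> subforms \<phi>" "y \<in> M.W" "\<psi> \<in> y" for \<psi> y
    using g[of \<psi>] that by blast
  have root: "M.risol x" if "\<not> (\<forall>v\<in>M.W. v \<inter> Fm \<sigma> = t \<longrightarrow> le v x)"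
  proof -
    obtain v where v: "v \<in> M.W" "v \<inter> Fm \<sigma> = t" "\<not> le v x" using \<open>\<not> (\<forall>v\<in>M.W. v \<inter> Fm \<sigma> = t \<longrightarrow> le v x)\<close> by blast
    have "\<not> acc v x" using v acc_le by blast
    then obtain \<psi> where p: "\<psi> \<in> x" "Dia \<psi> \<notin> v" using M.not_accE[OF M.root_W v(1)] by blast
    \<comment> \<open>\<theta> singles out \<open>t\<close> in its cluster and \<psi> keeps the last
      point \<open>m\<close> of the conjunction from passing \<open>v\<close>. So \<open>m\<close>
      lies over \<open>t\<close> and satisfies \<phi>, hence shares the cluster of \<open>x\<close>,
      and \<open>m\<close> is right-isolated.\<close>
    obtain \<theta> where th: "\<theta> \<in> t" "\<And>q. q \<in> Q.cluster t \<Longrightarrow> q \<noteq> t \<Longrightarrow> \<theta> \<notin> q"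
      using Q.isolate[of "Q.cluster t" t] Q.finite_cluster[OF Q.root_W] by (auto simp: Q.cluster_def)
    have "And \<phi> (And \<theta> \<psi>) \<in> x" using x(2) th(1) p(1) M.W_And[OF M.root_W] by auto
    then obtain m where m: "m \<in> M.W" "And \<phi> (And \<theta> \<psi>) \<in> m" "le x m" "M.risol m"
      using M.greatest_formula[OF M.root_W] M.root_le by metis
    have mm: "\<phi> \<in> m" "\<theta> \<in> m" "\<psi> \<in> m" using m(2) M.W_And[OF m(1)] by auto
    have "\<not> acc v m" using M.W_Dia[OF v(1)] m(1) mm(3) p(2) by blast
    then have "le m v" using M.le_total[OF m(1) v(1)] by (auto simp: le_def)
    then have "le (m \<inter> Fm \<sigma>) t" "le t (m \<inter> Fm \<sigma>)" using le_restr[of m v] v le_restr[OF m(3)] xt by auto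
    then have "m \<inter> Fm \<sigma> \<in> Q.cluster t" using rW[OF m(1)] by (simp add: Q.cluster_def)
    moreover have "\<theta> \<in> m \<inter> Fm \<sigma>" using mm(2) th(1) t by auto
    ultimately have "m \<inter> Fm \<sigma> = t" using th(2) by blast
    then have "le m x" using mx[OF m(1)] mm(1) by blast
    then show ?thesis using M.risol_cong[OF M.root_W m(1) m(3)] m(4) by blast
  qed
  \<comment> \<open>The root is added only when it is not last over \<open>t\<close>, the case in
    which it has just been shown to be right-isolated.\<close>
  define Rl where "Rl = (if \<forall>v\<in>M.W. v \<inter> Fm \<sigma> = t \<longrightarrow> le v x then g ` ?S else insert x (g ` ?S))"
  have gR: "g ` ?S \<subseteq> Rl" by (auto simp: Rl_def)
  have "K43_proj L \<delta> x \<sigma> t Rl"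
  proof (unfold_locales)
    show "Rl \<subseteq> M.W" using g M.root_W by (auto simp: Rl_def)
    show "finite Rl" using fin by (simp add: Rl_def)
    show "M.risol w" if "w \<in> Rl" for w using that g root by (auto simp: Rl_def split: if_splits)
    show "x \<in> Rl \<or> (\<forall>v\<in>M.W. v \<inter> Fm \<sigma> = t \<longrightarrow> le v x)" by (auto simp: Rl_def)
  qed (use f xt in auto)
  moreover have "card Rl \<le> card (subforms \<phi>) + 1"
    using cg card_insert_le_m1[of "card (g ` ?S) + 1" "g ` ?S" x] fin
    by (auto simp: Rl_def card_insert_if)
  ultimately show thesis
  proof (rule that[rotated])
    show "\<phi> \<in> x" using x by blast
    show "\<exists>w\<in>Rl \<inter> M.W. \<psi> \<in> w \<and> le y w" if "\<psi> \<in> subforms \<phi>" "y \<in> M.W" "\<psi> \<in> y" for \<psi> y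
      using cov[OF that] gR by blast
  qed
qed

end

lemma card_subforms_le: "card (subforms \<phi>) \<le> flen \<phi>"
  unfolding flen_def sub_def by (rule card_mono) auto

lemma finite_sig_form: "finite (sig \<phi>)"
  by (induction \<phi>) auto

text \<open>The sets of relevant points have at most \<open>n + 1\<close> and \<open>n + 2\<close>
  members, with the root and the extra negation counted. Hence a list has at most
  \<open>2 * (n + 2) + 1\<close> components, which is at most \<open>8 * n\<close>, and there are at
  most \<open>4 * (2 * n + 4)\<close> pairs, which is at most \<open>24 * n\<close>, as
  \<open>n\<close> is positive.\<close>

lemma interpolant_free_models:
  assumes L: "normal_logic L" "logic_K43 \<subseteq> L" and no: "\<not> (\<exists>\<iota>. craig_interpolant L \<phi>\<^sub>1 \<phi>\<^sub>2 \<iota>)"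
    and sig: "\<delta> = sig \<phi>\<^sub>1 \<union> sig \<phi>\<^sub>2" "\<sigma> = sig \<phi>\<^sub>1 \<inter> sig \<phi>\<^sub>2" and n: "n = max (flen \<phi>\<^sub>1) (flen \<phi>\<^sub>2)"
  shows "\<exists>(N\<^sub>1 :: (nat \<times> nat \<times> point) model) z\<^sub>1 (N\<^sub>2 :: (nat \<times> nat \<times> point) model) z\<^sub>2.
       rooted_delta_model \<delta> N\<^sub>1 z\<^sub>1 \<and> rooted_delta_model \<delta> N\<^sub>2 z\<^sub>2 \<and>
       sat N\<^sub>1 z\<^sub>1 \<phi>\<^sub>1 \<and> sat N\<^sub>2 z\<^sub>2 (Neg \<phi>\<^sub>2) \<and>
       frame_for L (frame_of N\<^sub>1) \<and> frame_for L (frame_of N\<^sub>2) \<and>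
       at_type \<sigma> N\<^sub>1 z\<^sub>1 = at_type \<sigma> N\<^sub>2 z\<^sub>2 \<and>
       (\<exists>N \<le> 24 * n. \<exists>Ms\<^sub>1 Ms\<^sub>2 :: nat \<Rightarrow> point model list.
          N\<^sub>1 = osum_model (map (\<lambda>l. osum_model (Ms\<^sub>1 l)) [0..<N]) \<and>
          N\<^sub>2 = osum_model (map (\<lambda>l. osum_model (Ms\<^sub>2 l)) [0..<N]) \<and>
          (\<forall>l<N.
             Ms\<^sub>1 l \<noteq> [] \<and> length (Ms\<^sub>1 l) \<le> 8 * n \<and> (\<forall>M\<in>set (Ms\<^sub>1 l). simple_atomic \<delta> M) \<and>
             Ms\<^sub>2 l \<noteq> [] \<and> length (Ms\<^sub>2 l) \<le> 8 * n \<and> (\<forall>M\<in>set (Ms\<^sub>2 l). simple_atomic \<delta> M) \<and>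
             sigma_matching \<delta> \<sigma> (Ms\<^sub>1 l) (Ms\<^sub>2 l)))"
proof -
  interpret K43_logic L by unfold_locales (use L in auto)
  have fd: "finite \<delta>" "\<sigma> \<subseteq> \<delta>" using finite_sig_form sig by auto
  have f: "\<phi>\<^sub>1 \<in> Fm \<delta>" "\<phi>\<^sub>2 \<in> Fm \<delta>" "Neg \<phi>\<^sub>2 \<in> Fm \<delta>" using sig by (auto simp: Fm_def)
  obtain u v where uv: "mcs \<delta> u" "mcs \<delta> v" "\<phi>\<^sub>1 \<in> u" "Neg \<phi>\<^sub>2 \<in> v" "u \<inter> Fm \<sigma> = v \<inter> Fm \<sigma>"
    using inseparable_pair[OF no f(1,2) sig(2) fd(2)] .
  define t where "t = u \<inter> Fm \<sigma>"
  have tu: "u \<inter> Fm \<sigma> = t" "v \<inter> Fm \<sigma> = t" using uv(5) by (auto simp: t_def)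
  obtain x\<^sub>1 R\<^sub>1 where r1: "\<phi>\<^sub>1 \<in> x\<^sub>1" "K43_proj L \<delta> x\<^sub>1 \<sigma> t R\<^sub>1" "card R\<^sub>1 \<le> card (subforms \<phi>\<^sub>1) + 1"
    "\<And>\<psi> y. \<psi> \<in> subforms \<phi>\<^sub>1 \<Longrightarrow> y \<in> K43_root.W L \<delta> x\<^sub>1 \<Longrightarrow> \<psi> \<in> y \<Longrightarrow>
       \<exists>w\<in>R\<^sub>1 \<inter> K43_root.W L \<delta> x\<^sub>1. \<psi> \<in> w \<and> le y w"
    using root_and_relevant_points[OF fd uv(1,3) tu(1)] by blast
  obtain x\<^sub>2 R\<^sub>2 where r2: "Neg \<phi>\<^sub>2 \<in> x\<^sub>2" "K43_proj L \<delta> x\<^sub>2 \<sigma> t R\<^sub>2" "card R\<^sub>2 \<le> card (subforms (Neg \<phi>\<^sub>2)) + 1"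
    "\<And>\<psi> y. \<psi> \<in> subforms (Neg \<phi>\<^sub>2) \<Longrightarrow> y \<in> K43_root.W L \<delta> x\<^sub>2 \<Longrightarrow> \<psi> \<in> y \<Longrightarrow>
       \<exists>w\<in>R\<^sub>2 \<inter> K43_root.W L \<delta> x\<^sub>2. \<psi> \<in> w \<and> le y w"
    using root_and_relevant_points[OF fd uv(2,4) tu(2)] by blast
  have n1: "1 \<le> n"
  proof -
    have "0 < card (subforms \<phi>\<^sub>1)"
      unfolding card_gt_0_iff using subforms_self[of \<phi>\<^sub>1] finite_subforms[of \<phi>\<^sub>1] by blast
    then show ?thesis using card_subforms_le[of \<phi>\<^sub>1] n by simp
  qed
  have c1: "card R\<^sub>1 \<le> n + 1" using r1(3) card_subforms_le[of \<phi>\<^sub>1] n by simp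
  have "card (subforms (Neg \<phi>\<^sub>2)) \<le> Suc (card (subforms \<phi>\<^sub>2))" by (simp add: card_insert_if)
  then have c2: "card R\<^sub>2 \<le> n + 2" using r2(3) card_subforms_le[of \<phi>\<^sub>2] n by simp
  interpret P1: K43_proj L \<delta> x\<^sub>1 \<sigma> t R\<^sub>1 by (rule r1(2))
  interpret P2: K43_proj L \<delta> x\<^sub>2 \<sigma> t R\<^sub>2 by (rule r2(2))
  interpret K43_pair L \<delta> \<sigma> t x\<^sub>1 x\<^sub>2 R\<^sub>1 R\<^sub>2 "8 * n"
    by unfold_locales (use c1 c2 n1 in auto)
  obtain N Ms\<^sub>1 Ms\<^sub>2 where N: "N \<le> 4 * card RQ"
    and b1: "P1.M.block R\<^sub>1 (osum_model (map (\<lambda>l. osum_model (Ms\<^sub>1 l)) [0..<N])) P1.M.W {} UNIV"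
    and b2: "P2.M.block R\<^sub>2 (osum_model (map (\<lambda>l. osum_model (Ms\<^sub>2 l)) [0..<N])) P2.M.W {} UNIV"
    and m: "\<forall>l<N. Ms\<^sub>1 l \<noteq> [] \<and> length (Ms\<^sub>1 l) \<le> 8 * n \<and> (\<forall>M\<in>set (Ms\<^sub>1 l). simple_atomic \<delta> M) \<and>
       Ms\<^sub>2 l \<noteq> [] \<and> length (Ms\<^sub>2 l) \<le> 8 * n \<and> (\<forall>M\<in>set (Ms\<^sub>2 l). simple_atomic \<delta> M) \<and>
       sigma_matching \<delta> \<sigma> (Ms\<^sub>1 l) (Ms\<^sub>2 l)"
    using decomposition .
  let ?N1 = "osum_model (map (\<lambda>l. osum_model (Ms\<^sub>1 l)) [0..<N])"
  let ?N2 = "osum_model (map (\<lambda>l. osum_model (Ms\<^sub>2 l)) [0..<N])"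
  have N24: "N \<le> 24 * n" using N card_RQ c1 c2 n1 by simp
  obtain z\<^sub>1 where z1: "rooted_delta_model \<delta> ?N1 z\<^sub>1" "sat ?N1 z\<^sub>1 \<phi>\<^sub>1 \<longleftrightarrow> \<phi>\<^sub>1 \<in> x\<^sub>1" "frame_for L (frame_of ?N1)"
    "\<And>p. p \<in> \<delta> \<Longrightarrow> z\<^sub>1 \<in> val ?N1 p \<longleftrightarrow> Var p \<in> x\<^sub>1"
    using P1.M.block_final[OF b1 r1(4) f(1)] by blast
  obtain z\<^sub>2 where z2: "rooted_delta_model \<delta> ?N2 z\<^sub>2" "sat ?N2 z\<^sub>2 (Neg \<phi>\<^sub>2) \<longleftrightarrow> Neg \<phi>\<^sub>2 \<in> x\<^sub>2" "frame_for L (frame_of ?N2)"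
    "\<And>p. p \<in> \<delta> \<Longrightarrow> z\<^sub>2 \<in> val ?N2 p \<longleftrightarrow> Var p \<in> x\<^sub>2"
    using P2.M.block_final[OF b2 r2(4) f(3)] by blast
  have "at_type \<sigma> ?N1 z\<^sub>1 = at_type \<sigma> ?N2 z\<^sub>2"
  proof (rule at_type_eqI)
    fix p assume p: "p \<in> \<sigma>"
    have "Var p \<in> x\<^sub>1 \<longleftrightarrow> Var p \<in> x\<^sub>2" using P1.root_proj P2.root_proj p by (auto simp: set_eq_iff)
    then show "z\<^sub>1 \<in> val ?N1 p \<longleftrightarrow> z\<^sub>2 \<in> val ?N2 p" using z1(4)[of p] z2(4)[of p] p fd(2) by auto
  qed
  moreover have "\<exists>N' \<le> 24 * n. \<exists>Ms\<^sub>1' Ms\<^sub>2' :: nat \<Rightarrow> point model list.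
          ?N1 = osum_model (map (\<lambda>l. osum_model (Ms\<^sub>1' l)) [0..<N']) \<and>
          ?N2 = osum_model (map (\<lambda>l. osum_model (Ms\<^sub>2' l)) [0..<N']) \<and>
          (\<forall>l<N'.
             Ms\<^sub>1' l \<noteq> [] \<and> length (Ms\<^sub>1' l) \<le> 8 * n \<and> (\<forall>M\<in>set (Ms\<^sub>1' l). simple_atomic \<delta> M) \<and>
             Ms\<^sub>2' l \<noteq> [] \<and> length (Ms\<^sub>2' l) \<le> 8 * n \<and> (\<forall>M\<in>set (Ms\<^sub>2' l). simple_atomic \<delta> M) \<and>
             sigma_matching \<delta> \<sigma> (Ms\<^sub>1' l) (Ms\<^sub>2' l))"
    by (rule exI[of _ N], rule conjI[OF N24], rule exI[of _ Ms\<^sub>1], rule exI[of _ Ms\<^sub>2]) (simp add: m)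
  moreover have "sat ?N1 z\<^sub>1 \<phi>\<^sub>1" "sat ?N2 z\<^sub>2 (Neg \<phi>\<^sub>2)" using z1(2) z2(2) r1(1) r2(1) by blast+
  ultimately show ?thesis using z1(1,3) z2(1,3) by - (rule exI[of _ ?N1], rule exI[of _ z\<^sub>1], rule exI[of _ ?N2], rule exI[of _ z\<^sub>2], intro conjI)
qed

theorem theorem4p5:
  shows "\<exists>c d :: nat. \<forall>(L :: form set) (\<phi>\<^sub>1 :: form) (\<phi>\<^sub>2 :: form).
    normal_logic L \<longrightarrow> logic_K43 \<subseteq> L \<longrightarrow> \<not> (\<exists>\<iota>. craig_interpolant L \<phi>\<^sub>1 \<phi>\<^sub>2 \<iota>) \<longrightarrow>
    (let \<delta> = sig \<phi>\<^sub>1 \<union> sig \<phi>\<^sub>2; \<sigma> = sig \<phi>\<^sub>1 \<inter> sig \<phi>\<^sub>2; n = max (flen \<phi>\<^sub>1) (flen \<phi>\<^sub>2) in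
     \<exists>(N\<^sub>1 :: (nat \<times> nat \<times> point) model) x\<^sub>1 (N\<^sub>2 :: (nat \<times> nat \<times> point) model) x\<^sub>2.
       rooted_delta_model \<delta> N\<^sub>1 x\<^sub>1 \<and> rooted_delta_model \<delta> N\<^sub>2 x\<^sub>2 \<and>
       sat N\<^sub>1 x\<^sub>1 \<phi>\<^sub>1 \<and> sat N\<^sub>2 x\<^sub>2 (Neg \<phi>\<^sub>2) \<and>
       frame_for L (frame_of N\<^sub>1) \<and> frame_for L (frame_of N\<^sub>2) \<and>
       at_type \<sigma> N\<^sub>1 x\<^sub>1 = at_type \<sigma> N\<^sub>2 x\<^sub>2 \<and>
       (\<exists>N \<le> c * n. \<exists>Ms\<^sub>1 Ms\<^sub>2 :: nat \<Rightarrow> point model list.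
          N\<^sub>1 = osum_model (map (\<lambda>l. osum_model (Ms\<^sub>1 l)) [0..<N]) \<and>
          N\<^sub>2 = osum_model (map (\<lambda>l. osum_model (Ms\<^sub>2 l)) [0..<N]) \<and>
          (\<forall>l<N.
             Ms\<^sub>1 l \<noteq> [] \<and> length (Ms\<^sub>1 l) \<le> d * n \<and> (\<forall>M\<in>set (Ms\<^sub>1 l). simple_atomic \<delta> M) \<and>
             Ms\<^sub>2 l \<noteq> [] \<and> length (Ms\<^sub>2 l) \<le> d * n \<and> (\<forall>M\<in>set (Ms\<^sub>2 l). simple_atomic \<delta> M) \<and>
             sigma_matching \<delta> \<sigma> (Ms\<^sub>1 l) (Ms\<^sub>2 l))))"
  unfolding Let_def
  by (intro exI[of _ 24] exI[of _ 8] allI impI interpolant_free_models) simp_all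

end
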